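(* Let $(\mathcal{C},\mathcal{D})$ be a regular $C^*$-inclusion and let $\mathcal{M}\subseteq\mathcal{C}$ be a norm-closed $\mathcal{D}$-bimodule. If $\phi\in\mathcal{E}^1(\mathcal{M})$, then there are an intertwiner $v\in\mathcal{M}$ and $\rho\in\hat{\mathcal{D}}$ so that $\phi=[v,\rho]|_{\mathcal{M}}$. Conversely, if $v\in\mathcal{N}(\mathcal{M})$ and $\rho\in\hat{\mathcal{D}}$ satisfies $\rho(v^*v)>0$, then $[v,\rho]|_{\mathcal{M}}\in\mathcal{E}^1(\mathcal{M})$.
   Context: Let $\mathcal{C}$ be a unital $C^*$-algebra and $\mathcal{D}\subseteq\mathcal{C}$ an abelian $C^*$-subalgebra containing the unit. For a subspace $\mathcal{M}\subseteq\mathcal{C}$, $\mathcal{N}(\mathcal{M})=\{v\in\mathcal{M}:v\mathcal{D}v^*\cup v^*\mathcal{D}v\subseteq\mathcal{D}\}$. An intertwiner is a nonzero $v$ with $v\mathcal{D}=\mathcal{D}v$. $\mathcal{D}$ has the extension property in $\mathcal{C}$ if every pure state of $\mathcal{D}$ has a unique extension to a state of $\mathcal{C}$ and no pure state of $\mathcal{C}$ annihilates $\mathcal{D}$. $(\mathcal{C},\mathcal{D})$ is a regular $C^*$-inclusion if $\mathcal{D}$ is a maximal abelian $C^*$-subalgebra of the unital $C^*$-algebra $\mathcal{C}$, $\mathcal{D}$ has the extension property in $\mathcal{C}$, and the closed linear span of $\mathcal{N}(\mathcal{C})$ is $\mathcal{C}$. In that case there is a unique conditional expectation $E:\mathcal{C}\to\mathcal{D}$.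 $\hat{\mathcal{D}}$ is the character space of $\mathcal{D}$; each $\rho\in\hat{\mathcal{D}}$ is also regarded as the state $\rho\circ E$ of $\mathcal{C}$. A $\mathcal{D}$-bimodule $\mathcal{M}\subseteq\mathcal{C}$ is a subspace with $d\,m\,e\in\mathcal{M}$ for $d,e\in\mathcal{D}$, $m\in\mathcal{M}$. $\mathcal{E}^1(\mathcal{M})$ is the set of norm-one bounded linear functionals $\phi$ on $\mathcal{M}$ such that for every $d\in\mathcal{D}$ the functionals $m\mapsto\phi(dm)$ and $m\mapsto\phi(md)$ are scalar multiples of $\phi$. For $v\in\mathcal{N}(\mathcal{C})$ and $\rho\in\hat{\mathcal{D}}$ with $\rho(v^*v)>0$, $[v,\rho]$ is the functional $[v,\rho](x)=\rho(v^*x)/\rho(v^*v)^{1/2}$ on $\mathcal{C}$ (writing $[v,\rho]$ presupposes $\rho(v^*v)>0$). *)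

theory Defs
  imports "HOL-Analysis.Analysis"
begin

section \<open>Unital C*-algebras\<close>

text \<open>Unital complex C*-algebras as a type class. The real scalar multiplication inherited from
  the library is the restriction of the complex one. Inheriting from
  \<^class>\<open>real_normed_algebra_1\<close> entails \<open>1 \<noteq> 0\<close>.\<close>

class cstar_algebra = real_normed_algebra_1 + banach +
  fixes scaleC :: "complex \<Rightarrow> 'a \<Rightarrow> 'a" (infixr "*\<^sub>C" 75)
    and adj :: "'a \<Rightarrow> 'a"
  assumes scaleR_scaleC: "r *\<^sub>R x = complex_of_real r *\<^sub>C x"
    and scaleC_add_right: "c *\<^sub>C (x + y) = c *\<^sub>C x + c *\<^sub>C y"
    and scaleC_add_left: "(b + c) *\<^sub>C x = b *\<^sub>C x + c *\<^sub>C x"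
    and scaleC_scaleC: "b *\<^sub>C (c *\<^sub>C x) = (b * c) *\<^sub>C x"
    and mult_scaleC_left: "(c *\<^sub>C x) * y = c *\<^sub>C (x * y)"
    and mult_scaleC_right: "x * (c *\<^sub>C y) = c *\<^sub>C (x * y)"
    and norm_scaleC: "norm (c *\<^sub>C x) = cmod c * norm x"
    and adj_adj: "adj (adj x) = x"
    and adj_add: "adj (x + y) = adj x + adj y"
    and adj_scaleC: "adj (c *\<^sub>C x) = cnj c *\<^sub>C adj x"
    and adj_mult: "adj (x * y) = adj y * adj x"
    and norm_adj_mult: "norm (adj x * x) = (norm x)\<^sup>2"

lemma scaleC_one: "1 *\<^sub>C x = (x :: 'a :: cstar_algebra)"
  using scaleR_scaleC[of 1 x] by simp

global_interpretation complex_vector: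
  vector_space "scaleC :: complex \<Rightarrow> 'a \<Rightarrow> 'a :: cstar_algebra"
  defines csubspace = complex_vector.subspace
    and cspan = complex_vector.span
  by unfold_locales (simp_all add: scaleC_add_right scaleC_add_left scaleC_scaleC scaleC_one)

instantiation complex :: cstar_algebra
begin

definition "scaleC_complex = (times :: complex \<Rightarrow> complex \<Rightarrow> complex)"

definition "adj_complex = cnj"

instance
  by standard
    (simp_all add: scaleC_complex_def adj_complex_def scaleR_conv_of_real algebra_simps
      norm_mult power2_eq_square)

end

definition cstar_subalgebra :: "'a :: cstar_algebra set \<Rightarrow> bool" where
  "cstar_subalgebra A \<longleftrightarrow>
     csubspace A \<and> closed A \<and> (\<forall>x\<in>A. \<forall>y\<in>A. x * y \<in> A) \<and> (\<forall>x\<in>A. adj x \<in> A)"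

definition abelian_cstar_subalgebra :: "'a :: cstar_algebra set \<Rightarrow> bool" where
  "abelian_cstar_subalgebra A \<longleftrightarrow>
     cstar_subalgebra A \<and> (\<forall>x\<in>A. \<forall>y\<in>A. x * y = y * x)"

definition maximal_abelian_cstar_subalgebra :: "'a :: cstar_algebra set \<Rightarrow> bool" where
  "maximal_abelian_cstar_subalgebra A \<longleftrightarrow>
     abelian_cstar_subalgebra A \<and>
     (\<forall>B. abelian_cstar_subalgebra B \<and> A \<subseteq> B \<longrightarrow> B = A)"


section \<open>Functionals, states and characters\<close>

text \<open>A functional on a subspace \<open>S\<close> is a function in \<^term>\<open>extensional S\<close>, so that
  functionals on \<open>S\<close> are equal iff they agree on \<open>S\<close>, and \<^term>\<open>restrict f S\<close> is the
  restriction of \<open>f\<close> to \<open>S\<close>. For \<open>S = UNIV\<close> the condition is void.\<close>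

definition linear_functionals :: "'a :: cstar_algebra set \<Rightarrow> ('a \<Rightarrow> complex) set" where
  "linear_functionals S = {f \<in> extensional S.
     (\<forall>x\<in>S. \<forall>y\<in>S. f (x + y) = f x + f y) \<and> (\<forall>c. \<forall>x\<in>S. f (c *\<^sub>C x) = c * f x)}"

definition bounded_functionals :: "'a :: cstar_algebra set \<Rightarrow> ('a \<Rightarrow> complex) set" where
  "bounded_functionals S =
     {f \<in> linear_functionals S. \<exists>K. \<forall>x\<in>S. cmod (f x) \<le> K * norm x}"

definition functional_norm :: "'a :: cstar_algebra set \<Rightarrow> ('a \<Rightarrow> complex) \<Rightarrow> real" where
  "functional_norm S f = (SUP x\<in>{x\<in>S. norm x \<le> 1}. cmod (f x))"

definition states :: "'a :: cstar_algebra set \<Rightarrow> ('a \<Rightarrow> complex) set" where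
  "states A = {f \<in> bounded_functionals A.
     functional_norm A f = 1 \<and> (\<forall>x\<in>A. f (adj x * x) \<in> \<real>\<^sub>\<ge>\<^sub>0)}"

text \<open>Pure states are the extreme points of the state space.\<close>

definition pure_states :: "'a :: cstar_algebra set \<Rightarrow> ('a \<Rightarrow> complex) set" where
  "pure_states A = {f \<in> states A.
     \<forall>g\<in>states A. \<forall>h\<in>states A. \<forall>t::real. 0 < t \<and> t < 1 \<and>
       (\<forall>x\<in>A. f x = of_real t * g x + of_real (1 - t) * h x) \<longrightarrow> g = f \<and> h = f}"

definition characters :: "'a :: cstar_algebra set \<Rightarrow> ('a \<Rightarrow> complex) set" where
  "characters D = {\<rho> \<in> linear_functionals D.
     (\<forall>x\<in>D. \<forall>y\<in>D. \<rho> (x * y) = \<rho> x * \<rho> y) \<and> (\<exists>x\<in>D. \<rho> x \<noteq> 0)}"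


section \<open>Regular inclusions\<close>

definition extension_property :: "'a :: cstar_algebra set \<Rightarrow> bool" where
  "extension_property D \<longleftrightarrow>
     (\<forall>\<tau>\<in>pure_states D. \<exists>!f. f \<in> states UNIV \<and> restrict f D = \<tau>) \<and>
     (\<forall>f\<in>pure_states UNIV. \<not> (\<forall>d\<in>D. f d = 0))"

definition normalizers :: "'a :: cstar_algebra set \<Rightarrow> 'a set \<Rightarrow> 'a set" where
  "normalizers D M = {v \<in> M. \<forall>d\<in>D. v * d * adj v \<in> D \<and> adj v * d * v \<in> D}"

definition intertwiner :: "'a :: cstar_algebra set \<Rightarrow> 'a \<Rightarrow> bool" where
  "intertwiner D v \<longleftrightarrow> v \<noteq> 0 \<and> (\<lambda>d. v * d) ` D = (\<lambda>d. d * v) ` D"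

definition regular_inclusion :: "'a :: cstar_algebra set \<Rightarrow> bool" where
  "regular_inclusion D \<longleftrightarrow>
     1 \<in> D \<and> maximal_abelian_cstar_subalgebra D \<and> extension_property D \<and>
     closure (cspan (normalizers D UNIV)) = UNIV"

text \<open>Positivity of \<open>E\<close> uses that the positive elements of the C*-algebra \<open>D\<close> are those of the
  form \<open>adj y * y\<close> with \<open>y \<in> D\<close>.\<close>

definition conditional_expectation ::
    "'a :: cstar_algebra set \<Rightarrow> ('a \<Rightarrow> 'a) \<Rightarrow> bool" where
  "conditional_expectation D E \<longleftrightarrow>
     Vector_Spaces.linear scaleC scaleC E \<and>
     (\<forall>x. E x \<in> D) \<and> (\<forall>d\<in>D. E d = d) \<and>
     (\<forall>x. norm (E x) \<le> norm x) \<and>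
     (\<forall>x. \<exists>y\<in>D. E (adj x * x) = adj y * y) \<and>
     (\<forall>d\<in>D. \<forall>e\<in>D. \<forall>x. E (d * x * e) = d * E x * e)"

text \<open>A regular inclusion has exactly one conditional expectation; \<open>cond_exp D\<close> is meaningful
  only when this is the case.\<close>

definition cond_exp :: "'a :: cstar_algebra set \<Rightarrow> 'a \<Rightarrow> 'a" where
  "cond_exp D = (THE E. conditional_expectation D E)"

definition character_state ::
    "'a :: cstar_algebra set \<Rightarrow> ('a \<Rightarrow> complex) \<Rightarrow> 'a \<Rightarrow> complex" where
  "character_state D \<rho> = \<rho> \<circ> cond_exp D"

definition bimodule :: "'a :: cstar_algebra set \<Rightarrow> 'a set \<Rightarrow> bool" where
  "bimodule D M \<longleftrightarrow> csubspace M \<and> (\<forall>d\<in>D. \<forall>e\<in>D. \<forall>m\<in>M. d * m * e \<in> M)"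

definition eigenfunctionals1 ::
    "'a :: cstar_algebra set \<Rightarrow> 'a set \<Rightarrow> ('a \<Rightarrow> complex) set" where
  "eigenfunctionals1 D M = {\<phi> \<in> bounded_functionals M. functional_norm M \<phi> = 1 \<and>
     (\<forall>d\<in>D. (\<exists>c. \<forall>m\<in>M. \<phi> (d * m) = c * \<phi> m) \<and> (\<exists>c. \<forall>m\<in>M. \<phi> (m * d) = c * \<phi> m))}"

text \<open>The functional \<open>[v, \<rho>]\<close> makes sense when \<open>v\<close> is a normalizer of \<open>D\<close> and
  \<open>\<rho> (adj v * v) > 0\<close>. The value \<open>\<rho> (adj v * v)\<close> of a state is always a nonnegative real
  number, so \<^term>\<open>Re\<close> is only a coercion.\<close>

definition bracket_defined ::
    "'a :: cstar_algebra set \<Rightarrow> 'a \<Rightarrow> ('a \<Rightarrow> complex) \<Rightarrow> bool" where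
  "bracket_defined D v \<rho> \<longleftrightarrow>
     v \<in> normalizers D UNIV \<and> Re (character_state D \<rho> (adj v * v)) > 0"

definition bracket ::
    "'a :: cstar_algebra set \<Rightarrow> 'a \<Rightarrow> ('a \<Rightarrow> complex) \<Rightarrow> 'a \<Rightarrow> complex" where
  "bracket D v \<rho> x =
     character_state D \<rho> (adj v * x) / of_real (sqrt (Re (character_state D \<rho> (adj v * v))))"

end

theory Submission
  imports Defs
begin

text \<open>
  For a character \<open>\<rho>\<close> of \<open>D\<close> let \<open>f\<close> be its unique extension to a state of the whole algebra.
  Uniqueness is an approximation property: for selfadjoint \<open>x\<close> there are \<open>d \<in> D\<close> with \<open>d \<ge> x\<close> and
  \<open>\<rho> d\<close> as close to \<open>f x\<close> as desired, since otherwise a maximal cone produces a second extension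
  (\<open>dominating_element\<close>). Hence elements \<open>k\<close> of \<open>D\<close> that live near \<open>\<rho>\<close> make \<open>x\<close> almost scalar:
  \<open>k x k\<close> is squeezed between \<open>(\<mu> - \<epsilon>) k\<^sup>2\<close> and \<open>(\<mu> + \<epsilon>) k\<^sup>2\<close>. A partition of unity \<open>\<Sum> h\<^sub>i\<^sup>2 = 1\<close>
  built from such elements gives averages \<open>\<Sum> h\<^sub>i x h\<^sub>i\<close> that are within \<open>\<epsilon>\<close> of \<open>D\<close>
  (\<open>average_near\<close>). All extended characters take the same value at \<open>x\<close> and at its averages, so
  the averages converge to an element \<open>E x\<close> of \<open>D\<close> with \<open>\<rho> (E x) = f x\<close> for every \<open>\<rho>\<close>. This \<open>E\<close>
  is the conditional expectation, and the useful fact about it is that \<open>E x\<close> is a norm limit of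
  averages \<open>\<Sum> h\<^sub>i x h\<^sub>i\<close> (\<open>average_near_expectation\<close>).

  Now let \<open>\<phi>\<close> be a norm one eigenfunctional on \<open>M\<close>. It has two characters with
  \<open>\<phi> (d m e) = \<alpha> d \<cdot> \<beta> e \<cdot> \<phi> m\<close>. Call a normalizer \<open>w\<close> aligned if it carries \<open>\<beta>\<close> to \<open>\<alpha>\<close>, that is
  \<open>\<beta> (w\<^sup>* d w) = \<beta> (w\<^sup>* w) \<alpha> d\<close> and \<open>\<beta> (w\<^sup>* w) \<noteq> 0\<close>. A normalizer that is not aligned becomes arbitrarily
  small when it is multiplied by suitable contractions \<open>d\<close>, \<open>e\<close> in \<open>D\<close> with \<open>\<alpha> d = 1 = \<beta> e\<close>. If no normalizer
  were aligned, regularity would give this for every element of the algebra, but \<open>\<phi> (d m e) = \<phi> m\<close>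
  prevents it for \<open>m \<in> M\<close> with \<open>\<phi> m \<noteq> 0\<close>. So an aligned \<open>w\<close> exists. For \<open>m \<in> M\<close> the elements
  \<open>w (\<Sum> h\<^sub>i w\<^sup>* m h\<^sub>i) = \<Sum> (w h\<^sub>i w\<^sup>*) m h\<^sub>i\<close> belong to \<open>M\<close>, and \<open>\<phi>\<close> has the value \<open>\<beta> (w\<^sup>* w) \<phi> m\<close> at each of them.
  In the limit \<open>w E (w\<^sup>* m) \<in> M\<close> and \<open>\<phi> (w E (w\<^sup>* m)) = \<beta> (w\<^sup>* w) \<phi> m\<close>
  (\<open>eigenfunctional_expectation\<close>). This has two uses. First, \<open>w\<close> need not lie in \<open>M\<close>, but
  \<open>w E (w\<^sup>* m)\<close> does, and cutting it off by an element of \<open>D\<close> on whose support \<open>w\<^sup>* w\<close> is bounded below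
  yields an intertwiner \<open>v \<in> M\<close> that is still aligned. Second, the formula applied to \<open>v\<close> itself says
  that \<open>\<phi>\<close> is a multiple of \<open>[v, \<beta>]\<close>; both functionals have norm one, so the factor is a phase, which
  can be absorbed into \<open>v\<close>.

  For the converse, let \<open>v \<in> M\<close> be a normalizer with \<open>\<rho> (v\<^sup>* v) > 0\<close>. The bound
  \<open>\<bar>[v, \<rho>] x\<bar> \<le> \<parallel>x\<parallel>\<close> is the Cauchy-Schwarz inequality, and it is sharp on the elements \<open>v e\<close> of \<open>M\<close> with \<open>e \<in> D\<close>
  concentrated near \<open>\<rho>\<close>. The right eigenvalue of \<open>d\<close> is \<open>\<rho> d\<close>. The left one is
  \<open>c = \<rho> (v\<^sup>* d v) / \<rho> (v\<^sup>* v)\<close>, because \<open>y = d\<^sup>* v - c\<^sup>* v\<close> satisfies \<open>f (y\<^sup>* y) = 0\<close> and hence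
  \<open>f (y\<^sup>* x) = 0\<close> for all \<open>x\<close>.

  The theory of positive elements, characters and states behind this is built from two ideas. Square
  roots come from the binomial series and give a norm criterion for positivity. Characters and
  states come from maximal cones: a maximal proper cone that contains the unit in its interior is a
  half-space, hence the positive half-space of a functional, and this functional is multiplicative
  if the cone is closed under multiplication.
\<close>

section \<open>The adjoint, and square roots of elements near the unit\<close>

lemma adj_zero [simp]: "adj (0::'a::cstar_algebra) = 0"
  using adj_scaleC[of 0 "0::'a"] by simp

lemma adj_one [simp]: "adj (1::'a::cstar_algebra) = 1"
  by (metis adj_adj adj_mult mult_1_left mult_1_right)

lemma adj_scaleR [simp]: "adj (r *\<^sub>R x) = r *\<^sub>R adj (x::'a::cstar_algebra)"
  by (simp add: scaleR_scaleC adj_scaleC)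

lemma adj_minus [simp]: "adj (- x) = - adj (x::'a::cstar_algebra)"
  using adj_scaleR[of "-1" x] by simp

lemma adj_diff [simp]: "adj (x - y) = adj x - adj (y::'a::cstar_algebra)"
  using adj_add[of x "- y"] by simp

lemma adj_power [simp]: "adj (x ^ n) = adj (x::'a::cstar_algebra) ^ n"
  by (induction n) (simp_all add: adj_mult power_commutes)

lemma adj_sum: "adj (sum f S) = (\<Sum>i\<in>S. adj (f i :: 'a::cstar_algebra))"
  by (induction S rule: infinite_finite_induct) (simp_all add: adj_add)

lemma norm_adj [simp]: "norm (adj x) = norm (x::'a::cstar_algebra)"
proof -
  have le: "norm y \<le> norm (adj y)" for y :: 'a
  proof (cases "norm y = 0")
    case False
    have "norm y * norm y \<le> norm (adj y) * norm y"
      using norm_adj_mult[of y] norm_mult_ineq[of "adj y" y] by (simp add: power2_eq_square)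
    with False show ?thesis by simp
  qed simp
  from le[of x] le[of "adj x"] show ?thesis by (simp add: adj_adj)
qed

lemma bounded_linear_adj: "bounded_linear (adj :: 'a::cstar_algebra \<Rightarrow> 'a)"
  by (rule bounded_linear_intro[where K = 1]) (simp_all add: adj_add)

lemmas continuous_on_adj [continuous_intros] = bounded_linear.continuous_on[OF bounded_linear_adj]

lemma norm_mult_adj: "norm (x * adj x) = (norm (x::'a::cstar_algebra))\<^sup>2"
  using norm_adj_mult[of "adj x"] by (simp add: adj_adj)

text \<open>The Taylor coefficients at \<open>0\<close> of \<open>t \<mapsto> sqrt (1 - t)\<close>, namely \<open>(- 1) ^ k * ((1 / 2) gchoose k)\<close>. In the
  Pochhammer form the signs of all but the first one are visible.\<close>

definition sqrt_coeff :: "nat \<Rightarrow> real" where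
  "sqrt_coeff k = pochhammer (- 1 / 2) k / fact k"

lemma sqrt_coeff_gbinomial: "sqrt_coeff k = (- 1) ^ k * ((1 / 2) gchoose k)"
  by (simp add: sqrt_coeff_def gbinomial_pochhammer flip: power_mult_distrib mult.assoc)

text \<open>The series squares to \<open>1 - t\<close>, by Vandermonde's identity with both parameters \<open>1 / 2\<close>.\<close>

lemma sqrt_coeff_convolution:
  "(\<Sum>i\<le>n. sqrt_coeff i * sqrt_coeff (n - i)) = (if n = 0 then 1 else if n = 1 then - 1 else 0)"
proof -
  have "(\<Sum>i\<le>n. sqrt_coeff i * sqrt_coeff (n - i))
      = (\<Sum>i\<le>n. (- 1) ^ n * (((1 / 2 :: real) gchoose i) * ((1 / 2) gchoose (n - i))))"
    by (rule sum.cong) (auto simp: sqrt_coeff_gbinomial simp flip: power_add)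
  also have "\<dots> = (- 1) ^ n * ((1 / 2 + 1 / 2 :: real) gchoose n)"
    unfolding sum_distrib_left[symmetric]
    using gbinomial_Vandermonde[of "1 / 2 :: real" "1 / 2" n] by (simp add: atLeast0AtMost)
  also have "\<dots> = (- 1) ^ n * real (1 choose n)"
    using binomial_gbinomial[of 1 n, where 'a = real] by simp
  also have "\<dots> = (if n = 0 then 1 else if n = 1 then - 1 else 0)"
    by (auto simp: binomial_eq_0)
  finally show ?thesis .
qed

lemma sqrt_coeff_Suc_nonpos: "sqrt_coeff (Suc k) \<le> 0"
proof -
  have "pochhammer (1 / 2 :: real) k \<ge> 0" by (intro pochhammer_nonneg) simp
  then show ?thesis by (simp add: sqrt_coeff_def pochhammer_rec field_simps del: fact_Suc)
qed

lemma sum_sqrt_coeff_nonneg: "0 \<le> (\<Sum>k\<le>n. sqrt_coeff k)"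
proof -
  have "(\<Sum>k\<le>n. sqrt_coeff k) = pochhammer (1 / 2) n / fact n"
  proof (induction n)
    case (Suc n)
    have *: "pochhammer (- 1 / 2 :: real) (Suc n) = - 1 / 2 * pochhammer (1 / 2) n"
      by (simp add: pochhammer_rec)
    have "(\<Sum>k\<le>Suc n. sqrt_coeff k)
        = pochhammer (1 / 2) n / fact n + - 1 / 2 * pochhammer (1 / 2) n / fact (Suc n)"
      using Suc by (simp only: sum.atMost_Suc sqrt_coeff_def *)
    also have "\<dots> = pochhammer (1 / 2) (Suc n) / fact (Suc n)"
      by (simp add: pochhammer_Suc divide_simps) (simp add: algebra_simps)
    finally show ?case .
  qed (simp add: sqrt_coeff_def)
  then show ?thesis by (simp add: pochhammer_nonneg)
qed

text \<open>All coefficients after the first have the same sign, so their absolute values telescope into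
  a partial sum of the series at \<open>t = 1\<close>, which is nonnegative. This gives absolute convergence on the
  closed unit ball, boundary included.\<close>

lemma sqrt_coeff_tail:
  "summable (\<lambda>k. \<bar>sqrt_coeff (Suc k)\<bar>)" "(\<Sum>k. \<bar>sqrt_coeff (Suc k)\<bar>) \<le> 1"
proof -
  have le: "(\<Sum>k<n. \<bar>sqrt_coeff (Suc k)\<bar>) \<le> 1" for n
  proof -
    have "(\<Sum>k<n. \<bar>sqrt_coeff (Suc k)\<bar>) = - (\<Sum>k<n. sqrt_coeff (Suc k))"
      by (simp add: sqrt_coeff_Suc_nonpos sum_negf)
    also have "\<dots> = 1 - (\<Sum>k\<le>n. sqrt_coeff k)"
      by (simp add: sum.atMost_shift sqrt_coeff_def)
    finally show ?thesis using sum_sqrt_coeff_nonneg[of n] by simp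
  qed
  show s: "summable (\<lambda>k. \<bar>sqrt_coeff (Suc k)\<bar>)"
    by (rule summableI_nonneg_bounded[OF _ le]) simp
  show "(\<Sum>k. \<bar>sqrt_coeff (Suc k)\<bar>) \<le> 1"
    using suminf_le_const[OF s le] .
qed

text \<open>Only real scalars are required and the adjoint does not occur, so that commutants of arbitrary
  elements qualify. A square root of \<open>x\<close> is later shown to commute with everything that commutes
  with \<open>x\<close> by placing it in such a commutant.\<close>

definition closed_unital_subalgebra :: "'a::cstar_algebra set \<Rightarrow> bool" where
  "closed_unital_subalgebra S \<longleftrightarrow> closed S \<and> subspace S \<and> 1 \<in> S \<and> (\<forall>a\<in>S. \<forall>b\<in>S. a * b \<in> S)"

lemma closed_unital_subalgebra_commutant: "closed_unital_subalgebra {y. y * b = b * y}"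
proof -
  have "u * v * b = b * (u * v)" if "u * b = b * u" "v * b = b * v" for u v
    by (metis mult.assoc that)
  moreover have "closed {y. y * b = b * y}" by (intro closed_Collect_eq continuous_intros)
  moreover have "subspace {y. y * b = b * y}" by (auto simp: subspace_def distrib_left distrib_right)
  ultimately show ?thesis unfolding closed_unital_subalgebra_def by simp
qed

text \<open>The witness is \<open>y = 1 - sqrt (1 - x)\<close>, a power series in \<open>x\<close> without constant term. The bound on its
  norm says that the square root is again within distance one of the unit, hence itself positive by the
  norm criterion below.\<close>

lemma sqrt_one_minus:
  fixes x :: "'a::cstar_algebra"
  assumes x: "norm x \<le> 1"
  obtains y where "norm y \<le> 1" "(1 - y) * (1 - y) = 1 - x" "adj x = x \<Longrightarrow> adj y = y"
    "\<forall>S. closed_unital_subalgebra S \<and> x \<in> S \<longrightarrow> y \<in> S"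
proof -
  define a :: "nat \<Rightarrow> 'a" where "a k = (- sqrt_coeff (Suc k)) *\<^sub>R x ^ Suc k" for k
  define y where "y = (\<Sum>k. a k)"
  have na: "norm (a k) \<le> \<bar>sqrt_coeff (Suc k)\<bar>" for k
  proof -
    have "norm (x ^ Suc k) \<le> 1"
      using norm_power_ineq[of x "Suc k"] power_le_one[OF norm_ge_zero x, of "Suc k"] by linarith
    then show ?thesis
      unfolding a_def norm_scaleR by (simp add: mult_left_le)
  qed
  have sna: "summable (\<lambda>k. norm (a k))"
    by (rule summable_comparison_test'[OF sqrt_coeff_tail(1), of 0]) (use na in simp)
  have sa: "summable a" by (rule summable_norm_cancel[OF sna])
  have "norm y \<le> (\<Sum>k. norm (a k))" unfolding y_def by (rule summable_norm[OF sna])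
  also have "\<dots> \<le> (\<Sum>k. \<bar>sqrt_coeff (Suc k)\<bar>)"
    by (rule suminf_le[OF na sna sqrt_coeff_tail(1)])
  finally have ny: "norm y \<le> 1" using sqrt_coeff_tail(2) by linarith
  define b where "b k = sqrt_coeff k *\<^sub>R x ^ k" for k
  have ba: "b (Suc k) = - a k" for k by (simp add: a_def b_def)
  have snb: "summable (\<lambda>k. norm (b k))"
    using sna by (subst summable_Suc_iff[symmetric]) (simp add: ba)
  have sb: "summable b" by (rule summable_norm_cancel[OF snb])
  have "b 0 = 1" by (simp add: b_def sqrt_coeff_def)
  then have "suminf b = 1 - y"
    using suminf_split_head[OF sb] suminf_minus[OF sa] by (simp add: ba eq_diff_eq add.commute flip: y_def)
  moreover have "(\<lambda>n. \<Sum>i\<le>n. b i * b (n - i)) sums (suminf b * suminf b)"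
    by (rule Cauchy_product_sums[OF snb snb])
  moreover have "(\<Sum>i\<le>n. b i * b (n - i)) = (if n = 0 then 1 else if n = 1 then - x else 0)" for n
  proof -
    have "(\<Sum>i\<le>n. b i * b (n - i)) = (\<Sum>i\<le>n. (sqrt_coeff i * sqrt_coeff (n - i)) *\<^sub>R x ^ n)"
      by (rule sum.cong) (auto simp: b_def simp flip: power_add)
    also have "\<dots> = (if n = 0 then 1 else if n = 1 then - 1 else 0) *\<^sub>R x ^ n"
      by (simp only: sqrt_coeff_convolution flip: scaleR_sum_left)
    finally show ?thesis by simp
  qed
  ultimately have s1: "(\<lambda>n. if n = 0 then 1 else if n = 1 then - x else 0) sums ((1 - y) * (1 - y))"
    by simp
  have "(\<lambda>n::nat. if n = 0 then 1 else if n = 1 then - x else 0) sums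
      (\<Sum>n\<in>{0::nat,1}. if n = 0 then 1 else if n = 1 then - x else 0)"
    by (rule sums_finite) auto
  from sums_unique2[OF s1 this] have sq: "(1 - y) * (1 - y) = 1 - x" by simp
  show thesis
  proof (rule that[OF ny sq])
    assume "adj x = x"
    then show "adj y = y"
      using bounded_linear.suminf[OF bounded_linear_adj sa] by (simp add: y_def a_def del: power_Suc)
  next
    show "\<forall>S. closed_unital_subalgebra S \<and> x \<in> S \<longrightarrow> y \<in> S"
    proof clarify
      fix S assume "closed_unital_subalgebra S" and xS: "x \<in> S"
      then have S: "closed S" "subspace S" "\<And>a b. a \<in> S \<Longrightarrow> b \<in> S \<Longrightarrow> a * b \<in> S"
        by (auto simp: closed_unital_subalgebra_def)
      have "x ^ Suc k \<in> S" for k by (induction k) (use S(3) xS in auto)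
      then have mem: "sum a {..<n} \<in> S" for n
        unfolding a_def by (intro subspace_sum[OF S(2)] subspace_scale[OF S(2)])
      have "(\<lambda>n. sum a {..<n}) \<longlonglongrightarrow> y" using sa unfolding y_def by (rule summable_LIMSEQ)
      then show "y \<in> S" by (rule closed_sequentially[OF S(1) mem])
    qed
  qed
qed

section \<open>Positive elements\<close>

text \<open>Positivity as being the square of a selfadjoint element is the form that the binomial series
  produces and that characters can read. That it coincides with being of the form \<open>adj a * a\<close> is the
  hard direction, and comes only after characters are available.\<close>

definition positive :: "'a::cstar_algebra \<Rightarrow> bool" where
  "positive x \<longleftrightarrow> (\<exists>b. adj b = b \<and> x = b * b)"

lemma scaleC_ii_ii: "\<i> *\<^sub>C \<i> *\<^sub>C x = - (x::'a::cstar_algebra)"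
  by (simp add: scaleC_scaleC complex_vector.scale_minus_left scaleC_one)

text \<open>With \<open>n = a + i b\<close> the sum of squares is \<open>adj n * n\<close>, so its norm is the square of \<open>norm n\<close>, and \<open>a\<close> is
  the real part of \<open>n\<close>.\<close>

lemma norm_le_sum_squares:
  fixes a b :: "'a::cstar_algebra"
  assumes "adj a = a" "adj b = b" "a * b = b * a"
  shows "(norm a)\<^sup>2 \<le> norm (a * a + b * b)"
proof -
  define n where "n = a + \<i> *\<^sub>C b"
  have an: "adj n = a - \<i> *\<^sub>C b"
    by (simp add: n_def adj_add adj_scaleC assms complex_vector.scale_minus_left)
  have "adj n * n = (a - \<i> *\<^sub>C b) * (a + \<i> *\<^sub>C b)" unfolding an by (simp add: n_def)
  also have "\<dots> = a * a + b * b"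
    by (simp add: algebra_simps mult_scaleC_left mult_scaleC_right scaleC_ii_ii assms)
  finally have "adj n * n = a * a + b * b" .
  then have 1: "norm (a * a + b * b) = (norm n)\<^sup>2" using norm_adj_mult[of n] by simp
  have "2 *\<^sub>R a = n + adj n" unfolding an by (simp add: n_def scaleR_2)
  then have "2 * norm a \<le> norm n + norm (adj n)"
    by (metis norm_scaleR norm_triangle_ineq abs_numeral)
  then have "norm a \<le> norm n" by simp
  with 1 show ?thesis by simp
qed

lemma sqrt_of_near_scalar:
  fixes x :: "'a::cstar_algebra"
  assumes t: "0 < t" and x: "adj x = x" "norm (t *\<^sub>R 1 - x) \<le> t"
  shows "\<exists>b. adj b = b \<and> b * b = x \<and> norm (sqrt t *\<^sub>R 1 - b) \<le> sqrt t \<and>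
    (\<forall>S. closed_unital_subalgebra S \<and> x \<in> S \<longrightarrow> b \<in> S)"
proof -
  define z where "z = 1 - (1 / t) *\<^sub>R x"
  have z: "z = (1 / t) *\<^sub>R (t *\<^sub>R 1 - x)" using t by (simp add: z_def scaleR_diff_right)
  have "norm z \<le> 1" unfolding z norm_scaleR using x t by (simp add: field_simps)
  then obtain y where y: "norm y \<le> 1" "(1 - y) * (1 - y) = 1 - z" "adj z = z \<Longrightarrow> adj y = y"
    "\<forall>S. closed_unital_subalgebra S \<and> z \<in> S \<longrightarrow> y \<in> S"
    using sqrt_one_minus[of z] by metis
  have "adj y = y" by (rule y(3)) (simp add: z_def x)
  define b where "b = sqrt t *\<^sub>R (1 - y)"
  have "adj b = b" using \<open>adj y = y\<close> by (simp add: b_def)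
  moreover have "b * b = x" using y(2) t by (simp add: z_def b_def)
  moreover have "sqrt t *\<^sub>R 1 - b = sqrt t *\<^sub>R y" by (simp add: scaleR_diff_right b_def)
  then have "norm (sqrt t *\<^sub>R 1 - b) \<le> sqrt t"
    using y(1) t by (simp add: mult_left_le)
  moreover have "b \<in> S" if S: "closed_unital_subalgebra S" "x \<in> S" for S
  proof -
    have S': "subspace S" "1 \<in> S" using S by (auto simp: closed_unital_subalgebra_def)
    have "z \<in> S" unfolding z_def by (intro subspace_diff subspace_scale S S')
    then have "y \<in> S" using y(4) S by blast
    then show "b \<in> S" unfolding b_def by (intro subspace_diff subspace_scale S')
  qed
  ultimately show ?thesis by blast
qed

lemma positive_selfadjoint: "positive x \<Longrightarrow> adj x = x"
  by (auto simp: positive_def adj_mult)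

lemma positive_zero [simp]: "positive 0" and positive_one [simp]: "positive 1"
  unfolding positive_def by (rule exI[of _ 0], simp, rule exI[of _ 1], simp)

lemma positive_scaleR: "positive x \<Longrightarrow> 0 \<le> r \<Longrightarrow> positive (r *\<^sub>R x)"
  unfolding positive_def
  by clarify (rule_tac x = "sqrt r *\<^sub>R b" in exI, simp)

text \<open>Together with \<open>norm_scalar_minus_positive\<close> this characterizes positivity by a norm inequality,
  which is what makes sums of positive elements positive.\<close>

lemma positive_of_near_scalar:
  assumes "adj x = x" "norm (t *\<^sub>R 1 - x) \<le> t" shows "positive x"
proof (cases "t > 0")
  case True
  then show ?thesis using sqrt_of_near_scalar[OF True assms] unfolding positive_def by blast
next
  case False
  moreover have "0 \<le> t" using assms(2) norm_ge_zero order_trans by blast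
  ultimately have "t = 0" by simp
  with assms have "x = 0" by simp
  then show ?thesis by simp
qed

lemma positive_scalar_minus:
  assumes "adj x = x" "norm x \<le> t" shows "positive (t *\<^sub>R 1 - x)"
  by (rule positive_of_near_scalar[where t = t]) (use assms in auto)

text \<open>If \<open>x = b * b\<close> and \<open>y * y = t - x\<close>, then \<open>y\<close> commutes with \<open>b\<close> and the two squares add up to the scalar
  \<open>t\<close>, so neither exceeds \<open>t\<close> in norm.\<close>

lemma norm_scalar_minus_positive:
  assumes "positive x" "norm x \<le> t" shows "norm (t *\<^sub>R 1 - x) \<le> t"
proof (cases "t > 0")
  case True
  from assms obtain b where b: "adj b = b" "x = b * b" unfolding positive_def by blast
  have sx: "adj x = x" using assms(1) by (rule positive_selfadjoint)
  have "adj (t *\<^sub>R 1 - x) = t *\<^sub>R 1 - x" "norm (t *\<^sub>R 1 - (t *\<^sub>R 1 - x)) \<le> t"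
    using sx assms(2) by simp_all
  from sqrt_of_near_scalar[OF True this] obtain y where y: "adj y = y" "y * y = t *\<^sub>R 1 - x"
    "\<forall>S. closed_unital_subalgebra S \<and> t *\<^sub>R 1 - x \<in> S \<longrightarrow> y \<in> S"
    by blast
  have "t *\<^sub>R 1 - x \<in> {y. y * b = b * y}"
    unfolding b(2) by (simp add: left_diff_distrib right_diff_distrib mult.assoc)
  then have "y \<in> {y. y * b = b * y}"
    using y(3) closed_unital_subalgebra_commutant by blast
  then have "(norm y)\<^sup>2 \<le> norm (y * y + b * b)" using norm_le_sum_squares[of y b] y b by simp
  also have "\<dots> = t" using y b True by simp
  finally show ?thesis using norm_adj_mult[of y] y by simp
next
  case False
  then have "t = 0" "norm x = 0" using assms norm_ge_zero[of x] by linarith+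
  then show ?thesis by simp
qed

lemma positive_add:
  assumes "positive x" "positive y" shows "positive (x + y)"
proof (rule positive_of_near_scalar[where t = "norm x + norm y"])
  show "adj (x + y) = x + y" using assms by (simp add: adj_add positive_selfadjoint)
  have "norm ((norm x + norm y) *\<^sub>R 1 - (x + y)) =
     norm ((norm x *\<^sub>R 1 - x) + (norm y *\<^sub>R 1 - y))" by (simp add: algebra_simps)
  also have "\<dots> \<le> norm x + norm y"
    by (intro norm_triangle_mono norm_scalar_minus_positive assms order.refl)
  finally show "norm ((norm x + norm y) *\<^sub>R 1 - (x + y)) \<le> norm x + norm y" .
qed

lemma positive_sum: "(\<And>i. i \<in> S \<Longrightarrow> positive (f i)) \<Longrightarrow> positive (sum f S)"
  by (induction S rule: infinite_finite_induct) (auto intro: positive_add)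

section \<open>Real and imaginary parts, and linear functionals\<close>

definition re_part :: "'a::cstar_algebra \<Rightarrow> 'a" where
  "re_part x = (1 / 2) *\<^sub>R (x + adj x)"

definition im_part :: "'a::cstar_algebra \<Rightarrow> 'a" where
  "im_part x = (- \<i> / 2) *\<^sub>C (x - adj x)"

lemma re_part_plus_im_part: "re_part x + \<i> *\<^sub>C im_part x = (x::'a::cstar_algebra)"
proof -
  have "\<i> *\<^sub>C im_part x = (1 / 2) *\<^sub>R (x - adj x)"
    by (simp add: im_part_def scaleC_scaleC scaleR_scaleC)
  then have "re_part x + \<i> *\<^sub>C im_part x = (1 / 2) *\<^sub>R ((x + adj x) + (x - adj x))"
    by (simp only: re_part_def scaleR_add_right)
  also have "\<dots> = x" by (simp flip: scaleR_2)
  finally show ?thesis .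
qed

lemma adj_re_part [simp]: "adj (re_part x) = re_part x"
  by (simp add: re_part_def adj_add adj_adj add.commute)

lemma adj_im_part [simp]: "adj (im_part x) = im_part x"
proof -
  have "adj (im_part x) = (\<i> / 2) *\<^sub>C (- (x - adj x))"
    by (simp add: im_part_def adj_scaleC adj_adj)
  also have "\<dots> = im_part x"
    unfolding complex_vector.scale_minus_right im_part_def
    by (simp flip: complex_vector.scale_minus_left)
  finally show ?thesis .
qed

lemma re_part_add: "re_part (x + y) = re_part x + re_part y"
  by (simp add: re_part_def adj_add scaleR_add_right)

lemma im_part_add: "im_part (x + y) = im_part x + im_part y"
  by (simp add: im_part_def adj_add complex_vector.scale_right_diff_distrib scaleC_add_right)

lemma selfadjoint_decomposition_unique:
  fixes a b c d :: "'a::cstar_algebra"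
  assumes "adj a = a" "adj b = b" "adj c = c" "adj d = d" "a + \<i> *\<^sub>C b = c + \<i> *\<^sub>C d"
  shows "a = c" "b = d"
proof -
  have "adj (a + \<i> *\<^sub>C b) = adj (c + \<i> *\<^sub>C d)" by (simp only: assms(5))
  then have 2: "a - \<i> *\<^sub>C b = c - \<i> *\<^sub>C d"
    unfolding adj_add adj_scaleC assms(1-4) by (simp add: complex_vector.scale_minus_left)
  have "2 *\<^sub>R a = (a + \<i> *\<^sub>C b) + (a - \<i> *\<^sub>C b)" by (simp add: scaleR_2)
  also have "\<dots> = 2 *\<^sub>R c" unfolding 2 assms(5) by (simp add: scaleR_2)
  finally show "a = c" by simp
  then have "\<i> *\<^sub>C b = \<i> *\<^sub>C d" using assms(5) by simp
  then show "b = d" by simp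
qed

lemma re_im_part_scaleC:
  "re_part (c *\<^sub>C x) = Re c *\<^sub>R re_part x - Im c *\<^sub>R im_part x" (is "_ = ?r")
  "im_part (c *\<^sub>C x) = Re c *\<^sub>R im_part x + Im c *\<^sub>R re_part x" (is "_ = ?i")
proof -
  let ?a = "re_part x" and ?b = "im_part x"
  have 1: "?r + \<i> *\<^sub>C ?i = c *\<^sub>C (?a + \<i> *\<^sub>C ?b)"
  proof -
    have "c *\<^sub>C (?a + \<i> *\<^sub>C ?b) = c *\<^sub>C ?a + (c * \<i>) *\<^sub>C ?b"
      by (simp add: scaleC_add_right scaleC_scaleC)
    also have "\<dots> = (complex_of_real (Re c) + \<i> * complex_of_real (Im c)) *\<^sub>C ?a +
        ((complex_of_real (Re c) + \<i> * complex_of_real (Im c)) * \<i>) *\<^sub>C ?b"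
      by (simp only: flip: complex_eq)
    also have "\<dots> = ?r + \<i> *\<^sub>C ?i"
      by (simp add: scaleR_scaleC scaleC_add_right scaleC_add_left scaleC_scaleC algebra_simps
          complex_vector.scale_minus_left)
    finally show ?thesis by simp
  qed
  have 2: "re_part (c *\<^sub>C x) + \<i> *\<^sub>C im_part (c *\<^sub>C x) = ?r + \<i> *\<^sub>C ?i"
    unfolding 1 re_part_plus_im_part ..
  have s: "adj ?r = ?r" "adj ?i = ?i" by (simp_all add: adj_add)
  show "re_part (c *\<^sub>C x) = ?r" "im_part (c *\<^sub>C x) = ?i"
    by (rule selfadjoint_decomposition_unique[OF adj_re_part adj_im_part s 2])+
qed

lemma re_im_part_selfadjoint: "adj x = x \<Longrightarrow> re_part x = x \<and> im_part x = 0"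
  by (simp add: re_part_def im_part_def flip: scaleR_2)

locale unital_cstar_subalgebra =
  fixes A :: "'a::cstar_algebra set"
  assumes cstar: "cstar_subalgebra A" and one_mem [simp, intro]: "1 \<in> A"
begin

lemma closed_A: "closed A" and csubspace_A: "csubspace A"
  using cstar by (auto simp: cstar_subalgebra_def)

lemma mem [intro]:
  shows zero_mem: "0 \<in> A"
    and add_mem: "x \<in> A \<Longrightarrow> y \<in> A \<Longrightarrow> x + y \<in> A"
    and diff_mem: "x \<in> A \<Longrightarrow> y \<in> A \<Longrightarrow> x - y \<in> A"
    and minus_mem: "x \<in> A \<Longrightarrow> - x \<in> A"
    and scaleC_mem: "x \<in> A \<Longrightarrow> c *\<^sub>C x \<in> A"
    and scaleR_mem: "x \<in> A \<Longrightarrow> r *\<^sub>R x \<in> A"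
    and mult_mem: "x \<in> A \<Longrightarrow> y \<in> A \<Longrightarrow> x * y \<in> A"
    and adj_mem: "x \<in> A \<Longrightarrow> adj x \<in> A"
  using cstar complex_vector.subspace_0[OF csubspace_A] complex_vector.subspace_add[OF csubspace_A]
    complex_vector.subspace_diff[OF csubspace_A] complex_vector.subspace_neg[OF csubspace_A]
    complex_vector.subspace_scale[OF csubspace_A]
  by (auto simp: cstar_subalgebra_def scaleR_scaleC)

lemma sum_mem: "(\<And>i. i \<in> S \<Longrightarrow> f i \<in> A) \<Longrightarrow> sum f S \<in> A"
  by (rule complex_vector.subspace_sum[OF csubspace_A])

lemma subspace_A: "subspace A"
  by (auto simp: subspace_def)

lemma closed_unital_subalgebra_A: "closed_unital_subalgebra A"
  unfolding closed_unital_subalgebra_def using closed_A subspace_A by auto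

lemma re_part_mem: "x \<in> A \<Longrightarrow> re_part x \<in> A" and im_part_mem: "x \<in> A \<Longrightarrow> im_part x \<in> A"
  by (auto simp: re_part_def im_part_def)

text \<open>Cones live in the selfadjoint part, so characters and states are first obtained there as real-linear
  functionals.\<close>

lemma complexify:
  fixes g :: "'a \<Rightarrow> real"
  assumes add: "\<And>a b. a \<in> A \<Longrightarrow> b \<in> A \<Longrightarrow> adj a = a \<Longrightarrow> adj b = b \<Longrightarrow> g (a + b) = g a + g b"
    and scale: "\<And>r a. a \<in> A \<Longrightarrow> adj a = a \<Longrightarrow> g (r *\<^sub>R a) = r * g a"
  obtains F where "F \<in> linear_functionals A" "\<And>a. a \<in> A \<Longrightarrow> adj a = a \<Longrightarrow> F a = of_real (g a)"
proof
  define F where "F = (\<lambda>x\<in>A. Complex (g (re_part x)) (g (im_part x)))"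
  have diff: "g (a - b) = g a - g b" if "a \<in> A" "b \<in> A" "adj a = a" "adj b = b" for a b
    using add[of a "- 1 *\<^sub>R b"] scale[of b "- 1"] that by auto
  show "F \<in> linear_functionals A"
    unfolding linear_functionals_def
  proof (intro CollectI conjI ballI allI)
    show "F \<in> extensional A" by (simp add: F_def)
    fix x assume x: "x \<in> A"
    show "F (x + y) = F x + F y" if "y \<in> A" for y
      using x that by (simp add: F_def add_mem re_part_add im_part_add add re_part_mem im_part_mem complex_eq_iff)
    show "F (c *\<^sub>C x) = c * F x" for c
      using x by (simp add: F_def scaleC_mem re_im_part_scaleC add diff scale re_part_mem im_part_mem
          scaleR_mem complex_eq_iff)
  qed
  fix a assume a: "a \<in> A" "adj a = a"
  have "g 0 = 0" using scale[of 0 0] by auto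
  with a show "F a = of_real (g a)"
    by (simp add: F_def re_im_part_selfadjoint complex_eq_iff)
qed

end

lemma linear_functionals_add: "f \<in> linear_functionals S \<Longrightarrow> x \<in> S \<Longrightarrow> y \<in> S \<Longrightarrow> f (x + y) = f x + f y"
  and linear_functionals_scaleC: "f \<in> linear_functionals S \<Longrightarrow> x \<in> S \<Longrightarrow> f (c *\<^sub>C x) = c * f x"
  and linear_functionals_scaleR: "f \<in> linear_functionals S \<Longrightarrow> x \<in> S \<Longrightarrow> f (r *\<^sub>R x) = of_real r * f x"
  by (auto simp: linear_functionals_def scaleR_scaleC)

lemma linear_functionals_diff:
  assumes "f \<in> linear_functionals S" "x \<in> S" "y \<in> S" "csubspace S"
  shows "f (x - y) = f x - f y"
proof -
  have "- 1 *\<^sub>R y \<in> S"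
    unfolding scaleR_scaleC by (rule complex_vector.subspace_scale[OF assms(4,3)])
  then have "f (x + - 1 *\<^sub>R y) = f x + f (- 1 *\<^sub>R y)"
    by (rule linear_functionals_add[OF assms(1,2)])
  also have "f (- 1 *\<^sub>R y) = - f y" using linear_functionals_scaleR[OF assms(1,3), of "- 1"] by simp
  finally show ?thesis by simp
qed

lemma linear_functionals_zero: "f \<in> linear_functionals S \<Longrightarrow> csubspace S \<Longrightarrow> f 0 = 0"
  using linear_functionals_scaleC[of f S 0 0] complex_vector.subspace_0[of S] by auto

lemma linear_functionals_sum:
  assumes "f \<in> linear_functionals S" "csubspace S" "\<And>i. i \<in> I \<Longrightarrow> x i \<in> S"
  shows "f (sum x I) = (\<Sum>i\<in>I. f (x i))"
  using assms(3)
proof (induction I rule: infinite_finite_induct)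
  case (insert i I)
  then show ?case
    using linear_functionals_add[OF assms(1), of "x i" "sum x I"] complex_vector.subspace_sum[OF assms(2), of I x]
    by auto
qed (use linear_functionals_zero[OF assms(1,2)] in auto)

section \<open>Maximal cones\<close>

text \<open>Proper convex cones; the unit plays the role of an order unit, so properness is expressed by
  excluding its negative.\<close>

definition order_cone :: "'a::real_normed_algebra_1 set \<Rightarrow> 'a set \<Rightarrow> bool" where
  "order_cone V Q \<longleftrightarrow> Q \<subseteq> V \<and> (\<forall>a\<in>Q. \<forall>b\<in>Q. a + b \<in> Q) \<and> (\<forall>r\<ge>0. \<forall>a\<in>Q. r *\<^sub>R a \<in> Q) \<and> - 1 \<notin> Q"

text \<open>If \<open>Q\<close> contains one of \<open>a\<close> and \<open>- a\<close> for every \<open>a\<close>, then each \<open>a\<close> defines a Dedekind cut of the scalars \<open>r\<close>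
  by whether \<open>a - r\<close> or \<open>r - a\<close> lies in \<open>Q\<close>. The cut point is the value of the functional.\<close>

lemma total_order_cone_functional:
  fixes V Q :: "'a::real_normed_algebra_1 set"
  assumes V: "subspace V" "1 \<in> V" and Q: "order_cone V Q"
    and total: "\<And>a. a \<in> V \<Longrightarrow> a \<in> Q \<or> - a \<in> Q"
    and arch: "\<And>a. a \<in> V \<Longrightarrow> \<exists>r. r *\<^sub>R 1 - a \<in> Q"
  obtains g :: "'a \<Rightarrow> real" where
    "\<And>a b. a \<in> V \<Longrightarrow> b \<in> V \<Longrightarrow> g (a + b) = g a + g b"
    "\<And>r a. a \<in> V \<Longrightarrow> g (r *\<^sub>R a) = r * g a" "g 1 = 1"
    "\<And>a. a \<in> Q \<Longrightarrow> 0 \<le> g a" "\<And>a. a \<in> V \<Longrightarrow> 0 < g a \<Longrightarrow> a \<in> Q"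
proof -
  have Qadd: "a + b \<in> Q" if "a \<in> Q" "b \<in> Q" for a b using Q that by (auto simp: order_cone_def)
  have Qscale: "r *\<^sub>R a \<in> Q" if "a \<in> Q" "0 \<le> r" for a r using Q that by (auto simp: order_cone_def)
  have QV: "a \<in> V" if "a \<in> Q" for a using Q that by (auto simp: order_cone_def)
  have Qm1: "- 1 \<notin> Q" using Q by (auto simp: order_cone_def)
  have Q1: "1 \<in> Q" using total[OF V(2)] Qm1 by blast
  have Qr: "r *\<^sub>R 1 \<in> Q \<longleftrightarrow> 0 \<le> r" for r
  proof
    show "r *\<^sub>R 1 \<in> Q" if "0 \<le> r" using Qscale[OF Q1 that] .
    show "0 \<le> r" if "r *\<^sub>R 1 \<in> Q"
    proof (rule ccontr)
      assume "\<not> 0 \<le> r"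
      then have "(1 / (- r)) *\<^sub>R (r *\<^sub>R 1) \<in> Q" by (intro Qscale that) simp
      with Qm1 \<open>\<not> 0 \<le> r\<close> show False by simp
    qed
  qed
  define S where "S a = {r. a - r *\<^sub>R 1 \<in> Q}" for a
  define g where "g a = Sup (S a)" for a
  have g_eq: "g a = c" if up: "\<And>e. e > 0 \<Longrightarrow> a - (c - e) *\<^sub>R 1 \<in> Q"
    and down: "\<And>e. e > 0 \<Longrightarrow> (c + e) *\<^sub>R 1 - a \<in> Q" for a c
    unfolding g_def
  proof (rule cSup_eq_non_empty)
    show "S a \<noteq> {}" using up[of 1] by (auto simp: S_def)
    show "r \<le> c" if "r \<in> S a" for r
    proof (rule field_le_epsilon)
      fix e :: real assume "0 < e"
      have "a - r *\<^sub>R 1 \<in> Q" using that by (simp add: S_def)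
      from Qadd[OF this down[OF \<open>0 < e\<close>]]
      have "(a - r *\<^sub>R 1) + ((c + e) *\<^sub>R 1 - a) \<in> Q" .
      also have "(a - r *\<^sub>R 1) + ((c + e) *\<^sub>R 1 - a) = (c + e - r) *\<^sub>R 1"
        by (simp add: scaleR_diff_left)
      finally show "r \<le> c + e" using Qr by simp
    qed
    show "c \<le> y" if "\<And>r. r \<in> S a \<Longrightarrow> r \<le> y" for y
    proof (rule field_le_epsilon)
      fix e :: real assume "0 < e"
      have "c - e \<in> S a" using up[OF \<open>0 < e\<close>] by (simp add: S_def)
      from that[OF this] show "c \<le> y + e" by simp
    qed
  qed
  have ne: "S a \<noteq> {}" and bdd: "bdd_above (S a)" if a: "a \<in> V" for a
  proof -
    have "- a \<in> V" using a V(1) by (simp add: subspace_neg)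
    from arch[OF this] obtain r where "r *\<^sub>R 1 + a \<in> Q" by auto
    then have "- r \<in> S a" by (simp add: S_def add.commute)
    then show "S a \<noteq> {}" by auto
    from arch[OF a] obtain r where r: "r *\<^sub>R 1 - a \<in> Q" by auto
    have "s \<le> r" if "s \<in> S a" for s
    proof -
      have "(a - s *\<^sub>R 1) + (r *\<^sub>R 1 - a) \<in> Q" using that by (intro Qadd r) (simp add: S_def)
      also have "(a - s *\<^sub>R 1) + (r *\<^sub>R 1 - a) = (r - s) *\<^sub>R 1" by (simp add: algebra_simps)
      finally show ?thesis using Qr by simp
    qed
    then show "bdd_above (S a)" by (auto simp: bdd_above_def)
  qed
  have up: "a - (g a - e) *\<^sub>R 1 \<in> Q" if a: "a \<in> V" and e: "e > 0" for a e
  proof -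
    obtain r where r: "r \<in> S a" "g a - e < r"
      using less_cSup_iff[OF ne[OF a] bdd[OF a], of "g a - e"] e by (auto simp: g_def)
    have "(a - r *\<^sub>R 1) + (r - (g a - e)) *\<^sub>R 1 \<in> Q"
      using r by (intro Qadd Qscale Q1) (auto simp: S_def)
    then show ?thesis by (simp add: algebra_simps)
  qed
  have down: "(g a + e) *\<^sub>R 1 - a \<in> Q" if a: "a \<in> V" and e: "e > 0" for a e
  proof -
    have "g a + e \<notin> S a"
      using cSup_upper[OF _ bdd[OF a], of "g a + e"] e by (auto simp: g_def)
    then have "a - (g a + e) *\<^sub>R 1 \<notin> Q" by (simp add: S_def)
    moreover have "a - (g a + e) *\<^sub>R 1 \<in> V" using a V by (simp add: subspace_diff subspace_scale)
    ultimately have "- (a - (g a + e) *\<^sub>R 1) \<in> Q" using total by blast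
    then show ?thesis by simp
  qed
  have g_add: "g (a + b) = g a + g b" if a: "a \<in> V" and b: "b \<in> V" for a b
  proof (rule g_eq)
    fix e :: real assume e: "0 < e"
    then have "a - (g a - e / 2) *\<^sub>R 1 + (b - (g b - e / 2) *\<^sub>R 1) \<in> Q"
      by (intro Qadd up a b) auto
    also have "a - (g a - e / 2) *\<^sub>R 1 + (b - (g b - e / 2) *\<^sub>R 1) = a + b - ((g a - e / 2) + (g b - e / 2)) *\<^sub>R 1"
      unfolding scaleR_add_left by simp
    also have "(g a - e / 2) + (g b - e / 2) = g a + g b - e" by simp
    finally show "a + b - (g a + g b - e) *\<^sub>R 1 \<in> Q" .
    have "(g a + e / 2) *\<^sub>R 1 - a + ((g b + e / 2) *\<^sub>R 1 - b) \<in> Q"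
      using e by (intro Qadd down a b) auto
    also have "(g a + e / 2) *\<^sub>R 1 - a + ((g b + e / 2) *\<^sub>R 1 - b) = ((g a + e / 2) + (g b + e / 2)) *\<^sub>R 1 - (a + b)"
      unfolding scaleR_add_left[of "g a + e / 2" "g b + e / 2"] by simp
    also have "(g a + e / 2) + (g b + e / 2) = g a + g b + e" by simp
    finally show "(g a + g b + e) *\<^sub>R 1 - (a + b) \<in> Q" .
  qed
  have g_pos_scale: "g (r *\<^sub>R a) = r * g a" if a: "a \<in> V" and r: "r > 0" for a r
  proof (rule g_eq)
    fix e :: real assume e: "0 < e"
    have "r *\<^sub>R (a - (g a - e / r) *\<^sub>R 1) \<in> Q" "r *\<^sub>R ((g a + e / r) *\<^sub>R 1 - a) \<in> Q"
      using e r by (auto intro!: Qscale up down a)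
    then show "r *\<^sub>R a - (r * g a - e) *\<^sub>R 1 \<in> Q" "(r * g a + e) *\<^sub>R 1 - r *\<^sub>R a \<in> Q"
      using r by (simp_all add: scaleR_diff_right right_diff_distrib distrib_left)
  qed
  have g_uminus: "g (- a) = - g a" if a: "a \<in> V" for a
  proof (rule g_eq)
    fix e :: real assume e: "0 < e"
    show "- a - (- g a - e) *\<^sub>R 1 \<in> Q" using down[OF a e] by (simp add: algebra_simps)
    show "(- g a + e) *\<^sub>R 1 - - a \<in> Q" using up[OF a e] by (simp add: algebra_simps)
  qed
  have g0: "g 0 = 0" using g_add[of 0 0] V(1) by (simp add: subspace_0)
  show thesis
  proof (rule that[of g])
    show "g (a + b) = g a + g b" if "a \<in> V" "b \<in> V" for a b using g_add that .
    show "g (r *\<^sub>R a) = r * g a" if a: "a \<in> V" for r a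
    proof (cases r "0::real" rule: linorder_cases)
      case less
      have "g (r *\<^sub>R a) = - g ((- r) *\<^sub>R a)"
        using g_uminus[of "(- r) *\<^sub>R a"] a V(1) by (simp add: subspace_scale subspace_neg)
      then show ?thesis using g_pos_scale[OF a, of "- r"] less by simp
    qed (use a g0 g_pos_scale in auto)
    show "g 1 = 1"
    proof (rule g_eq)
      fix e :: real assume "0 < e"
      then have "e *\<^sub>R 1 \<in> Q" using Qr by simp
      then show "1 - (1 - e) *\<^sub>R 1 \<in> Q" "(1 + e) *\<^sub>R 1 - 1 \<in> Q" by (simp_all add: algebra_simps)
    qed
    show "0 \<le> g a" if "a \<in> Q" for a
      unfolding g_def using that by (intro cSup_upper bdd QV) (simp_all add: S_def)
    show "a \<in> Q" if "a \<in> V" "0 < g a" for a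
      using up[OF that] by simp
  qed
qed

text \<open>Zorn's lemma in the form used for both cones and multiplicatively closed cones.\<close>

lemma maximal_superset:
  assumes "P Q0" "\<And>C. C \<noteq> {} \<Longrightarrow> subset.chain (Collect P) C \<Longrightarrow> P (\<Union>C)"
  obtains Q where "Q0 \<subseteq> Q" "P Q" "\<And>Q'. P Q' \<Longrightarrow> Q \<subseteq> Q' \<Longrightarrow> Q' = Q"
proof -
  have "\<exists>M\<in>{Q. P Q \<and> Q0 \<subseteq> Q}. \<forall>X\<in>{Q. P Q \<and> Q0 \<subseteq> Q}. M \<subseteq> X \<longrightarrow> X = M"
  proof (rule subset_Zorn_nonempty)
    show "{Q. P Q \<and> Q0 \<subseteq> Q} \<noteq> {}" using assms(1) by auto
    fix C assume C: "C \<noteq> {}" "subset.chain {Q. P Q \<and> Q0 \<subseteq> Q} C"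
    then have "subset.chain (Collect P) C" by (auto simp: subset_chain_def)
    moreover have "Q0 \<subseteq> \<Union>C" using C unfolding subset_chain_def by blast
    ultimately show "\<Union>C \<in> {Q. P Q \<and> Q0 \<subseteq> Q}" using assms(2)[OF C(1)] by auto
  qed
  then obtain Q where Q: "P Q" "Q0 \<subseteq> Q" and max: "\<forall>X\<in>{Q. P Q \<and> Q0 \<subseteq> Q}. Q \<subseteq> X \<longrightarrow> X = Q"
    by auto
  show thesis
  proof (rule that[OF Q(2,1)])
    fix Q' assume "P Q'" "Q \<subseteq> Q'"
    then show "Q' = Q" using max Q(2) by (metis (mono_tags, lifting) mem_Collect_eq order_trans)
  qed
qed

lemma chain_common_member:
  assumes "subset.chain S C" "a \<in> \<Union>C" "b \<in> \<Union>C"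
  obtains X where "X \<in> C" "a \<in> X" "b \<in> X"
  using assms unfolding subset_chain_def by blast

lemma order_cone_Union_chain:
  assumes "C \<noteq> {}" "subset.chain (Collect (order_cone V)) C"
  shows "order_cone V (\<Union>C)"
proof -
  have X: "order_cone V X" if "X \<in> C" for X using assms that by (auto simp: subset_chain_def)
  show ?thesis
    unfolding order_cone_def
  proof (intro conjI ballI allI impI)
    show "\<Union>C \<subseteq> V" using X unfolding order_cone_def by blast
    show "- 1 \<notin> \<Union>C" using X by (auto simp: order_cone_def)
    fix a assume a: "a \<in> \<Union>C"
    show "r *\<^sub>R a \<in> \<Union>C" if "0 \<le> r" for r using X a that by (auto simp: order_cone_def)
    fix b assume "b \<in> \<Union>C"
    with a obtain Y where "Y \<in> C" "a \<in> Y" "b \<in> Y" using chain_common_member[OF assms(2)] by metis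
    then show "a + b \<in> \<Union>C" using X unfolding order_cone_def by blast
  qed
qed

text \<open>This replaces the Hahn-Banach theorem. In a maximal cone every element or its negative is
  present: if \<open>a\<close> cannot be added without making the cone improper, then \<open>- 1 = q + r a\<close> with \<open>r > 0\<close>, which
  exhibits \<open>- a\<close> as an element of the cone.\<close>

lemma order_cone_extend_functional:
  fixes V Q :: "'a::real_normed_algebra_1 set"
  assumes V: "subspace V" "1 \<in> V" and Q: "order_cone V Q" and Q1: "1 \<in> Q"
    and arch: "\<And>a. a \<in> V \<Longrightarrow> \<exists>r. r *\<^sub>R 1 - a \<in> Q"
  obtains g :: "'a \<Rightarrow> real" where
    "\<And>a b. a \<in> V \<Longrightarrow> b \<in> V \<Longrightarrow> g (a + b) = g a + g b"
    "\<And>r a. a \<in> V \<Longrightarrow> g (r *\<^sub>R a) = r * g a" "g 1 = 1" "\<And>a. a \<in> Q \<Longrightarrow> 0 \<le> g a"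
proof -
  obtain R where QR: "Q \<subseteq> R" and R: "order_cone V R"
    and max: "\<And>R'. order_cone V R' \<Longrightarrow> R \<subseteq> R' \<Longrightarrow> R' = R"
    using maximal_superset[of "order_cone V", OF Q order_cone_Union_chain] by metis
  have Radd: "a + b \<in> R" if "a \<in> R" "b \<in> R" for a b using R that by (auto simp: order_cone_def)
  have Rscale: "r *\<^sub>R a \<in> R" if "a \<in> R" "0 \<le> r" for a r using R that by (auto simp: order_cone_def)
  have RV: "a \<in> V" if "a \<in> R" for a using R that by (auto simp: order_cone_def)
  have Rm1: "- 1 \<notin> R" using R by (auto simp: order_cone_def)
  have R1: "1 \<in> R" using Q1 QR by blast
  have R0: "0 \<in> R" using Rscale[OF R1, of 0] by simp
  have total: "a \<in> R \<or> - a \<in> R" if a: "a \<in> V" for a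
  proof (rule disjCI)
    assume na: "- a \<notin> R"
    define R' where "R' = {q + r *\<^sub>R a | q r. q \<in> R \<and> 0 \<le> r}"
    have R'I: "q + r *\<^sub>R a \<in> R'" if "q \<in> R" "0 \<le> r" for q r using that by (auto simp: R'_def)
    have "order_cone V R'"
      unfolding order_cone_def
    proof (intro conjI ballI allI impI)
      show "R' \<subseteq> V" using a V(1) RV by (auto simp: R'_def intro!: subspace_add subspace_scale)
      show "- 1 \<notin> R'"
      proof
        assume "- 1 \<in> R'"
        then obtain q r where qr: "- 1 = q + r *\<^sub>R a" "q \<in> R" "0 \<le> r" by (auto simp: R'_def)
        have "r \<noteq> 0" using qr Rm1 by auto
        have "r *\<^sub>R (- a) = q + 1" using arg_cong[OF qr(1), of "\<lambda>z. 1 + z - r *\<^sub>R a"] by (simp add: algebra_simps)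
        then have "- a = (1 / r) *\<^sub>R (q + 1)" using \<open>r \<noteq> 0\<close> by (metis divide_self scaleR_one scaleR_scaleR times_divide_eq_left mult_1_left)
        also have "\<dots> \<in> R" using qr R1 by (intro Rscale Radd) auto
        finally show False using na by blast
      qed
      fix u assume "u \<in> R'"
      then obtain q r where u: "u = q + r *\<^sub>R a" "q \<in> R" "0 \<le> r" by (auto simp: R'_def)
      show "s *\<^sub>R u \<in> R'" if "0 \<le> s" for s
        using R'I[of "s *\<^sub>R q" "s * r"] u that Rscale by (simp add: scaleR_add_right)
      fix v assume "v \<in> R'"
      then obtain q' r' where v: "v = q' + r' *\<^sub>R a" "q' \<in> R" "0 \<le> r'" by (auto simp: R'_def)
      show "u + v \<in> R'"
        using R'I[of "q + q'" "r + r'"] u v Radd by (simp add: scaleR_add_left algebra_simps)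
    qed
    moreover have "R \<subseteq> R'" using R'I[of _ 0] by auto
    ultimately have "R' = R" by (rule max)
    then show "a \<in> R" using R'I[OF R0, of 1] by simp
  qed
  have "\<exists>r. r *\<^sub>R 1 - a \<in> R" if "a \<in> V" for a using arch[OF that] QR by blast
  from total_order_cone_functional[OF V R total this]
  obtain g :: "'a \<Rightarrow> real" where g: "\<And>a b. a \<in> V \<Longrightarrow> b \<in> V \<Longrightarrow> g (a + b) = g a + g b"
    "\<And>r a. a \<in> V \<Longrightarrow> g (r *\<^sub>R a) = r * g a" "g 1 = 1" "\<And>a. a \<in> R \<Longrightarrow> 0 \<le> g a" by metis
  show thesis by (rule that[of g]) (use g QR in auto)
qed

section \<open>Characters of abelian subalgebras: existence\<close>

lemma (in unital_cstar_subalgebra) positive_sqrt: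
  assumes "positive x" "x \<in> A"
  obtains b where "b \<in> A" "positive b" "b * b = x"
proof -
  define t where "t = max 1 (norm x)"
  have t: "0 < t" by (simp add: t_def)
  have "norm (t *\<^sub>R 1 - x) \<le> t"
    by (rule norm_scalar_minus_positive[OF assms(1)]) (simp add: t_def)
  from sqrt_of_near_scalar[OF t positive_selfadjoint[OF assms(1)] this]
  obtain b where b: "adj b = b" "b * b = x" "norm (sqrt t *\<^sub>R 1 - b) \<le> sqrt t"
    "\<forall>S. closed_unital_subalgebra S \<and> x \<in> S \<longrightarrow> b \<in> S" by blast
  have "b \<in> A" using b(4) closed_unital_subalgebra_A assms(2) by blast
  then show thesis using that positive_of_near_scalar[OF b(1,3)] b(2) by blast
qed

locale unital_abelian_cstar_subalgebra = unital_cstar_subalgebra +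
  assumes comm: "x \<in> A \<Longrightarrow> y \<in> A \<Longrightarrow> x * y = y * x"
begin

lemma positive_mult:
  assumes "x \<in> A" "y \<in> A" "positive x" "positive y"
  shows "positive (x * y)"
proof -
  obtain b c where b: "b \<in> A" "positive b" "b * b = x" and c: "c \<in> A" "positive c" "c * c = y"
    using positive_sqrt assms by metis
  have "x * y = (b * c) * (b * c)"
    unfolding b(3)[symmetric] c(3)[symmetric]
    by (metis b(1) c(1) comm mult.assoc)
  moreover have "adj (b * c) = b * c"
    using b c comm by (simp add: adj_mult positive_selfadjoint)
  ultimately show ?thesis unfolding positive_def by blast
qed

lemma Neumann_inverse:
  assumes z: "z \<in> A" "norm z < 1"
  obtains y where "y \<in> A" "(1 - z) * y = 1"
proof -
  have s: "summable (\<lambda>n. z ^ n)" by (rule complete_algebra_summable_geometric[OF z(2)])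
  define y where "y = (\<Sum>n. z ^ n)"
  have pow: "z ^ n \<in> A" for n by (induction n) (use z in auto)
  have mem: "(\<Sum>k<n. z ^ k) \<in> A" for n by (intro sum_mem pow)
  have "y \<in> A"
    unfolding y_def by (rule closed_sequentially[OF closed_A mem summable_LIMSEQ[OF s]])
  have "(\<lambda>n. z ^ Suc n - z ^ n) sums (0 - z ^ 0)"
    by (rule telescope_sums[OF summable_LIMSEQ_zero[OF s]])
  then have "(\<lambda>n. - (z ^ Suc n - z ^ n)) sums - (0 - z ^ 0)" by (rule sums_minus)
  moreover have "(\<lambda>n. (1 - z) * z ^ n) sums ((1 - z) * y)"
    unfolding y_def by (rule sums_mult[OF summable_sums[OF s]])
  moreover have "- (z ^ Suc n - z ^ n) = (1 - z) * z ^ n" for n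
    by (simp add: left_diff_distrib)
  ultimately have "(1 - z) * y = 1" using sums_unique2 by fastforce
  with \<open>y \<in> A\<close> show thesis by (rule that)
qed

text \<open>By the norm criterion \<open>1 + s\<close> is, up to a scalar, at distance less than one from the unit.\<close>

lemma one_plus_positive_inverse:
  assumes s: "s \<in> A" "positive s"
  obtains y where "y \<in> A" "(1 + s) * y = 1"
proof -
  define t where "t = norm s"
  have t: "0 \<le> t" by (simp add: t_def)
  define z where "z = (1 / (t + 1)) *\<^sub>R (t *\<^sub>R 1 - s)"
  have "norm (t *\<^sub>R 1 - s) \<le> t" using norm_scalar_minus_positive[OF s(2)] by (simp add: t_def)
  then have "norm z < 1" using t by (simp add: z_def divide_simps)
  moreover have zA: "z \<in> A" using s by (auto simp: z_def)
  ultimately obtain y where y: "y \<in> A" "(1 - z) * y = 1" using Neumann_inverse by blast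
  have "(t + 1) *\<^sub>R (1 - z) = (t + 1) *\<^sub>R 1 - (t *\<^sub>R 1 - s)"
    using t by (simp add: z_def scaleR_diff_right)
  also have "\<dots> = 1 + s" by (simp add: scaleR_add_left)
  finally have "1 + s = (t + 1) *\<^sub>R (1 - z)" ..
  then have "(1 + s) * ((1 / (t + 1)) *\<^sub>R y) = 1" using y(2) t by simp
  then show thesis using that y(1) by blast
qed

text \<open>Squares together with the selfadjoint part of the ideal \<open>J\<close> generate a multiplicatively closed
  proper cone; it is proper because \<open>1 + s\<close> is invertible for positive \<open>s\<close>. In a maximal such cone \<open>Q\<close> every
  selfadjoint element or its negative occurs, so \<open>Q\<close> defines a real functional, which is multiplicative
  because \<open>Q\<close> is closed under products. On \<open>J\<close> it vanishes because both \<open>j\<close> and \<open>- j\<close> lie in \<open>Q\<close>.\<close>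

lemma exists_character:
  assumes J: "J \<subseteq> A" "0 \<in> J" and Jadd: "\<And>x y. x \<in> J \<Longrightarrow> y \<in> J \<Longrightarrow> x + y \<in> J"
    and Jmult: "\<And>x y. x \<in> A \<Longrightarrow> y \<in> J \<Longrightarrow> x * y \<in> J"
    and Jadj: "\<And>x. x \<in> J \<Longrightarrow> adj x \<in> J" and J1: "1 \<notin> J"
  obtains \<rho> where "\<rho> \<in> characters A" "\<And>x. x \<in> J \<Longrightarrow> \<rho> x = 0"
proof -
  define V where "V = {a \<in> A. adj a = a}"
  have V: "subspace V" "1 \<in> V" by (auto simp: V_def subspace_def adj_add)
  have Vm: "a * b \<in> V" if "a \<in> V" "b \<in> V" for a b
    using that comm by (auto simp: V_def adj_mult)
  have Vc: "a * b = b * a" if "a \<in> V" "b \<in> V" for a b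
    using that comm by (auto simp: V_def)
  have Jscale: "r *\<^sub>R x \<in> J" if "x \<in> J" for r x
    using Jmult[of "r *\<^sub>R 1" x] that by auto
  define P where "P Q \<longleftrightarrow> order_cone V Q \<and> (\<forall>a\<in>Q. \<forall>b\<in>Q. a * b \<in> Q) \<and> (\<forall>a\<in>V. a * a \<in> Q)" for Q
  define Q0 where "Q0 = {s + j | s j. s \<in> A \<and> positive s \<and> j \<in> J \<and> adj j = j}"
  have Q0I: "s + j \<in> Q0" if "s \<in> A" "positive s" "j \<in> J" "adj j = j" for s j
    using that by (auto simp: Q0_def)
  have "P Q0"
    unfolding P_def order_cone_def
  proof (intro conjI ballI allI impI)
    show "Q0 \<subseteq> V" using J by (auto simp: Q0_def V_def adj_add positive_selfadjoint)
    show "- 1 \<notin> Q0"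
    proof
      assume "- 1 \<in> Q0"
      then obtain s j where sj: "- 1 = s + j" "s \<in> A" "positive s" "j \<in> J" by (auto simp: Q0_def)
      from one_plus_positive_inverse[OF sj(2,3)]
      obtain y where y: "y \<in> A" "(1 + s) * y = 1" by blast
      have "1 + s = - j" using arg_cong[OF sj(1), of "\<lambda>z. 1 + z - j"] by simp
      then have "1 = - y * j" using y comm[of j y] sj J by auto
      also have "\<dots> \<in> J" using sj y by (intro Jmult) auto
      finally show False using J1 by blast
    qed
    show "a * a \<in> Q0" if "a \<in> V" for a
      using Q0I[of "a * a" 0] that J by (auto simp: V_def positive_def)
    fix a assume "a \<in> Q0"
    then obtain s j where a: "a = s + j" "s \<in> A" "positive s" "j \<in> J" "adj j = j" by (auto simp: Q0_def)
    show "r *\<^sub>R a \<in> Q0" if "0 \<le> r" for r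
      using Q0I[of "r *\<^sub>R s" "r *\<^sub>R j"] a that Jscale by (auto simp: positive_scaleR scaleR_add_right)
    fix b assume "b \<in> Q0"
    then obtain s' j' where b: "b = s' + j'" "s' \<in> A" "positive s'" "j' \<in> J" "adj j' = j'" by (auto simp: Q0_def)
    show "a + b \<in> Q0"
      using Q0I[of "s + s'" "j + j'"] a b Jadd by (auto simp: positive_add adj_add algebra_simps)
    have "j \<in> A" "j' \<in> A" using a b J by auto
    have c: "j' * s = s * j'" "s' * j = j * s'" "j' * j = j * j'"
      using a b \<open>j \<in> A\<close> \<open>j' \<in> A\<close> comm by blast+
    have "s * j' + s' * j + j * j' \<in> J"
      using a b \<open>j \<in> A\<close> by (intro Jadd Jmult) auto
    moreover have "adj (s * j' + s' * j + j * j') = s * j' + s' * j + j * j'"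
      using a b c by (simp add: adj_add adj_mult positive_selfadjoint)
    ultimately have "s * s' + (s * j' + s' * j + j * j') \<in> Q0"
      using a b by (intro Q0I positive_mult) auto
    then show "a * b \<in> Q0" using c by (simp add: a(1) b(1) algebra_simps)
  qed
  moreover have "P (\<Union>C)" if C: "C \<noteq> {}" "subset.chain (Collect P) C" for C
  proof -
    have X: "P X" if "X \<in> C" for X using C that by (auto simp: subset_chain_def)
    have "subset.chain (Collect (order_cone V)) C" using C by (auto simp: subset_chain_def P_def)
    with C(1) have "order_cone V (\<Union>C)" by (rule order_cone_Union_chain)
    moreover have "a * b \<in> \<Union>C" if ab: "a \<in> \<Union>C" "b \<in> \<Union>C" for a b
    proof -
      obtain Y where "Y \<in> C" "a \<in> Y" "b \<in> Y" using chain_common_member[OF C(2) ab] .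
      then show ?thesis using X unfolding P_def by blast
    qed
    moreover have "a * a \<in> \<Union>C" if "a \<in> V" for a
      using X C(1) that unfolding P_def by blast
    ultimately show ?thesis unfolding P_def by blast
  qed
  ultimately obtain Q where Q0Q: "Q0 \<subseteq> Q" and PQ: "P Q" and max: "\<And>Q'. P Q' \<Longrightarrow> Q \<subseteq> Q' \<Longrightarrow> Q' = Q"
    using maximal_superset[of P] by metis
  have Qc: "order_cone V Q" and Qadd: "\<And>a b. a \<in> Q \<Longrightarrow> b \<in> Q \<Longrightarrow> a + b \<in> Q"
    and Qscale: "\<And>r a. a \<in> Q \<Longrightarrow> 0 \<le> r \<Longrightarrow> r *\<^sub>R a \<in> Q"
    and Qmult: "\<And>a b. a \<in> Q \<Longrightarrow> b \<in> Q \<Longrightarrow> a * b \<in> Q" and Qsq: "\<And>a. a \<in> V \<Longrightarrow> a * a \<in> Q"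
    and Qm1: "- 1 \<notin> Q" and QV: "\<And>a. a \<in> Q \<Longrightarrow> a \<in> V"
    using PQ unfolding P_def order_cone_def by blast+
  have Q1: "1 \<in> Q" using Qsq[OF V(2)] by simp
  have Q0': "0 \<in> Q" using Qscale[OF Q1, of 0] by simp
  \<comment> \<open>Maximality: the multiplicative cone generated by \<open>Q\<close> and a new element is improper.\<close>
  have ext: "\<exists>s\<in>Q. \<exists>t\<in>Q. - 1 = s + a * t" if a: "a \<in> V" "a \<notin> Q" for a
  proof (rule ccontr)
    assume no: "\<not> ?thesis"
    define R where "R = {s + a * t | s t. s \<in> Q \<and> t \<in> Q}"
    have RI: "s + a * t \<in> R" if "s \<in> Q" "t \<in> Q" for s t using that by (auto simp: R_def)
    have QR: "Q \<subseteq> R" using RI[OF _ Q0'] by auto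
    have "P R"
      unfolding P_def order_cone_def
    proof (intro conjI ballI allI impI)
      show "R \<subseteq> V" using QV a Vm V(1) by (auto simp: R_def subspace_add)
      show "- 1 \<notin> R" using no by (auto simp: R_def)
      show "u * u \<in> R" if "u \<in> V" for u using Qsq[OF that] QR by blast
      fix u assume "u \<in> R"
      then obtain s t where u: "u = s + a * t" "s \<in> Q" "t \<in> Q" by (auto simp: R_def)
      show "r *\<^sub>R u \<in> R" if "0 \<le> r" for r
        using RI[OF Qscale[OF u(2) that] Qscale[OF u(3) that]] by (simp add: u(1) scaleR_add_right)
      fix v assume "v \<in> R"
      then obtain s' t' where v: "v = s' + a * t'" "s' \<in> Q" "t' \<in> Q" by (auto simp: R_def)
      show "u + v \<in> R" using RI[OF Qadd[OF u(2) v(2)] Qadd[OF u(3) v(3)]]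
        by (simp add: u(1) v(1) algebra_simps)
      have "s * s' + (a * a) * (t * t') \<in> Q" "s * t' + t * s' \<in> Q"
        using u v a by (auto intro!: Qadd Qmult Qsq)
      from RI[OF this] have "s * s' + a * a * (t * t') + a * (s * t' + t * s') \<in> R" .
      moreover have "s * (a * t') = a * (s * t')" "a * t * (a * t') = a * a * (t * t')"
        using Vc[of s a] Vc[of t a] QV u v a by (metis mult.assoc)+
      ultimately show "u * v \<in> R" by (simp add: u(1) v(1) algebra_simps)
    qed
    then have "R = Q" using QR by (rule max)
    then show False using RI[OF Q0' Q1] a by simp
  qed
  have total: "a \<in> Q \<or> - a \<in> Q" if a: "a \<in> V" for a
  proof (rule ccontr)
    assume "\<not> ?thesis"
    then have n: "a \<notin> Q" "- a \<notin> Q" by auto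
    have ma: "- a \<in> V" using a V(1) by (simp add: subspace_neg)
    obtain s t where st: "s \<in> Q" "t \<in> Q" "- 1 = s + a * t" using ext[OF a n(1)] by blast
    obtain s' t' where st': "s' \<in> Q" "t' \<in> Q" "- 1 = s' + - a * t'" using ext[OF ma n(2)] by blast
    \<comment> \<open>Multiplying the two relations for \<open>a\<close> and \<open>- a\<close> turns the right-hand side into minus a
      square times an element of \<open>Q\<close>.\<close>
    have e: "1 + s = - (a * t)" using arg_cong[OF st(3), of "\<lambda>z. 1 + z - a * t"] by simp
    have e': "1 + s' = a * t'" using arg_cong[OF st'(3), of "\<lambda>z. 1 + z + a * t'"] by simp
    have "(1 + s) * (1 + s') = - ((a * t) * (a * t'))" unfolding e e' by simp
    also have "(a * t) * (a * t') = a * a * (t * t')"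
      using Vc[of t a] QV st a by (metis mult.assoc)
    finally have eq: "(1 + s) * (1 + s') = - (a * a * (t * t'))" .
    have "- 1 = (1 + s) * (1 + s') - 1 + a * a * (t * t')" unfolding eq by simp
    also have "\<dots> = s + s' + s * s' + a * a * (t * t')" by (simp add: distrib_left distrib_right)
    also have "\<dots> \<in> Q" using st st' a by (intro Qadd Qmult Qsq) auto
    finally show False using Qm1 by blast
  qed
  have arch: "\<exists>r. r *\<^sub>R 1 - a \<in> Q" if "a \<in> V" for a
  proof -
    have "norm a *\<^sub>R 1 - a + 0 \<in> Q0"
      using that J by (intro Q0I positive_scalar_minus) (auto simp: V_def)
    then show ?thesis using Q0Q by auto
  qed
  from total_order_cone_functional[OF V Qc total arch] obtain g :: "'a \<Rightarrow> real" where
    gadd: "\<And>a b. a \<in> V \<Longrightarrow> b \<in> V \<Longrightarrow> g (a + b) = g a + g b"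
    and gscale: "\<And>r a. a \<in> V \<Longrightarrow> g (r *\<^sub>R a) = r * g a" and g1: "g 1 = 1"
    and gQ: "\<And>a. a \<in> Q \<Longrightarrow> 0 \<le> g a" and gQ': "\<And>a. a \<in> V \<Longrightarrow> 0 < g a \<Longrightarrow> a \<in> Q" by blast
  have gdiff: "g (a - b) = g a - g b" if "a \<in> V" "b \<in> V" for a b
    using gadd[of "a - b" b] that V(1) by (simp add: subspace_diff)
  \<comment> \<open>For \<open>a\<close> and \<open>b\<close> in the kernel, \<open>e \<plusminus> a\<close> and \<open>e \<plusminus> b\<close> lie in \<open>Q\<close>; sums of their products are
    \<open>2 (e\<^sup>2 \<plusminus> a b)\<close>, so the value at \<open>a b\<close> is at most \<open>e\<^sup>2\<close> in absolute value.\<close>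
  have gmult0: "g (a * b) = 0" if a: "a \<in> V" "g a = 0" and b: "b \<in> V" "g b = 0" for a b
  proof -
    have pm: "e *\<^sub>R 1 + x \<in> Q" "e *\<^sub>R 1 - x \<in> Q" if "0 < e" "x \<in> V" "g x = 0" for e x
      using that V by (auto intro!: gQ' subspace_add subspace_diff subspace_scale
          simp: gadd gdiff gscale g1 subspace_scale)
    have bound: "\<bar>g (a * b)\<bar> \<le> e * e" if e: "0 < e" for e
    proof -
      have "(e *\<^sub>R 1 + a) * (e *\<^sub>R 1 + b) + (e *\<^sub>R 1 - a) * (e *\<^sub>R 1 - b) \<in> Q"
        "(e *\<^sub>R 1 + a) * (e *\<^sub>R 1 - b) + (e *\<^sub>R 1 - a) * (e *\<^sub>R 1 + b) \<in> Q"
        by (intro Qadd[OF Qmult Qmult] pm[OF e a] pm[OF e b])+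
      moreover have "(e *\<^sub>R 1 + a) * (e *\<^sub>R 1 + b) + (e *\<^sub>R 1 - a) * (e *\<^sub>R 1 - b)
          = 2 *\<^sub>R ((e * e) *\<^sub>R 1 + a * b)"
        "(e *\<^sub>R 1 + a) * (e *\<^sub>R 1 - b) + (e *\<^sub>R 1 - a) * (e *\<^sub>R 1 + b)
          = 2 *\<^sub>R ((e * e) *\<^sub>R 1 - a * b)"
        unfolding scaleR_2 by (simp_all add: algebra_simps)
      ultimately have "0 \<le> g (2 *\<^sub>R ((e * e) *\<^sub>R 1 + a * b))" "0 \<le> g (2 *\<^sub>R ((e * e) *\<^sub>R 1 - a * b))"
        using gQ by metis+
      moreover have "(e * e) *\<^sub>R 1 + a * b \<in> V" "(e * e) *\<^sub>R 1 - a * b \<in> V" "(e * e) *\<^sub>R 1 \<in> V"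
        using V Vm a b by (auto intro!: subspace_add subspace_diff subspace_scale)
      ultimately show ?thesis using Vm a b V by (simp add: gscale gadd gdiff g1)
    qed
    show ?thesis
    proof (rule ccontr)
      assume "g (a * b) \<noteq> 0"
      define e where "e = sqrt (\<bar>g (a * b)\<bar> / 2)"
      have "0 < e" "e * e = \<bar>g (a * b)\<bar> / 2" using \<open>g (a * b) \<noteq> 0\<close> by (simp_all add: e_def)
      with bound[of e] \<open>g (a * b) \<noteq> 0\<close> show False by simp
    qed
  qed
  have gmult: "g (a * b) = g a * g b" if a: "a \<in> V" and b: "b \<in> V" for a b
  proof -
    let ?a = "a - g a *\<^sub>R 1" and ?b = "b - g b *\<^sub>R 1"
    have mem: "?a \<in> V" "?b \<in> V" "g a *\<^sub>R 1 \<in> V" "g b *\<^sub>R 1 \<in> V"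
      using a b V by (auto intro!: subspace_diff subspace_scale)
    have "0 = g (?a * ?b)" using mem a b V by (intro gmult0[symmetric]) (simp_all add: gdiff gscale g1)
    also have "?a * ?b = (a * b - g b *\<^sub>R a) - (g a *\<^sub>R b - (g a * g b) *\<^sub>R 1)"
      by (simp add: algebra_simps)
    also have "g \<dots> = g (a * b) - g b * g a - (g a * g b - g a * g b)"
      using a b V Vm by (simp add: gdiff gscale g1 subspace_diff subspace_scale)
    finally show ?thesis by simp
  qed
  have "g (a + b) = g a + g b" if "a \<in> A" "b \<in> A" "adj a = a" "adj b = b" for a b
    using gadd that by (auto simp: V_def)
  moreover have "g (r *\<^sub>R a) = r * g a" if "a \<in> A" "adj a = a" for r a
    using gscale that by (auto simp: V_def)
  ultimately obtain F where F: "F \<in> linear_functionals A"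
    and Fg: "\<And>a. a \<in> A \<Longrightarrow> adj a = a \<Longrightarrow> F a = of_real (g a)"
    using complexify[of g] by metis
  have FV: "F a = of_real (g a)" if "a \<in> V" for a using Fg that by (simp add: V_def)
  have Fdec: "F x = F (re_part x) + \<i> * F (im_part x)" if "x \<in> A" for x
    using linear_functionals_add[OF F, of "re_part x" "\<i> *\<^sub>C im_part x"]
      linear_functionals_scaleC[OF F, of "im_part x" \<i>] that
    by (simp add: re_part_plus_im_part re_part_mem im_part_mem scaleC_mem)
  have parts: "re_part x \<in> V" "im_part x \<in> V" if "x \<in> A" for x
    using that by (simp_all add: V_def re_part_mem im_part_mem)
  have "F \<in> characters A"
    unfolding characters_def
  proof (intro CollectI conjI ballI F)
    show "\<exists>x\<in>A. F x \<noteq> 0" by (rule bexI[of _ 1]) (simp_all add: FV V g1)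
    fix x y assume x: "x \<in> A" and y: "y \<in> A"
    define a b c d where abcd: "a = re_part x" "b = im_part x" "c = re_part y" "d = im_part y"
    have m: "a \<in> V" "b \<in> V" "c \<in> V" "d \<in> V" using x y by (simp_all add: abcd parts)
    have mm: "u \<in> A" if "u \<in> V" for u using that by (simp add: V_def)
    have "x * y = (a + \<i> *\<^sub>C b) * (c + \<i> *\<^sub>C d)" by (simp add: abcd re_part_plus_im_part)
    also have "\<dots> = (a * c - b * d) + \<i> *\<^sub>C (a * d + b * c)"
      by (simp add: algebra_simps mult_scaleC_left mult_scaleC_right scaleC_ii_ii scaleC_add_right)
    finally have xy: "x * y = (a * c - b * d) + \<i> *\<^sub>C (a * d + b * c)" .
    have "a * c - b * d \<in> A" "a * d + b * c \<in> A" using m mm by auto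
    then have "F (x * y) = F (a * c - b * d) + \<i> * F (a * d + b * c)"
      unfolding xy by (simp add: linear_functionals_add[OF F] linear_functionals_scaleC[OF F] scaleC_mem)
    also have "\<dots> = of_real (g a * g c - g b * g d) + \<i> * of_real (g a * g d + g b * g c)"
      using m Vm V(1) by (simp add: FV subspace_diff subspace_add gdiff gadd gmult)
    also have "\<dots> = (F a + \<i> * F b) * (F c + \<i> * F d)"
      using m by (simp add: FV algebra_simps)
    also have "\<dots> = F x * F y" by (simp add: abcd Fdec[OF x] Fdec[OF y])
    finally show "F (x * y) = F x * F y" .
  qed
  moreover have "F x = 0" if x: "x \<in> J" for x
  proof -
    have xA: "x \<in> A" using x J by auto
    have "re_part x \<in> J" unfolding re_part_def by (intro Jscale Jadd Jadj x)
    moreover have "im_part x = ((- \<i> / 2) *\<^sub>C 1) * (x + - 1 *\<^sub>R adj x)"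
      by (simp add: im_part_def mult_scaleC_left)
    moreover have "\<dots> \<in> J" by (intro Jmult Jadd Jscale Jadj x scaleC_mem one_mem)
    ultimately have J': "re_part x \<in> J" "im_part x \<in> J" by auto
    have "g j = 0" if j: "j \<in> J" "adj j = j" for j
    proof -
      have "0 + j \<in> Q0" "0 + - 1 *\<^sub>R j \<in> Q0" by (intro Q0I zero_mem positive_zero Jscale j(1), simp add: j)+
      then have "0 \<le> g j" "0 \<le> g (- 1 *\<^sub>R j)" using Q0Q gQ by auto
      moreover have "j \<in> V" using j J by (auto simp: V_def)
      ultimately show ?thesis using gscale[of j "- 1"] by simp
    qed
    then show ?thesis using Fdec[OF xA] parts[OF xA] J' by (simp add: FV)
  qed
  ultimately show thesis using that by blast
qed

section \<open>Characters of abelian subalgebras: spectral properties\<close>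

context
  fixes \<rho> assumes \<rho>: "\<rho> \<in> characters A"
begin

lemma character_linear: "\<rho> \<in> linear_functionals A"
  using \<rho> by (simp add: characters_def)

lemma character_add: "x \<in> A \<Longrightarrow> y \<in> A \<Longrightarrow> \<rho> (x + y) = \<rho> x + \<rho> y"
  by (rule linear_functionals_add[OF character_linear])

lemma character_scaleC: "x \<in> A \<Longrightarrow> \<rho> (c *\<^sub>C x) = c * \<rho> x"
  by (rule linear_functionals_scaleC[OF character_linear])

lemma character_scaleR: "x \<in> A \<Longrightarrow> \<rho> (r *\<^sub>R x) = of_real r * \<rho> x"
  by (rule linear_functionals_scaleR[OF character_linear])

lemma character_diff: "x \<in> A \<Longrightarrow> y \<in> A \<Longrightarrow> \<rho> (x - y) = \<rho> x - \<rho> y"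
  by (rule linear_functionals_diff[OF character_linear _ _ csubspace_A])

lemma character_mult: "x \<in> A \<Longrightarrow> y \<in> A \<Longrightarrow> \<rho> (x * y) = \<rho> x * \<rho> y"
  using \<rho> by (simp add: characters_def)

lemma character_zero: "\<rho> 0 = 0"
  by (rule linear_functionals_zero[OF character_linear csubspace_A])

lemma character_minus: "x \<in> A \<Longrightarrow> \<rho> (- x) = - \<rho> x"
  using character_diff[of 0 x] character_zero by auto

lemma character_sum: "(\<And>i. i \<in> I \<Longrightarrow> f i \<in> A) \<Longrightarrow> \<rho> (sum f I) = (\<Sum>i\<in>I. \<rho> (f i))"
  by (rule linear_functionals_sum[OF character_linear csubspace_A])

lemma character_one: "\<rho> 1 = 1"
proof -
  obtain x where "x \<in> A" "\<rho> x \<noteq> 0" using \<rho> by (auto simp: characters_def)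
  then show ?thesis using character_mult[of x 1] by simp
qed

text \<open>If \<open>\<rho> a\<close> had a nonzero imaginary part, an affine image \<open>b\<close> of \<open>a\<close> would be selfadjoint with \<open>\<rho> b = i\<close>,
  although \<open>1 + b * b\<close> is invertible.\<close>

lemma character_selfadjoint_real:
  assumes a: "a \<in> A" "adj a = a" shows "Im (\<rho> a) = 0"
proof (rule ccontr)
  define s t where "s = Re (\<rho> a)" and "t = Im (\<rho> a)"
  assume "Im (\<rho> a) \<noteq> 0"
  then have t: "t \<noteq> 0" by (simp add: t_def)
  define b where "b = (1 / t) *\<^sub>R (a - s *\<^sub>R 1)"
  have b: "b \<in> A" "adj b = b" using a by (auto simp: b_def)
  have \<rho>b: "\<rho> b = \<i>"
    using a t by (simp add: b_def character_scaleR character_diff character_one diff_mem scaleR_mem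
        s_def t_def complex_eq_iff)
  have "positive (b * b)" using b by (auto simp: positive_def)
  then obtain y where y: "y \<in> A" "(1 + b * b) * y = 1"
    using one_plus_positive_inverse[of "b * b"] b(1) by blast
  have "1 = \<rho> ((1 + b * b) * y)" unfolding y(2) by (rule character_one[symmetric])
  also have "\<dots> = \<rho> (1 + b * b) * \<rho> y" using b y by (intro character_mult) auto
  also have "\<rho> (1 + b * b) = 1 + \<i> * \<i>"
    using b by (simp add: character_mult character_add character_one \<rho>b mult_mem del: i_squared)
  finally show False by simp
qed

lemma character_adj:
  assumes x: "x \<in> A" shows "\<rho> (adj x) = cnj (\<rho> x)"
proof -
  have r: "Im (\<rho> (re_part x)) = 0" "Im (\<rho> (im_part x)) = 0"
    using x by (simp_all add: character_selfadjoint_real re_part_mem im_part_mem)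
  have e: "\<rho> x = \<rho> (re_part x) + \<i> * \<rho> (im_part x)"
    using x character_add[of "re_part x" "\<i> *\<^sub>C im_part x"] character_scaleC[of "im_part x" \<i>]
    by (simp add: re_part_plus_im_part re_part_mem im_part_mem scaleC_mem)
  have "adj x = re_part x + - \<i> *\<^sub>C im_part x"
    using arg_cong[OF re_part_plus_im_part[of x], of adj] by (simp add: adj_add adj_scaleC)
  then have "\<rho> (adj x) = \<rho> (re_part x) + - \<i> * \<rho> (im_part x)"
    using x character_add[of "re_part x" "- \<i> *\<^sub>C im_part x"] character_scaleC[of "im_part x" "- \<i>"]
    by (metis re_part_mem im_part_mem scaleC_mem)
  then show ?thesis using r by (simp add: e complex_eq_iff)
qed

lemma character_adj_mult:
  assumes "x \<in> A" shows "\<rho> (adj x * x) = of_real ((cmod (\<rho> x))\<^sup>2)"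
  using assms by (simp add: character_mult character_adj adj_mem complex_norm_square mult.commute del: of_real_power)

lemma character_positive:
  assumes "positive x" "x \<in> A" shows "\<rho> x \<in> \<real>\<^sub>\<ge>\<^sub>0"
proof -
  obtain b where b: "b \<in> A" "positive b" "b * b = x" using positive_sqrt assms by metis
  have "Im (\<rho> b) = 0" using b positive_selfadjoint by (intro character_selfadjoint_real) auto
  then have "\<rho> x = of_real ((Re (\<rho> b))\<^sup>2)"
    using b character_mult[of b b] by (simp add: complex_eq_iff power2_eq_square)
  then show ?thesis by (simp only: nonneg_Reals_of_real_iff) simp
qed

lemma norm_character_le:
  assumes x: "x \<in> A" shows "cmod (\<rho> x) \<le> norm x"
proof -
  have "positive ((norm x)\<^sup>2 *\<^sub>R 1 - adj x * x)"
    by (rule positive_scalar_minus) (simp_all add: adj_mult adj_adj norm_adj_mult)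
  then have "\<rho> ((norm x)\<^sup>2 *\<^sub>R 1 - adj x * x) \<in> \<real>\<^sub>\<ge>\<^sub>0"
    using x by (intro character_positive) auto
  also have "\<rho> ((norm x)\<^sup>2 *\<^sub>R 1 - adj x * x) = of_real ((norm x)\<^sup>2 - (cmod (\<rho> x))\<^sup>2)"
    using x by (simp add: character_diff character_scaleR character_one character_adj_mult mult_mem
        adj_mem scaleR_mem)
  finally have "(cmod (\<rho> x))\<^sup>2 \<le> (norm x)\<^sup>2" by (simp only: nonneg_Reals_of_real_iff)
  then show ?thesis by (rule power2_le_imp_le) simp
qed

end

text \<open>A selfadjoint element that is not invertible generates a proper ideal, and some character
  vanishes on it.\<close>

lemma inverse_from_characters:
  assumes a: "a \<in> A" "adj a = a" and nz: "\<And>\<rho>. \<rho> \<in> characters A \<Longrightarrow> \<rho> a \<noteq> 0"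
  obtains y where "y \<in> A" "a * y = 1"
proof -
  have "\<exists>y\<in>A. a * y = 1"
  proof (rule ccontr)
    assume no: "\<not> ?thesis"
    define J where "J = (\<lambda>y. a * y) ` A"
    have "\<exists>\<rho>\<in>characters A. \<forall>x\<in>J. \<rho> x = 0"
    proof -
      have "J \<subseteq> A" using a by (auto simp: J_def)
      moreover have "0 \<in> J" using image_eqI[of 0 "\<lambda>y. a * y" 0 A] by (auto simp: J_def)
      moreover have "x + y \<in> J" if "x \<in> J" "y \<in> J" for x y
        using that by (auto simp: J_def simp flip: distrib_left)
      moreover have "x * y \<in> J" if x: "x \<in> A" and "y \<in> J" for x y
      proof -
        obtain z where z: "z \<in> A" "y = a * z" using \<open>y \<in> J\<close> by (auto simp: J_def)
        have "x * y = a * (x * z)" unfolding z(2) using comm[OF a(1) x] by (metis mult.assoc)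
        then show ?thesis using x z by (auto simp: J_def)
      qed
      moreover have "adj x \<in> J" if x: "x \<in> J" for x
      proof -
        obtain z where z: "z \<in> A" "x = a * z" using x by (auto simp: J_def)
        have "adj x = a * adj z" using z(2) a comm[OF a(1) adj_mem[OF z(1)]] by (simp add: adj_mult)
        then show ?thesis using z by (auto simp: J_def)
      qed
      moreover have "1 \<notin> J" using no by (auto simp: J_def)
      ultimately obtain \<rho> where "\<rho> \<in> characters A" "\<And>x. x \<in> J \<Longrightarrow> \<rho> x = 0"
        by (rule exists_character) blast+
      then show ?thesis by blast
    qed
    moreover have "a \<in> J" unfolding J_def by (rule image_eqI[of _ _ 1]) auto
    ultimately show False using nz by blast
  qed
  then show thesis using that by blast
qed

text \<open>With \<open>c = norm a\<close>, it suffices that \<open>q = c\<^sup>2 - a * a\<close> is not invertible. If it were, it would be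
  bounded below by a positive scalar \<open>1 / K\<close>, so that \<open>a * a + e * e = c\<^sup>2 - 1 / K\<close> for a selfadjoint \<open>e\<close>, and
  the norm of \<open>a\<close> would be less than \<open>c\<close>.\<close>

lemma character_attains_norm_selfadjoint:
  assumes a: "a \<in> A" "adj a = a"
  obtains \<rho> where "\<rho> \<in> characters A" "cmod (\<rho> a) = norm a"
proof -
  define c where "c = norm a"
  define q where "q = c\<^sup>2 *\<^sub>R 1 - a * a"
  have q: "q \<in> A" "adj q = q" using a by (auto simp: q_def adj_mult)
  have "\<exists>\<rho>\<in>characters A. \<rho> q = 0"
  proof (rule ccontr)
    assume "\<not> ?thesis"
    then obtain y where y: "y \<in> A" "q * y = 1" using inverse_from_characters[OF q] by blast
    have naa: "norm (a * a) = c\<^sup>2" using norm_adj_mult[of a] a by (simp add: c_def)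
    have "positive q" unfolding q_def by (rule positive_scalar_minus) (use a naa in \<open>auto simp: adj_mult\<close>)
    then obtain u where u: "u \<in> A" "positive u" "u * u = q" using positive_sqrt q by metis
    have su: "adj u = u" using u by (simp add: positive_selfadjoint)
    have sy: "adj y = y"
    proof -
      have "adj y * q = 1" using arg_cong[OF y(2), of adj] q by (simp add: adj_mult)
      then have "adj y * (q * y) = y" by (simp flip: mult.assoc)
      then show ?thesis using y by simp
    qed
    \<comment> \<open>\<open>w\<close> is the inverse of the square root \<open>u\<close> of \<open>q\<close>, and \<open>K\<close> is the norm of \<open>w * w\<close>.\<close>
    define w where "w = u * y"
    have w: "w \<in> A" "adj w = w" using u y su sy comm by (auto simp: w_def adj_mult)
    have uw: "u * w = 1" using u y by (simp add: w_def flip: mult.assoc)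
    define K where "K = (norm w)\<^sup>2"
    have nw: "norm (w * w) = K" using norm_adj_mult[of w] w by (simp add: K_def)
    have nu: "norm (u * u) = (norm u)\<^sup>2" using norm_adj_mult[of u] su by simp
    have "1 \<le> norm u * norm w" using norm_mult_ineq[of u w] uw by simp
    then have "1\<^sup>2 \<le> (norm u * norm w)\<^sup>2" by (rule power_mono) simp
    then have "1 \<le> (norm u)\<^sup>2 * K" by (simp add: K_def power_mult_distrib)
    moreover have "(norm u)\<^sup>2 \<le> c\<^sup>2"
    proof -
      have "positive (a * a)" using a by (auto simp: positive_def)
      then have "norm (c\<^sup>2 *\<^sub>R 1 - a * a) \<le> c\<^sup>2"
        by (rule norm_scalar_minus_positive) (simp add: naa)
      then show ?thesis using nu u by (simp add: q_def)
    qed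
    ultimately have cK: "1 \<le> c\<^sup>2 * K"
      using mult_right_mono[of "(norm u)\<^sup>2" "c\<^sup>2" K] by (simp add: K_def)
    have K0: "0 < K"
    proof (rule ccontr)
      assume "\<not> 0 < K" then have "K = 0" by (simp add: K_def)
      then show False using cK by simp
    qed
    have "positive (K *\<^sub>R 1 - w * w)"
      by (rule positive_scalar_minus) (use w nw in \<open>auto simp: adj_mult\<close>)
    then obtain z where z: "z \<in> A" "positive z" "z * z = K *\<^sub>R 1 - w * w"
      using positive_sqrt[of "K *\<^sub>R 1 - w * w"] w(1) by blast
    define e where "e = (1 / sqrt K) *\<^sub>R (u * z)"
    have sz: "adj z = z" using z by (simp add: positive_selfadjoint)
    have e: "e \<in> A" "adj e = e" using u z su sz comm by (auto simp: e_def adj_mult)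
    have "(u * z) * (u * z) = (u * u) * (z * z)"
      using comm[OF u(1) z(1)] by (metis mult.assoc)
    also have "\<dots> = K *\<^sub>R (u * u) - (u * w) * (u * w)"
      unfolding z(3) using comm[OF u(1) w(1)] by (simp add: right_diff_distrib) (metis mult.assoc)
    also have "\<dots> = K *\<^sub>R q - 1" by (simp add: uw u(3))
    finally have "e * e = q - (1 / K) *\<^sub>R 1"
      using K0 by (simp add: e_def scaleR_diff_right)
    then have sumsq: "a * a + e * e = (c\<^sup>2 - 1 / K) *\<^sub>R 1"
      by (simp add: q_def algebra_simps)
    have "c\<^sup>2 \<le> norm (a * a + e * e)"
      unfolding c_def using norm_le_sum_squares[OF a(2) e(2)] comm a e by blast
    also have "\<dots> = c\<^sup>2 - 1 / K"
      unfolding sumsq using cK K0 by (simp add: field_simps)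
    finally show False using K0 by simp
  qed
  then obtain \<rho> where \<rho>: "\<rho> \<in> characters A" "\<rho> q = 0" by blast
  have "\<rho> q = of_real (c\<^sup>2) - \<rho> a * \<rho> a"
    using a by (simp add: q_def character_diff[OF \<rho>(1)] character_scaleR[OF \<rho>(1)]
        character_one[OF \<rho>(1)] character_mult[OF \<rho>(1)] mult_mem scaleR_mem)
  then have "\<rho> a * \<rho> a = of_real (c\<^sup>2)" using \<rho>(2) by simp
  then have "cmod (\<rho> a) * cmod (\<rho> a) = c\<^sup>2"
    by (metis norm_mult norm_of_real abs_power2)
  then have "(cmod (\<rho> a))\<^sup>2 = c\<^sup>2" by (simp only: power2_eq_square)
  then have "cmod (\<rho> a) = c" by (rule power2_eq_imp_eq) (simp_all add: c_def)
  then show thesis using that \<rho>(1) by (simp add: c_def)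
qed

lemma character_attains_norm:
  assumes x: "x \<in> A"
  obtains \<rho> where "\<rho> \<in> characters A" "cmod (\<rho> x) = norm x"
proof -
  obtain \<rho> where \<rho>: "\<rho> \<in> characters A" "cmod (\<rho> (adj x * x)) = norm (adj x * x)"
    using character_attains_norm_selfadjoint[of "adj x * x"] x by (auto simp: adj_mult adj_adj)
  have "(cmod (\<rho> x))\<^sup>2 = (norm x)\<^sup>2"
    using \<rho> x by (simp add: norm_adj_mult character_mult character_adj adj_mem norm_mult power2_eq_square)
  then show thesis using that \<rho>(1) by simp
qed

lemma norm_le_from_characters:
  assumes "x \<in> A" "\<And>\<rho>. \<rho> \<in> characters A \<Longrightarrow> cmod (\<rho> x) \<le> c" shows "norm x \<le> c"
  using character_attains_norm[OF assms(1)] assms(2) by metis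

lemma eq_from_characters:
  assumes "x \<in> A" "y \<in> A" "\<And>\<rho>. \<rho> \<in> characters A \<Longrightarrow> \<rho> x = \<rho> y" shows "x = y"
proof -
  have "norm (x - y) \<le> 0"
    using assms by (intro norm_le_from_characters) (auto simp: character_diff)
  then show ?thesis by simp
qed

lemma positive_from_characters:
  assumes x: "x \<in> A" and pos: "\<And>\<rho>. \<rho> \<in> characters A \<Longrightarrow> \<rho> x \<in> \<real>\<^sub>\<ge>\<^sub>0"
  shows "positive x"
proof (rule positive_of_near_scalar)
  have r: "\<rho> x = of_real (cmod (\<rho> x))" if "\<rho> \<in> characters A" for \<rho>
    using pos[OF that] by (auto elim!: nonneg_Reals_cases)
  show "adj x = x"
    using x r by (intro eq_from_characters) (auto simp: character_adj adj_mem, metis complex_cnj_complex_of_real)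
  show "norm (norm x *\<^sub>R 1 - x) \<le> norm x"
  proof (rule norm_le_from_characters)
    show "norm x *\<^sub>R 1 - x \<in> A" using x by auto
    fix \<rho> assume \<rho>: "\<rho> \<in> characters A"
    have "\<rho> (norm x *\<^sub>R 1 - x) = of_real (norm x - cmod (\<rho> x))"
      using x \<rho> r[OF \<rho>] by (simp add: character_diff character_scaleR character_one scaleR_mem)
    then have "cmod (\<rho> (norm x *\<^sub>R 1 - x)) = \<bar>norm x - cmod (\<rho> x)\<bar>" by (simp only: norm_of_real)
    then show "cmod (\<rho> (norm x *\<^sub>R 1 - x)) \<le> norm x"
      using norm_character_le[OF \<rho> x] by simp
  qed
qed

text \<open>The element \<open>e = \<epsilon>\<^sup>2 / (\<epsilon>\<^sup>2 + z\<^sup>* z)\<close> is concentrated where \<open>z\<close> is small. The last bound is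
  \<open>t \<epsilon> \<le> \<epsilon>\<^sup>2 + t\<^sup>2\<close> for the values \<open>t\<close> of \<open>\<bar>z\<bar>\<close>.\<close>

lemma bump:
  assumes \<rho>: "\<rho> \<in> characters A" and z: "z \<in> A" "\<rho> z = 0" and \<epsilon>: "0 < \<epsilon>"
  obtains e where "e \<in> A" "adj e = e" "\<rho> e = 1" "norm e \<le> 1" "norm (z * e) \<le> \<epsilon>"
proof -
  define r where "r = \<epsilon>\<^sup>2"
  have r: "0 < r" using \<epsilon> by (simp add: r_def)
  define q where "q = r *\<^sub>R 1 + adj z * z"
  have q: "q \<in> A" "adj q = q" using z by (auto simp: q_def adj_add adj_mult adj_adj)
  have \<sigma>q: "\<sigma> q = of_real (r + (cmod (\<sigma> z))\<^sup>2)" if "\<sigma> \<in> characters A" for \<sigma>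
    using that z by (simp add: q_def character_add character_scaleR character_one character_adj_mult
        adj_mem mult_mem scaleR_mem)
  have pos: "0 < r + (cmod (\<sigma> z))\<^sup>2" for \<sigma> using r by (simp add: add_pos_nonneg)
  have "\<sigma> q \<noteq> 0" if "\<sigma> \<in> characters A" for \<sigma>
    unfolding \<sigma>q[OF that] using pos[of \<sigma>] by (simp only: of_real_eq_0_iff)
  then obtain y where y: "y \<in> A" "q * y = 1" using inverse_from_characters[OF q] by blast
  have \<sigma>y: "\<sigma> y = of_real (1 / (r + (cmod (\<sigma> z))\<^sup>2))" if s: "\<sigma> \<in> characters A" for \<sigma>
  proof -
    have "\<sigma> q * \<sigma> y = 1" using character_mult[OF s q(1) y(1)] y character_one[OF s] by simp
    moreover have "\<sigma> q \<noteq> 0" using calculation by auto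
    ultimately have "\<sigma> y = 1 / \<sigma> q" by (simp add: field_simps)
    then show ?thesis unfolding \<sigma>q[OF s] by simp
  qed
  define e where "e = r *\<^sub>R y"
  have e: "e \<in> A" using y by (auto simp: e_def)
  have \<sigma>e: "\<sigma> e = of_real (r / (r + (cmod (\<sigma> z))\<^sup>2))" if "\<sigma> \<in> characters A" for \<sigma>
    using that y by (simp add: e_def character_scaleR \<sigma>y)
  show thesis
  proof (rule that[OF e])
    show "adj e = e"
      using e by (intro eq_from_characters) (auto simp: character_adj adj_mem \<sigma>e simp del: of_real_divide of_real_add of_real_power)
    show "\<rho> e = 1" using \<sigma>e[OF \<rho>] z r by simp
    show "norm e \<le> 1"
    proof (rule norm_le_from_characters[OF e])
      fix \<sigma> assume s: "\<sigma> \<in> characters A"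
      show "cmod (\<sigma> e) \<le> 1"
        unfolding \<sigma>e[OF s] norm_of_real using r pos[of \<sigma>] by simp
    qed
    show "norm (z * e) \<le> \<epsilon>"
    proof (rule norm_le_from_characters)
      show "z * e \<in> A" using z e by auto
      fix \<sigma> assume s: "\<sigma> \<in> characters A"
      define t where "t = cmod (\<sigma> z)"
      have "cmod (\<sigma> (z * e)) = t * (r / (r + t\<^sup>2))"
        unfolding character_mult[OF s z(1) e] \<sigma>e[OF s] norm_mult norm_of_real
        using r pos[of \<sigma>] by (simp add: t_def)
      also have "\<dots> \<le> \<epsilon>"
      proof -
        have "t * \<epsilon> \<le> \<epsilon>\<^sup>2 + t\<^sup>2"
        proof -
          have "0 \<le> t * \<epsilon>" using \<epsilon> by (simp add: t_def)
          moreover have "2 * (t * \<epsilon>) \<le> t\<^sup>2 + \<epsilon>\<^sup>2" using sum_squares_bound[of t \<epsilon>] by (simp only: mult.assoc)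
          ultimately show ?thesis by linarith
        qed
        then have "t * \<epsilon> * \<epsilon> \<le> (\<epsilon>\<^sup>2 + t\<^sup>2) * \<epsilon>" using \<epsilon> by (intro mult_right_mono) auto
        then show ?thesis using pos[of \<sigma>] by (simp add: r_def t_def divide_simps power2_eq_square mult_ac)
      qed
      finally show "cmod (\<sigma> (z * e)) \<le> \<epsilon>" .
    qed
  qed
qed

text \<open>The positive part is \<open>(\<bar>b\<bar> + b) / 2\<close> with \<open>\<bar>b\<bar>\<close> the positive square root of \<open>b * b\<close>.\<close>

lemma positive_part:
  assumes b: "b \<in> A" "adj b = b"
  obtains k where "k \<in> A" "adj k = k" "\<And>\<sigma>. \<sigma> \<in> characters A \<Longrightarrow> \<sigma> k = of_real (max 0 (Re (\<sigma> b)))"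
proof -
  have "positive (b * b)" using b by (auto simp: positive_def)
  then obtain m where m: "m \<in> A" "positive m" "m * m = b * b" using positive_sqrt[of "b * b"] b by auto
  define k where "k = (1 / 2) *\<^sub>R (m + b)"
  show thesis
  proof (rule that[of k])
    show "k \<in> A" "adj k = k" using m b by (auto simp: k_def adj_add positive_selfadjoint)
    fix \<sigma> assume s: "\<sigma> \<in> characters A"
    have "\<sigma> m \<in> \<real>\<^sub>\<ge>\<^sub>0" by (rule character_positive[OF s m(2,1)])
    then obtain u where u: "\<sigma> m = of_real u" "0 \<le> u" by (auto elim: nonneg_Reals_cases)
    obtain v where v: "\<sigma> b = of_real v"
      using character_selfadjoint_real[OF s b] by (metis complex_is_Real_iff Reals_cases)
    have "\<sigma> m * \<sigma> m = \<sigma> b * \<sigma> b" using m b s by (metis character_mult)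
    then have "u * u = v * v" unfolding u v by (metis of_real_eq_iff of_real_mult)
    then have "u = \<bar>v\<bar>" using u(2) by (metis abs_mult_self_eq abs_of_nonneg power2_eq_imp_eq power2_eq_square abs_ge_zero)
    then show "\<sigma> k = of_real (max 0 (Re (\<sigma> b)))"
      using m b s by (simp add: k_def character_scaleR character_add add_mem u v max_def)
  qed
qed

end

section \<open>Partitions of unity\<close>

text \<open>The span of \<open>K\<close> is an ideal on which no character vanishes, so it contains the unit. The finitely
  many elements of \<open>K\<close> occurring in a representation of the unit have no common zero; hence the sum of
  their squares is invertible, and dividing by its square root normalizes the sum to one.

  This algebraic form of compactness of the character space avoids topologizing it.\<close>

lemma (in unital_abelian_cstar_subalgebra) partition_of_unity:
  assumes K: "\<And>k. k \<in> K \<Longrightarrow> k \<in> A \<and> adj k = k"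
    and Kmult: "\<And>h k. h \<in> A \<Longrightarrow> adj h = h \<Longrightarrow> k \<in> K \<Longrightarrow> h * k \<in> K"
    and nz: "\<And>\<rho>. \<rho> \<in> characters A \<Longrightarrow> \<exists>k\<in>K. \<rho> k \<noteq> 0"
  obtains t :: "'a set" and h where "\<forall>k\<in>t. h k \<in> K" "(\<Sum>k\<in>t. h k * h k) = 1"
proof -
  have KA: "K \<subseteq> A" using K by blast
  have spanA: "cspan K \<subseteq> A" by (rule complex_vector.span_minimal[OF KA csubspace_A])
  have "1 \<in> cspan K"
  proof (rule ccontr)
    assume "1 \<notin> cspan K"
    have mult: "x * y \<in> cspan K" if x: "x \<in> A" and y: "y \<in> cspan K" for x y
      using y
    proof (induction rule: complex_vector.span_induct)
      case base
      show ?case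
        by (rule complex_vector.subspaceI)
          (auto simp: complex_vector.span_zero distrib_left mult_scaleC_right
            intro: complex_vector.span_add complex_vector.span_scale)
    next
      case (step k)
      have "x * k = re_part x * k + \<i> *\<^sub>C (im_part x * k)"
        by (metis re_part_plus_im_part distrib_right mult_scaleC_left)
      also have "\<dots> \<in> cspan K"
        using x step by (intro complex_vector.span_add complex_vector.span_scale complex_vector.span_base Kmult
            re_part_mem im_part_mem adj_re_part adj_im_part)
      finally show ?case .
    qed
    have adj: "adj y \<in> cspan K" if y: "y \<in> cspan K" for y
      using y
    proof (induction rule: complex_vector.span_induct)
      case base
      show ?case
        by (rule complex_vector.subspaceI)
          (auto simp: complex_vector.span_zero adj_add adj_scaleC
            intro: complex_vector.span_add complex_vector.span_scale)
    next
      case (step k)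
      then show ?case using K by (simp add: complex_vector.span_base)
    qed
    obtain \<rho> where \<rho>: "\<rho> \<in> characters A" "\<And>x. x \<in> cspan K \<Longrightarrow> \<rho> x = 0"
      using exists_character[OF spanA complex_vector.span_zero complex_vector.span_add mult adj \<open>1 \<notin> cspan K\<close>]
      by metis
    obtain k where "k \<in> K" "\<rho> k \<noteq> 0" using nz[OF \<rho>(1)] by blast
    then show False using \<rho>(2) complex_vector.span_base[of k K] by blast
  qed
  then obtain t r where t: "finite t" "t \<subseteq> K" and one: "(\<Sum>k\<in>t. r k *\<^sub>C k) = 1"
    unfolding complex_vector.span_explicit by auto
  have tA: "k \<in> A" "adj k = k" if "k \<in> t" for k using that t K by auto
  define s where "s = (\<Sum>k\<in>t. k * k)"
  have "positive (k * k)" if "k \<in> t" for k using tA(2)[OF that] unfolding positive_def by metis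
  then have s: "s \<in> A" "positive s"
    unfolding s_def using tA by (auto intro!: sum_mem positive_sum)
  obtain b where b: "b \<in> A" "positive b" "b * b = s" using positive_sqrt s by metis
  have sb: "adj b = b" using b by (simp add: positive_selfadjoint)
  have "\<sigma> b \<noteq> 0" if \<sigma>: "\<sigma> \<in> characters A" for \<sigma>
  proof
    assume "\<sigma> b = 0"
    then have "\<sigma> s = 0" using b character_mult[OF \<sigma>, of b b] by simp
    moreover have "\<sigma> s = (\<Sum>k\<in>t. of_real ((cmod (\<sigma> k))\<^sup>2))"
    proof -
      have "\<sigma> s = (\<Sum>k\<in>t. \<sigma> (k * k))"
        unfolding s_def using tA by (intro character_sum[OF \<sigma>]) auto
      also have "\<dots> = (\<Sum>k\<in>t. of_real ((cmod (\<sigma> k))\<^sup>2))"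
        using character_adj_mult[OF \<sigma>] tA by (intro sum.cong refl) metis
      finally show ?thesis .
    qed
    ultimately have "(\<Sum>k\<in>t. (cmod (\<sigma> k))\<^sup>2) = 0" by (simp only: of_real_sum[symmetric] of_real_eq_0_iff)
    then have "\<sigma> k = 0" if "k \<in> t" for k using that t by (simp add: sum_nonneg_eq_0_iff)
    then have "\<sigma> (\<Sum>k\<in>t. r k *\<^sub>C k) = 0"
      using tA by (subst character_sum[OF \<sigma>]) (auto simp: character_scaleC[OF \<sigma>])
    then show False using one character_one[OF \<sigma>] by simp
  qed
  then obtain y where y: "y \<in> A" "b * y = 1" using inverse_from_characters[OF b(1) sb] by blast
  have "adj y * b = 1" using arg_cong[OF y(2), of adj] sb by (simp add: adj_mult)
  then have "adj y * (b * y) = y" by (simp flip: mult.assoc)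
  then have sy: "adj y = y" using y by simp
  show thesis
  proof (rule that[of t "\<lambda>k. y * k"])
    show "\<forall>k\<in>t. y * k \<in> K" using t y sy by (auto intro: Kmult)
    have "(y * k) * (y * k) = y * y * (k * k)" if "k \<in> t" for k
      using comm[OF y(1) tA(1)[OF that]] by (metis mult.assoc)
    then have "(\<Sum>k\<in>t. (y * k) * (y * k)) = y * y * s"
      by (simp add: s_def sum_distrib_left)
    also have "\<dots> = (b * y) * (b * y)"
      unfolding b(3)[symmetric] using comm[OF b(1) y(1)] by (metis mult.assoc)
    finally show "(\<Sum>k\<in>t. (y * k) * (y * k)) = 1" using y by simp
  qed
qed

section \<open>Elements of the form \<open>a\<^sup>* a\<close> are positive\<close>

text \<open>Any selfadjoint element lies in an abelian unital subalgebra, to which the results on characters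
  apply. The bicommutant is the most convenient choice, since its closure properties are immediate.\<close>

definition bicommutant :: "'a::cstar_algebra \<Rightarrow> 'a set" where
  "bicommutant x = {y. \<forall>z. z * x = x * z \<longrightarrow> z * y = y * z}"

lemma mem_bicommutant: "x \<in> bicommutant x"
  by (simp add: bicommutant_def)

lemma bicommutant_unital_abelian:
  fixes x :: "'a::cstar_algebra"
  assumes x: "adj x = x" shows "unital_abelian_cstar_subalgebra (bicommutant x)"
proof
  show "1 \<in> bicommutant x" by (simp add: bicommutant_def)
  have commutes: "z * y = y * z" if "y \<in> bicommutant x" "z * x = x * z" for y z
    using that unfolding bicommutant_def by blast
  have x_commutes: "y * x = x * y" if "y \<in> bicommutant x" for y
    using commutes[OF that, of x] by simp
  show "y * z = z * y" if "y \<in> bicommutant x" "z \<in> bicommutant x" for y z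
    using commutes[OF that(2) x_commutes[OF that(1)]] .
  have memI: "y \<in> bicommutant x" if "\<And>z. z * x = x * z \<Longrightarrow> z * y = y * z" for y
    using that unfolding bicommutant_def by blast
  have "csubspace (bicommutant x)"
  proof (rule complex_vector.subspaceI)
    show "0 \<in> bicommutant x" by (rule memI) simp
    fix y z c assume y: "y \<in> bicommutant x"
    show "c *\<^sub>C y \<in> bicommutant x"
      by (rule memI) (simp add: mult_scaleC_left mult_scaleC_right commutes[OF y])
    assume z: "z \<in> bicommutant x"
    show "y + z \<in> bicommutant x"
      by (rule memI) (simp add: distrib_left distrib_right commutes[OF y] commutes[OF z])
  qed
  moreover have "closed (bicommutant x)"
  proof -
    have "bicommutant x = (\<Inter>z\<in>{z. z * x = x * z}. {y. z * y = y * z})"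
      unfolding bicommutant_def by blast
    moreover have "closed {y. z * y = y * z}" for z :: 'a by (intro closed_Collect_eq continuous_intros)
    ultimately show ?thesis by (simp add: closed_INT)
  qed
  moreover have "y * z \<in> bicommutant x" if "y \<in> bicommutant x" "z \<in> bicommutant x" for y z
  proof (rule memI)
    fix w assume w: "w * x = x * w"
    have "w * (y * z) = (y * w) * z" unfolding commutes[OF that(1) w, symmetric] by (rule mult.assoc[symmetric])
    also have "\<dots> = y * (z * w)" unfolding commutes[OF that(2) w, symmetric] by (rule mult.assoc)
    finally show "w * (y * z) = y * z * w" by (simp only: mult.assoc)
  qed
  moreover have "adj y \<in> bicommutant x" if y: "y \<in> bicommutant x" for y
  proof (rule memI)
    fix z assume "z * x = x * z"
    then have "adj (z * x) = adj (x * z)" by (rule arg_cong)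
    then have "adj z * x = x * adj z" unfolding adj_mult x by (rule sym)
    then have "adj (adj z * y) = adj (y * adj z)" by (simp only: commutes[OF y])
    then show "z * adj y = adj y * z" unfolding adj_mult adj_adj by (rule sym)
  qed
  ultimately show "cstar_subalgebra (bicommutant x)" unfolding cstar_subalgebra_def by blast
qed

text \<open>Let \<open>n\<close> be the negative part of \<open>x = adj a * a\<close> and \<open>c = a * n\<close>. Then \<open>adj c * c = - q\<close> with \<open>q = n\<^sup>3\<close>
  positive, whereas \<open>r = c * adj c\<close> is positive because \<open>adj c * c + c * adj c\<close> is a sum of squares. The
  classical argument now compares the spectra of \<open>adj c * c\<close> and \<open>c * adj c\<close>. Here a single identity
  suffices: \<open>adj c * (t - r) * c = - q (t + q)\<close> with \<open>t = norm q = norm r\<close>. The left-hand side has norm at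
  most \<open>t\<^sup>2\<close> as \<open>r\<close> is positive, and the right-hand side has norm \<open>2 t\<^sup>2\<close>, so \<open>t = 0\<close>.\<close>

theorem positive_adj_mult: "positive (adj a * a)"
proof -
  define x where "x = adj a * a"
  have x: "adj x = x" by (simp add: x_def adj_mult adj_adj)
  interpret unital_abelian_cstar_subalgebra "bicommutant x"
    by (rule bicommutant_unital_abelian[OF x])
  let ?A = "bicommutant x"
  have xA: "x \<in> ?A" by (rule mem_bicommutant)
  obtain n where n: "n \<in> ?A" "adj n = n"
    and \<sigma>n: "\<And>\<sigma>. \<sigma> \<in> characters ?A \<Longrightarrow> \<sigma> n = of_real (max 0 (Re (\<sigma> (- x))))"
    using positive_part[of "- x"] xA x by (metis adj_minus minus_mem)
  have \<sigma>x: "\<sigma> x = of_real (Re (\<sigma> x))" if "\<sigma> \<in> characters ?A" for \<sigma>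
    using character_selfadjoint_real[OF that xA x] by (simp add: complex_eq_iff)
  have \<sigma>n': "\<sigma> n = of_real (max 0 (- Re (\<sigma> x)))" if "\<sigma> \<in> characters ?A" for \<sigma>
    using \<sigma>n[OF that] character_minus[OF that xA] by simp
  define c where "c = a * n"
  define q where "q = n * n * n"
  have q: "q \<in> ?A" unfolding q_def by (intro mult_mem n)
  have \<sigma>q: "\<sigma> q = of_real ((max 0 (- Re (\<sigma> x))) ^ 3)" if s: "\<sigma> \<in> characters ?A" for \<sigma>
    using n by (simp add: q_def character_mult[OF s] mult_mem \<sigma>n'[OF s] power3_eq_cube)
  have "positive q"
  proof (rule positive_from_characters[OF q])
    fix \<sigma> assume "\<sigma> \<in> characters ?A"
    from \<sigma>q[OF this] show "\<sigma> q \<in> \<real>\<^sub>\<ge>\<^sub>0" by (simp only: nonneg_Reals_of_real_iff) simp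
  qed
  have cc: "adj c * c = - q"
  proof -
    have "adj c * c = n * x * n" by (simp add: c_def x_def adj_mult n mult.assoc)
    also have "n * x * n = - q"
    proof (rule eq_from_characters)
      show "n * x * n \<in> ?A" "- q \<in> ?A" using n xA q by auto
      fix \<sigma> assume s: "\<sigma> \<in> characters ?A"
      have "m * r * m = - (m ^ 3)" if "m = max 0 (- r)" for m r :: real
        using that by (cases "r \<le> 0") (auto simp: power3_eq_cube)
      then have "complex_of_real (max 0 (- Re (\<sigma> x)) * Re (\<sigma> x) * max 0 (- Re (\<sigma> x)))
          = - of_real (max 0 (- Re (\<sigma> x)) ^ 3)" by (simp only: of_real_minus)
      then show "\<sigma> (n * x * n) = \<sigma> (- q)"
        unfolding character_minus[OF s q] \<sigma>q[OF s] character_mult[OF s mult_mem[OF n(1) xA] n(1)]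
          character_mult[OF s n(1) xA] \<sigma>n'[OF s]
        by (subst \<sigma>x[OF s]) (simp only: of_real_mult)
    qed
    finally show ?thesis .
  qed
  define r where "r = c * adj c"
  define t where "t = norm q"
  have nc: "(norm c)\<^sup>2 = t" using norm_adj_mult[of c] by (simp add: cc t_def)
  have nr: "norm r = t" using norm_mult_adj[of c] nc by (simp add: r_def)
  have "positive r"
  proof -
    define h k where "h = re_part c" and "k = im_part c"
    have c: "c = h + \<i> *\<^sub>C k" by (simp add: h_def k_def re_part_plus_im_part)
    have ac: "adj c = h - \<i> *\<^sub>C k"
      unfolding c by (simp add: adj_add adj_scaleC h_def k_def complex_vector.scale_minus_left)
    have "adj c * c + c * adj c = 2 *\<^sub>R (h * h + k * k)"
      unfolding ac unfolding c
      by (simp add: algebra_simps mult_scaleC_left mult_scaleC_right scaleC_ii_ii scaleR_2)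
    then have r: "r = 2 *\<^sub>R (h * h + k * k) + q" unfolding cc r_def by (simp add: algebra_simps)
    have "positive (h * h)" "positive (k * k)"
      unfolding positive_def h_def k_def using adj_re_part adj_im_part by blast+
    then show ?thesis unfolding r using \<open>positive q\<close> by (intro positive_add positive_scaleR) auto
  qed
  then have "norm (t *\<^sub>R 1 - r) \<le> t" by (rule norm_scalar_minus_positive) (simp add: nr)
  have "adj c * (t *\<^sub>R 1 - r) * c = - (q * (t *\<^sub>R 1 + q))"
  proof -
    have "adj c * (t *\<^sub>R 1 - r) * c = t *\<^sub>R (adj c * c) - (adj c * c) * (adj c * c)"
      by (simp add: r_def right_diff_distrib left_diff_distrib mult.assoc)
    then show ?thesis unfolding cc by (simp add: distrib_left)
  qed
  then have "norm (q * (t *\<^sub>R 1 + q)) = norm (adj c * (t *\<^sub>R 1 - r) * c)" by simp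
  also have "\<dots> \<le> norm (adj c) * norm (t *\<^sub>R 1 - r) * norm c"
    by (meson norm_mult_ineq mult_right_mono norm_ge_zero order_trans)
  also have "\<dots> \<le> norm c * t * norm c"
    using \<open>norm (t *\<^sub>R 1 - r) \<le> t\<close> by (intro mult_mono) (auto simp: t_def)
  also have "\<dots> = t * t" using nc by (simp add: power2_eq_square mult_ac)
  finally have le: "norm (q * (t *\<^sub>R 1 + q)) \<le> t * t" .
  obtain \<sigma> where \<sigma>: "\<sigma> \<in> characters ?A" "cmod (\<sigma> q) = t"
    using character_attains_norm[OF q] unfolding t_def by blast
  have "\<sigma> q = of_real t"
  proof -
    have "\<sigma> q \<in> \<real>\<^sub>\<ge>\<^sub>0" by (rule character_positive[OF \<sigma>(1) \<open>positive q\<close> q])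
    then show ?thesis using \<sigma>(2) by (auto elim!: nonneg_Reals_cases)
  qed
  then have "\<sigma> (q * (t *\<^sub>R 1 + q)) = of_real (t * (t + t))"
    using q by (simp add: character_mult[OF \<sigma>(1)] character_add[OF \<sigma>(1)] character_scaleR[OF \<sigma>(1)]
        character_one[OF \<sigma>(1)] add_mem scaleR_mem)
  then have "cmod (\<sigma> (q * (t *\<^sub>R 1 + q))) = \<bar>t * (t + t)\<bar>"
    by (simp only: norm_of_real)
  then have "t * (t + t) \<le> t * t"
    using le norm_character_le[OF \<sigma>(1), of "q * (t *\<^sub>R 1 + q)"] q by (simp add: mult_mem add_mem scaleR_mem)
  then have "t * t \<le> 0" by (simp add: distrib_left)
  then have "t = 0" by (metis mult_eq_0_iff order_antisym zero_le_square)
  then have "q = 0" by (simp add: t_def)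
  have "positive x"
  proof (rule positive_from_characters[OF xA])
    fix \<sigma> assume s: "\<sigma> \<in> characters ?A"
    have "complex_of_real ((max 0 (- Re (\<sigma> x))) ^ 3) = 0"
      using \<sigma>q[OF s] character_zero[OF s] \<open>q = 0\<close> by simp
    then have "max 0 (- Re (\<sigma> x)) = 0" by (simp only: of_real_eq_0_iff power_eq_0_iff)
    then have "0 \<le> Re (\<sigma> x)" by linarith
    then show "\<sigma> x \<in> \<real>\<^sub>\<ge>\<^sub>0" by (subst \<sigma>x[OF s]) (simp only: nonneg_Reals_of_real_iff)
  qed
  then show ?thesis by (simp add: x_def)
qed

lemma positive_conjugate:
  assumes "positive x" shows "positive (adj b * x * b)"
proof -
  obtain y where y: "adj y = y" "x = y * y" using assms by (auto simp: positive_def)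
  have "adj b * x * b = adj (y * b) * (y * b)" by (simp add: y adj_mult mult.assoc)
  then show ?thesis by (simp add: positive_adj_mult)
qed

lemma norm_le_from_order:
  assumes z: "adj z = z" and le: "positive (\<epsilon> *\<^sub>R 1 - z)" "positive (\<epsilon> *\<^sub>R 1 + z)"
  shows "norm z \<le> \<epsilon>"
proof -
  interpret unital_abelian_cstar_subalgebra "bicommutant z"
    by (rule bicommutant_unital_abelian[OF z])
  have zA: "z \<in> bicommutant z" by (rule mem_bicommutant)
  show ?thesis
  proof (rule norm_le_from_characters[OF zA])
    fix \<sigma> assume s: "\<sigma> \<in> characters (bicommutant z)"
    have "\<sigma> (\<epsilon> *\<^sub>R 1 - z) \<in> \<real>\<^sub>\<ge>\<^sub>0" "\<sigma> (\<epsilon> *\<^sub>R 1 + z) \<in> \<real>\<^sub>\<ge>\<^sub>0"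
      using zA by (auto intro!: character_positive[OF s] le)
    moreover have r: "\<sigma> z = of_real (Re (\<sigma> z))"
      using character_selfadjoint_real[OF s zA z] by (simp add: complex_eq_iff)
    moreover have "\<sigma> (\<epsilon> *\<^sub>R 1 - z) = of_real \<epsilon> - \<sigma> z" "\<sigma> (\<epsilon> *\<^sub>R 1 + z) = of_real \<epsilon> + \<sigma> z"
      using zA by (simp_all add: character_diff[OF s] character_add[OF s] character_scaleR[OF s]
          character_one[OF s] scaleR_mem)
    ultimately have "0 \<le> \<epsilon> - Re (\<sigma> z)" "0 \<le> \<epsilon> + Re (\<sigma> z)"
      by (auto simp: complex_nonneg_Reals_iff)
    moreover have "cmod (\<sigma> z) = \<bar>Re (\<sigma> z)\<bar>" by (subst r) (simp only: norm_of_real)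
    ultimately show "cmod (\<sigma> z) \<le> \<epsilon>" by simp
  qed
qed

section \<open>States\<close>

lemma functional_norm_bound:
  assumes f: "f \<in> bounded_functionals S" and S: "csubspace S" and x: "x \<in> S"
  shows "cmod (f x) \<le> functional_norm S f * norm x"
proof (cases "x = 0")
  case True
  then show ?thesis using linear_functionals_zero[of f S] f S by (simp add: bounded_functionals_def)
next
  case False
  have lin: "f \<in> linear_functionals S" using f by (simp add: bounded_functionals_def)
  obtain K where K: "\<And>y. y \<in> S \<Longrightarrow> cmod (f y) \<le> K * norm y" using f by (auto simp: bounded_functionals_def)
  have "bdd_above ((\<lambda>y. cmod (f y)) ` {y\<in>S. norm y \<le> 1})"
  proof (rule bdd_aboveI2)
    fix y assume "y \<in> {y\<in>S. norm y \<le> 1}"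
    then have "cmod (f y) \<le> K * norm y" "norm y \<le> 1" using K by auto
    then show "cmod (f y) \<le> \<bar>K\<bar>"
      by (smt (verit, ccfv_SIG) mult_left_le mult_right_mono norm_ge_zero)
  qed
  moreover have xS: "(1 / norm x) *\<^sub>R x \<in> S"
    unfolding scaleR_scaleC by (rule complex_vector.subspace_scale[OF S x])
  ultimately have "cmod (f ((1 / norm x) *\<^sub>R x)) \<le> functional_norm S f"
    unfolding functional_norm_def using False by (intro cSUP_upper) auto
  then show ?thesis
    using False linear_functionals_scaleR[OF lin x, of "1 / norm x"] by (simp add: norm_mult norm_divide field_simps)
qed

lemma functional_norm_le:
  assumes "0 \<in> S" "0 \<le> c" "\<And>x. x \<in> S \<Longrightarrow> cmod (f x) \<le> c * norm x"
  shows "functional_norm S f \<le> c"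
  unfolding functional_norm_def
proof (rule cSUP_least)
  show "{x \<in> S. norm x \<le> 1} \<noteq> {}" using assms(1) by (auto intro!: exI[of _ 0])
  fix x assume "x \<in> {x \<in> S. norm x \<le> 1}"
  then show "cmod (f x) \<le> c" using assms(3)[of x] assms(2) mult_left_le[of "norm x" c] by auto
qed

context unital_cstar_subalgebra
begin

text \<open>Both parts come from the nonnegativity of the functional at \<open>adj u * u\<close> for \<open>u = x + c y\<close>. Hermitian
  symmetry uses \<open>c = 1\<close> and \<open>c = i\<close>; the inequality uses \<open>c = - s b\<close> with \<open>s\<close> real and \<open>b = f (adj y * x)\<close>, which
  gives a real quadratic polynomial in \<open>s\<close>.\<close>

lemma positive_functional_Cauchy_Schwarz:
  assumes f: "f \<in> linear_functionals A" and pos: "\<And>x. x \<in> A \<Longrightarrow> f (adj x * x) \<in> \<real>\<^sub>\<ge>\<^sub>0"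
    and x: "x \<in> A" and y: "y \<in> A"
  shows "f (adj x * y) = cnj (f (adj y * x))"
    and "(cmod (f (adj y * x)))\<^sup>2 \<le> Re (f (adj y * y)) * Re (f (adj x * x))"
proof -
  have fadd: "f (u + v) = f u + f v" if "u \<in> A" "v \<in> A" for u v
    by (rule linear_functionals_add[OF f that])
  have fscale: "f (c *\<^sub>C u) = c * f u" if "u \<in> A" for c u
    by (rule linear_functionals_scaleC[OF f that])
  have exp: "f (adj (x + c *\<^sub>C y) * (x + c *\<^sub>C y)) =
      f (adj x * x) + c * f (adj x * y) + cnj c * f (adj y * x) + cnj c * c * f (adj y * y)" for c
  proof -
    have "adj (x + c *\<^sub>C y) * (x + c *\<^sub>C y) =
        adj x * x + c *\<^sub>C (adj x * y) + cnj c *\<^sub>C (adj y * x) + (cnj c * c) *\<^sub>C (adj y * y)"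
      by (simp add: adj_add adj_scaleC distrib_left distrib_right mult_scaleC_left mult_scaleC_right
          scaleC_add_right scaleC_scaleC add_ac mult.commute[of c "cnj c"])
    then show ?thesis using x y by (simp add: fadd fscale add_mem scaleC_mem mult_mem adj_mem)
  qed
  have real: "Im (f (adj u * u)) = 0" "0 \<le> Re (f (adj u * u))" if "u \<in> A" for u
    using pos[OF that] by (auto simp: complex_nonneg_Reals_iff)
  have "Im (f (adj (x + 1 *\<^sub>C y) * (x + 1 *\<^sub>C y))) = 0" "Im (f (adj (x + \<i> *\<^sub>C y) * (x + \<i> *\<^sub>C y))) = 0"
    using x y by (intro real add_mem scaleC_mem; simp)+
  then show herm: "f (adj x * y) = cnj (f (adj y * x))"
    unfolding exp using real[OF x] real[OF y] by (simp add: complex_eq_iff)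
  define b a c where "b = f (adj y * x)" and "a = Re (f (adj y * y))" and "c = Re (f (adj x * x))"
  have q: "0 \<le> c - 2 * s * (cmod b)\<^sup>2 + s\<^sup>2 * (cmod b)\<^sup>2 * a" for s :: real
  proof -
    let ?l = "- (of_real s * b)"
    have "0 \<le> Re (f (adj (x + ?l *\<^sub>C y) * (x + ?l *\<^sub>C y)))"
      using x y by (intro real add_mem scaleC_mem)
    also have "f (adj (x + ?l *\<^sub>C y) * (x + ?l *\<^sub>C y)) =
        of_real c + ?l * cnj b + cnj ?l * b + cnj ?l * ?l * of_real a"
      unfolding exp herm b_def a_def c_def using real[OF x] real[OF y] by (simp add: complex_eq_iff)
    also have "Re \<dots> = c - 2 * s * (cmod b)\<^sup>2 + s\<^sup>2 * (cmod b)\<^sup>2 * a"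
      unfolding cmod_power2 by (simp add: power2_eq_square algebra_simps)
    finally show ?thesis .
  qed
  have ac: "0 \<le> a" "0 \<le> c" using real x y by (simp_all add: a_def c_def)
  have "(cmod b)\<^sup>2 \<le> a * c"
  proof (cases "a = 0")
    case True
    have "b = 0"
    proof (rule ccontr)
      assume "b \<noteq> 0"
      then have "(c + 1) / (2 * (cmod b)\<^sup>2) * (2 * (cmod b)\<^sup>2) = c + 1" by simp
      then show False using q[of "(c + 1) / (2 * (cmod b)\<^sup>2)"] True by (simp add: algebra_simps)
    qed
    then show ?thesis using True by simp
  next
    case False
    then have "0 < a" using ac by simp
    then have "0 \<le> c - (cmod b)\<^sup>2 / a" using q[of "1 / a"] by (simp add: power2_eq_square)
    then show ?thesis using \<open>0 < a\<close> by (simp add: field_simps)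
  qed
  then show "(cmod (f (adj y * x)))\<^sup>2 \<le> Re (f (adj y * y)) * Re (f (adj x * x))"
    by (simp add: a_def b_def c_def)
qed

context
  fixes f assumes f: "f \<in> states A"
begin

lemma state_linear: "f \<in> linear_functionals A"
  using f by (simp add: states_def bounded_functionals_def)

lemma state_nonneg: "x \<in> A \<Longrightarrow> f (adj x * x) \<in> \<real>\<^sub>\<ge>\<^sub>0"
  using f by (simp add: states_def)

lemma norm_state_le: "x \<in> A \<Longrightarrow> cmod (f x) \<le> norm x"
  using functional_norm_bound[of f A x] f csubspace_A by (simp add: states_def)

lemma state_Cauchy_Schwarz:
  assumes "x \<in> A" "y \<in> A"
  shows "(cmod (f (adj y * x)))\<^sup>2 \<le> Re (f (adj y * y)) * Re (f (adj x * x))"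
  using positive_functional_Cauchy_Schwarz(2)[OF state_linear state_nonneg assms] .

lemma state_adj:
  assumes "x \<in> A" shows "f (adj x) = cnj (f x)"
  using positive_functional_Cauchy_Schwarz(1)[OF state_linear state_nonneg assms one_mem] by simp

text \<open>By Cauchy-Schwarz the norm of a positive functional is at most the square root of its value at the
  unit, so norm one forces that value to be at least one.\<close>

lemma state_one: "f 1 = 1"
proof -
  have r: "f 1 \<in> \<real>\<^sub>\<ge>\<^sub>0" using state_nonneg[OF one_mem] by simp
  have "cmod (f x) \<le> sqrt (Re (f 1)) * norm x" if x: "x \<in> A" for x
  proof -
    have "(cmod (f x))\<^sup>2 \<le> Re (f 1) * Re (f (adj x * x))"
      using state_Cauchy_Schwarz[OF x one_mem] by simp
    also have "\<dots> \<le> Re (f 1) * (norm x)\<^sup>2"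
    proof (rule mult_left_mono)
      have "Re (f (adj x * x)) \<le> cmod (f (adj x * x))" by (rule complex_Re_le_cmod)
      also have "\<dots> \<le> norm (adj x * x)" using x by (intro norm_state_le) auto
      finally show "Re (f (adj x * x)) \<le> (norm x)\<^sup>2" by (simp add: norm_adj_mult)
    qed (use r in \<open>simp add: complex_nonneg_Reals_iff\<close>)
    finally have "sqrt ((cmod (f x))\<^sup>2) \<le> sqrt (Re (f 1) * (norm x)\<^sup>2)" by (rule real_sqrt_le_mono)
    then show ?thesis by (simp add: real_sqrt_mult)
  qed
  then have "functional_norm A f \<le> sqrt (Re (f 1))"
    using r by (intro functional_norm_le zero_mem) (auto simp: complex_nonneg_Reals_iff)
  then have "1 \<le> Re (f 1)" using f by (simp add: states_def)
  moreover have "cmod (f 1) \<le> 1" using norm_state_le[OF one_mem] by simp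
  ultimately show ?thesis
    using r complex_Re_le_cmod[of "f 1"] by (auto simp: complex_nonneg_Reals_iff complex_eq_iff)
qed

lemma state_zero_left:
  assumes "x \<in> A" "y \<in> A" "f (adj y * y) = 0" shows "f (adj y * x) = 0"
  using state_Cauchy_Schwarz[OF assms(1,2)] assms(3) by simp

end

text \<open>A positive functional that is normalized at the unit is bounded with norm one; the bound uses
  that \<open>norm x ^ 2 - adj x * x\<close> is a square within the subalgebra.\<close>

lemma stateI:
  assumes f: "f \<in> linear_functionals A" and pos: "\<And>x. x \<in> A \<Longrightarrow> f (adj x * x) \<in> \<real>\<^sub>\<ge>\<^sub>0"
    and one: "f 1 = 1"
  shows "f \<in> states A"
proof -
  have bound: "cmod (f x) \<le> norm x" if x: "x \<in> A" for x
  proof -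
    have "positive ((norm x)\<^sup>2 *\<^sub>R 1 - adj x * x)"
      by (rule positive_scalar_minus) (simp_all add: adj_mult adj_adj norm_adj_mult)
    then obtain b where b: "b \<in> A" "positive b" "b * b = (norm x)\<^sup>2 *\<^sub>R 1 - adj x * x"
      using positive_sqrt[of "(norm x)\<^sup>2 *\<^sub>R 1 - adj x * x"] x by blast
    have "f (adj b * b) \<in> \<real>\<^sub>\<ge>\<^sub>0" by (rule pos[OF b(1)])
    also have "adj b * b = (norm x)\<^sup>2 *\<^sub>R 1 - adj x * x" using b by (simp add: positive_selfadjoint)
    also have "f \<dots> = of_real ((norm x)\<^sup>2) - f (adj x * x)"
      using x one by (subst linear_functionals_diff[OF f _ _ csubspace_A]) (auto simp: linear_functionals_scaleR[OF f])
    finally have "Re (f (adj x * x)) \<le> (norm x)\<^sup>2" by (simp add: complex_nonneg_Reals_iff)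
    moreover have "(cmod (f x))\<^sup>2 \<le> Re (f (adj x * x))"
      using positive_functional_Cauchy_Schwarz(2)[OF f pos x one_mem] one by simp
    ultimately have "(cmod (f x))\<^sup>2 \<le> (norm x)\<^sup>2" by linarith
    then show ?thesis by (rule power2_le_imp_le) simp
  qed
  then have bf: "f \<in> bounded_functionals A"
    unfolding bounded_functionals_def using f by (auto intro!: exI[of _ 1])
  have "functional_norm A f \<le> 1"
    using bound by (intro functional_norm_le) auto
  moreover have "1 \<le> functional_norm A f"
    using functional_norm_bound[OF bf csubspace_A one_mem] one by simp
  ultimately show ?thesis using bf pos by (simp add: states_def)
qed

end

text \<open>If \<open>\<rho> = t g + (1 - t) h\<close> and \<open>k = d - \<rho> d\<close>, then \<open>\<rho> (adj k * k) = 0\<close> forces \<open>g (adj k * k) = h (adj k * k) = 0\<close>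
  by positivity, and Cauchy-Schwarz yields \<open>g k = h k = 0\<close>. Hence the extension property applies to
  characters.\<close>

lemma (in unital_abelian_cstar_subalgebra) character_pure_state:
  assumes \<rho>: "\<rho> \<in> characters A" shows "\<rho> \<in> pure_states A"
proof -
  have "\<rho> \<in> states A"
  proof (rule stateI[OF character_linear[OF \<rho>] _ character_one[OF \<rho>]])
    show "\<rho> (adj x * x) \<in> \<real>\<^sub>\<ge>\<^sub>0" if "x \<in> A" for x
      using that by (intro character_positive[OF \<rho>] positive_adj_mult) auto
  qed
  moreover have "g = \<rho> \<and> h = \<rho>"
    if g: "g \<in> states A" and h: "h \<in> states A" and t: "0 < t" "t < 1"
      and eq: "\<And>x. x \<in> A \<Longrightarrow> \<rho> x = of_real t * g x + of_real (1 - t) * h x" for g h and t :: real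
  proof -
    have gh: "g d = \<rho> d \<and> h d = \<rho> d" if d: "d \<in> A" for d
    proof -
      define k where "k = d - \<rho> d *\<^sub>C 1"
      have k: "k \<in> A" using d by (auto simp: k_def)
      have "\<rho> k = 0"
        using d by (simp add: k_def character_diff[OF \<rho>] character_scaleC[OF \<rho>] character_one[OF \<rho>] scaleC_mem)
      then have "\<rho> (adj k * k) = 0" by (simp add: character_adj_mult[OF \<rho> k])
      then have 0: "of_real t * g (adj k * k) + of_real (1 - t) * h (adj k * k) = 0"
        using eq[of "adj k * k"] k by (simp add: mult_mem adj_mem)
      have "t * Re (g (adj k * k)) + (1 - t) * Re (h (adj k * k)) = 0"
        using arg_cong[OF 0, of Re] by simp
      moreover have ge: "g (adj k * k) \<in> \<real>\<^sub>\<ge>\<^sub>0" "h (adj k * k) \<in> \<real>\<^sub>\<ge>\<^sub>0"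
        using state_nonneg[OF g k] state_nonneg[OF h k] .
      ultimately have "t * Re (g (adj k * k)) = 0" "(1 - t) * Re (h (adj k * k)) = 0"
        using t by (auto simp: complex_nonneg_Reals_iff add_nonneg_eq_0_iff)
      then have "g (adj k * k) = 0" "h (adj k * k) = 0"
        using t ge by (auto simp: complex_nonneg_Reals_iff complex_eq_iff)
      then have "g (adj k) = 0" "h (adj k) = 0"
        using state_zero_left[OF g one_mem k] state_zero_left[OF h one_mem k] by simp_all
      then have "g k = 0" "h k = 0"
        using state_adj[OF g k] state_adj[OF h k] by simp_all
      moreover have "g k = g d - \<rho> d" "h k = h d - \<rho> d"
        using d by (simp_all add: k_def linear_functionals_diff[OF state_linear[OF g] _ _ csubspace_A]
            linear_functionals_diff[OF state_linear[OF h] _ _ csubspace_A] scaleC_mem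
            linear_functionals_scaleC[OF state_linear[OF g]] linear_functionals_scaleC[OF state_linear[OF h]]
            state_one[OF g] state_one[OF h])
      ultimately show ?thesis by simp
    qed
    have "g \<in> extensional A" "h \<in> extensional A" "\<rho> \<in> extensional A"
      using state_linear[OF g] state_linear[OF h] character_linear[OF \<rho>] by (auto simp: linear_functionals_def)
    then show ?thesis
      using extensionalityI[of g A \<rho>] extensionalityI[of h A \<rho>] gh by simp
  qed
  ultimately show ?thesis unfolding pure_states_def by blast
qed

section \<open>Unique extensions of characters\<close>

interpretation whole: unital_cstar_subalgebra "UNIV :: 'a::cstar_algebra set"
  by standard (auto simp: cstar_subalgebra_def complex_vector.subspace_UNIV)

lemma state_positive:
  fixes f :: "'a::cstar_algebra \<Rightarrow> complex"
  assumes "f \<in> states UNIV" "positive x" shows "f x \<in> \<real>\<^sub>\<ge>\<^sub>0"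
proof -
  obtain b where "adj b = b" "x = b * b" using assms(2) by (auto simp: positive_def)
  then show ?thesis using whole.state_nonneg[OF assms(1), of b] by simp
qed

text \<open>The setting in which every character of \<open>D\<close> has a unique extension to a state of the whole algebra,
  from which the conditional expectation is constructed.\<close>

locale extension_property_inclusion = unital_abelian_cstar_subalgebra D for D :: "'a::cstar_algebra set" +
  assumes ext: "extension_property D"
begin

definition state_extension :: "('a \<Rightarrow> complex) \<Rightarrow> 'a \<Rightarrow> complex" where
  "state_extension \<rho> = (THE f. f \<in> states UNIV \<and> restrict f D = \<rho>)"

context
  fixes \<rho> assumes \<rho>: "\<rho> \<in> characters D"
begin

lemma ex1_state_extension: "\<exists>!f. f \<in> states UNIV \<and> restrict f D = \<rho>"
  using ext character_pure_state[OF \<rho>] by (simp add: extension_property_def)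

lemma state_extension_state: "state_extension \<rho> \<in> states UNIV"
  and restrict_state_extension: "restrict (state_extension \<rho>) D = \<rho>"
  using theI'[OF ex1_state_extension] by (simp_all add: state_extension_def)

lemma state_extension_eq: "d \<in> D \<Longrightarrow> state_extension \<rho> d = \<rho> d"
  using restrict_state_extension by (metis restrict_apply')

lemma state_extension_unique:
  assumes "f \<in> states UNIV" "\<And>d. d \<in> D \<Longrightarrow> f d = \<rho> d" shows "f = state_extension \<rho>"
proof -
  have "\<rho> \<in> extensional D" using character_linear[OF \<rho>] by (simp add: linear_functionals_def)
  then have "restrict f D = \<rho>" using assms(2) by (auto simp: fun_eq_iff extensional_def)
  then show ?thesis
    using ex1_state_extension assms(1) state_extension_state restrict_state_extension by blast
qed

lemmas state_extension_linear = whole.state_linear[OF state_extension_state]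

lemma state_extension_add: "state_extension \<rho> (x + y) = state_extension \<rho> x + state_extension \<rho> y"
  and state_extension_scaleC: "state_extension \<rho> (c *\<^sub>C x) = c * state_extension \<rho> x"
  and state_extension_scaleR: "state_extension \<rho> (r *\<^sub>R x) = of_real r * state_extension \<rho> x"
  and state_extension_diff: "state_extension \<rho> (x - y) = state_extension \<rho> x - state_extension \<rho> y"
  using linear_functionals_add[OF state_extension_linear] linear_functionals_scaleC[OF state_extension_linear]
    linear_functionals_scaleR[OF state_extension_linear]
    linear_functionals_diff[OF state_extension_linear _ _ whole.csubspace_A]
  by auto

lemma state_extension_sum: "state_extension \<rho> (sum g S) = (\<Sum>i\<in>S. state_extension \<rho> (g i))"
  by (rule linear_functionals_sum[OF state_extension_linear whole.csubspace_A]) simp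

lemma norm_state_extension_le: "cmod (state_extension \<rho> x) \<le> norm x"
  by (rule whole.norm_state_le[OF state_extension_state UNIV_I])

lemma state_extension_adj: "state_extension \<rho> (adj x) = cnj (state_extension \<rho> x)"
  by (rule whole.state_adj[OF state_extension_state UNIV_I])

text \<open>\<open>D\<close> is in the multiplicative domain of the extension, since \<open>k = d - \<rho> d\<close> satisfies \<open>\<rho> (adj k * k) = 0\<close>.\<close>

lemma state_extension_mult_right:
  assumes d: "d \<in> D" shows "state_extension \<rho> (x * d) = state_extension \<rho> x * \<rho> d"
proof -
  define k where "k = d - \<rho> d *\<^sub>C 1"
  have k: "k \<in> D" using d by (auto simp: k_def)
  have "\<rho> k = 0"
    using d by (simp add: k_def character_diff[OF \<rho>] character_scaleC[OF \<rho>] character_one[OF \<rho>] scaleC_mem)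
  then have "state_extension \<rho> (adj k * k) = 0"
    using k by (simp add: state_extension_eq mult_mem adj_mem character_mult[OF \<rho>])
  then have "state_extension \<rho> (adj k * adj x) = 0"
    by (rule whole.state_zero_left[OF state_extension_state UNIV_I UNIV_I])
  then have "state_extension \<rho> (x * k) = 0"
    using state_extension_adj[of "x * k"] by (simp add: adj_mult)
  then show ?thesis
    by (simp add: k_def right_diff_distrib mult_scaleC_right state_extension_diff state_extension_scaleC)
qed

lemma state_extension_mult_left:
  assumes d: "d \<in> D" shows "state_extension \<rho> (d * x) = \<rho> d * state_extension \<rho> x"
  using state_extension_mult_right[OF adj_mem[OF d], of "adj x"] state_extension_adj[of "d * x"]
  by (simp add: adj_mult state_extension_adj character_adj[OF \<rho> d]) (metis complex_cnj_cnj complex_cnj_mult mult.commute)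

text \<open>This is where uniqueness of the extension is used. If no such \<open>d\<close> exists, then the positive elements,
  the elements of \<open>D\<close> on which \<open>\<rho>\<close> is nonnegative, and \<open>x - u\<close> with \<open>u\<close> slightly above \<open>f x\<close> generate a proper
  cone. The functional of a maximal cone containing it is a state that extends \<open>\<rho>\<close> and is at least \<open>u\<close> at
  \<open>x\<close>, a second extension.\<close>

lemma dominating_element:
  assumes x: "adj x = x" and \<epsilon>: "0 < \<epsilon>"
  obtains d where "d \<in> D" "adj d = d" "positive (d - x)" "Re (\<rho> d) < Re (state_extension \<rho> x) + \<epsilon>"
proof -
  let ?f = "state_extension \<rho>"
  have "\<exists>d\<in>D. adj d = d \<and> positive (d - x) \<and> Re (\<rho> d) < Re (?f x) + \<epsilon>"
  proof (rule ccontr)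
    assume no: "\<not> ?thesis"
    define u where "u = Re (?f x) + \<epsilon> / 2"
    define V where "V = {a::'a. adj a = a}"
    define Q where "Q = {p + d + l *\<^sub>R (x - u *\<^sub>R 1) | p d l.
      positive p \<and> d \<in> D \<and> adj d = d \<and> 0 \<le> Re (\<rho> d) \<and> 0 \<le> (l::real)}"
    have QI: "p + d + l *\<^sub>R (x - u *\<^sub>R 1) \<in> Q"
      if "positive p" "d \<in> D" "adj d = d" "0 \<le> Re (\<rho> d)" "0 \<le> l" for p d and l :: real
      using that by (auto simp: Q_def)
    have pQ: "p \<in> Q" if "positive p" for p
      using QI[OF that zero_mem, of 0] by (simp add: character_zero[OF \<rho>])
    have dQ: "d \<in> Q" if "d \<in> D" "adj d = d" "0 \<le> Re (\<rho> d)" for d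
      using QI[OF positive_zero that, of 0] by simp
    have xQ: "x - u *\<^sub>R 1 \<in> Q"
      using QI[OF positive_zero zero_mem, of 1] by (simp add: character_zero[OF \<rho>])
    have V: "subspace V" "1 \<in> V" by (auto simp: V_def subspace_def adj_add)
    have cone: "order_cone V Q"
      unfolding order_cone_def
    proof (intro conjI ballI allI impI)
      show "Q \<subseteq> V" using x by (auto simp: Q_def V_def adj_add positive_selfadjoint)
      show "- 1 \<notin> Q"
      proof
        assume "- 1 \<in> Q"
        then obtain p d l where e: "- 1 = p + d + l *\<^sub>R (x - u *\<^sub>R 1)" and p: "positive p"
          and d: "d \<in> D" "adj d = d" "0 \<le> Re (\<rho> d)" and l: "0 \<le> l" by (auto simp: Q_def)
        have p_eq: "p = - 1 - d - l *\<^sub>R (x - u *\<^sub>R 1)" unfolding e by simp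
        show False
        proof (cases "l = 0")
          case True
          then have "p \<in> D" "\<rho> p = - 1 - \<rho> d"
            using d by (auto simp: p_eq character_diff[OF \<rho>] character_minus[OF \<rho>] character_one[OF \<rho>] minus_mem)
          moreover have "?f p \<in> \<real>\<^sub>\<ge>\<^sub>0" by (rule state_positive[OF state_extension_state p])
          ultimately show False using d(3) by (simp add: state_extension_eq complex_nonneg_Reals_iff)
        next
          case False
          then have l: "0 < l" using l by simp
          \<comment> \<open>Solving the relation for \<open>x\<close> exhibits an element of \<open>D\<close> above \<open>x\<close> whose value at \<open>\<rho>\<close> is below \<open>u\<close>.\<close>
          define d' where "d' = u *\<^sub>R 1 - (1 / l) *\<^sub>R (1 + d)"
          have d': "d' \<in> D" "adj d' = d'" using d by (auto simp: d'_def adj_add)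
          have "d' - x = (1 / l) *\<^sub>R p"
            using l by (simp add: d'_def p_eq scaleR_diff_right scaleR_add_right algebra_simps)
          then have "positive (d' - x)" using p l by (simp add: positive_scaleR)
          then have "Re (?f x) + \<epsilon> \<le> Re (\<rho> d')" using no d' by force
          moreover have "Re (\<rho> d') = u - (1 / l) * (1 + Re (\<rho> d))"
            using d by (simp add: d'_def character_diff[OF \<rho>] character_scaleR[OF \<rho>] character_add[OF \<rho>]
                character_one[OF \<rho>] scaleR_mem add_mem)
          moreover have "0 \<le> (1 / l) * (1 + Re (\<rho> d))" using l d by simp
          ultimately show False using \<epsilon> by (simp add: u_def)
        qed
      qed
      fix a assume "a \<in> Q"
      then obtain p d l where a: "a = p + d + l *\<^sub>R (x - u *\<^sub>R 1)" "positive p"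
          "d \<in> D" "adj d = d" "0 \<le> Re (\<rho> d)" "0 \<le> l" by (auto simp: Q_def)
      show "r *\<^sub>R a \<in> Q" if "0 \<le> r" for r
        using QI[of "r *\<^sub>R p" "r *\<^sub>R d" "r * l"] a that
        by (auto simp: positive_scaleR character_scaleR[OF \<rho>] scaleR_add_right)
      fix b assume "b \<in> Q"
      then obtain p' d' l' where b: "b = p' + d' + l' *\<^sub>R (x - u *\<^sub>R 1)" "positive p'"
          "d' \<in> D" "adj d' = d'" "0 \<le> Re (\<rho> d')" "0 \<le> l'" by (auto simp: Q_def)
      have "(p + p') + (d + d') + (l + l') *\<^sub>R (x - u *\<^sub>R 1) \<in> Q"
        using a b by (intro QI positive_add add_mem) (auto simp: adj_add character_add[OF \<rho>])
      then show "a + b \<in> Q" unfolding a(1) b(1) by (simp add: scaleR_add_left add_ac)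
    qed
    have arch: "\<exists>r. r *\<^sub>R 1 - a \<in> Q" if "a \<in> V" for a
      using that pQ[OF positive_scalar_minus[OF _ order.refl]] by (auto simp: V_def)
    obtain g :: "'a \<Rightarrow> real" where
      gadd: "\<And>a b. a \<in> V \<Longrightarrow> b \<in> V \<Longrightarrow> g (a + b) = g a + g b"
      and gscale: "\<And>r a. a \<in> V \<Longrightarrow> g (r *\<^sub>R a) = r * g a" and g1: "g 1 = 1"
      and gQ: "\<And>a. a \<in> Q \<Longrightarrow> 0 \<le> g a"
      using order_cone_extend_functional[OF V cone pQ[OF positive_one] arch] by metis
    obtain F where F: "F \<in> linear_functionals UNIV"
      and Fg: "\<And>a. adj a = a \<Longrightarrow> F a = of_real (g a)"
      using whole.complexify[of g] gadd gscale by (auto simp: V_def)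
    have gdiff: "g (a - r *\<^sub>R 1) = g a - r" if "adj a = a" for a r
      using gadd[of a "(- r) *\<^sub>R 1"] gscale[of 1 "- r"] that by (simp add: V_def g1)
    have "F \<in> states UNIV"
    proof (rule whole.stateI[OF F])
      show "F 1 = 1" by (simp add: Fg g1)
      show "F (adj y * y) \<in> \<real>\<^sub>\<ge>\<^sub>0" for y
        using gQ[OF pQ[OF positive_adj_mult[of y]]] by (simp add: Fg adj_mult adj_adj)
    qed
    moreover have "F d = \<rho> d" if d: "d \<in> D" for d
    proof -
      have sa: "F a = \<rho> a" if a: "a \<in> D" "adj a = a" for a
      proof -
        let ?r = "Re (\<rho> a)"
        have "a - ?r *\<^sub>R 1 \<in> Q" "?r *\<^sub>R 1 - a \<in> Q"
          using a by (auto intro!: dQ simp: character_diff[OF \<rho>] character_scaleR[OF \<rho>] character_one[OF \<rho>] scaleR_mem)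
        then have "0 \<le> g (a - ?r *\<^sub>R 1)" "0 \<le> g (?r *\<^sub>R 1 - a)" using gQ by auto
        moreover have "g (?r *\<^sub>R 1 - a) = - g (a - ?r *\<^sub>R 1)"
          using gscale[of "a - ?r *\<^sub>R 1" "- 1"] a by (simp add: V_def)
        ultimately have "g a = ?r" using gdiff[OF a(2)] by simp
        then show ?thesis using Fg[OF a(2)] character_selfadjoint_real[OF \<rho> a] by (simp add: complex_eq_iff)
      qed
      have "F d = F (re_part d) + \<i> * F (im_part d)"
        using linear_functionals_add[OF F] linear_functionals_scaleC[OF F] re_part_plus_im_part by (metis UNIV_I)
      also have "\<dots> = \<rho> (re_part d) + \<i> * \<rho> (im_part d)"
        using d by (simp add: sa re_part_mem im_part_mem)
      also have "\<dots> = \<rho> (re_part d + \<i> *\<^sub>C im_part d)"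
        using d by (simp add: character_add[OF \<rho>] character_scaleC[OF \<rho>] re_part_mem im_part_mem scaleC_mem)
      finally show ?thesis by (simp add: re_part_plus_im_part)
    qed
    ultimately have "F = ?f" by (rule state_extension_unique)
    moreover have "0 \<le> g (x - u *\<^sub>R 1)" by (rule gQ[OF xQ])
    ultimately show False using Fg[OF x] gdiff[OF x] \<epsilon> by (auto simp: u_def)
  qed
  then show thesis using that by blast
qed

end

text \<open>The elements of \<open>D\<close> whose support is so small that \<open>x\<close> looks like a scalar there. The condition is an
  order relation rather than a norm estimate so that it can be added up over a partition of unity
  without accumulating error.\<close>

definition localizers :: "'a \<Rightarrow> real \<Rightarrow> 'a set" where
  "localizers x \<epsilon> = {k \<in> D. adj k = k \<and>
     (\<exists>\<mu>::real. positive ((\<mu> + \<epsilon>) *\<^sub>R (k * k) - k * x * k) \<and> positive (k * x * k - (\<mu> - \<epsilon>) *\<^sub>R (k * k)))}"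

lemma localizers_mult:
  assumes h: "h \<in> D" "adj h = h" and k: "k \<in> localizers x \<epsilon>"
  shows "h * k \<in> localizers x \<epsilon>"
proof -
  obtain \<mu> where kD: "k \<in> D" "adj k = k"
    and pos: "positive ((\<mu> + \<epsilon>) *\<^sub>R (k * k) - k * x * k)" "positive (k * x * k - (\<mu> - \<epsilon>) *\<^sub>R (k * k))"
    using k by (auto simp: localizers_def)
  have hk: "h * k = k * h" using h kD by (intro comm)
  have "(h * k) * (h * k) = h * (k * k) * h" by (metis hk mult.assoc)
  moreover have "(h * k) * x * (h * k) = h * (k * x * k) * h" by (metis hk mult.assoc)
  moreover have "positive (adj h * ((\<mu> + \<epsilon>) *\<^sub>R (k * k) - k * x * k) * h)"
    "positive (adj h * (k * x * k - (\<mu> - \<epsilon>) *\<^sub>R (k * k)) * h)"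
    by (rule positive_conjugate[OF pos(1)], rule positive_conjugate[OF pos(2)])
  ultimately have "positive ((\<mu> + \<epsilon>) *\<^sub>R ((h * k) * (h * k)) - (h * k) * x * (h * k))"
    "positive ((h * k) * x * (h * k) - (\<mu> - \<epsilon>) *\<^sub>R ((h * k) * (h * k)))"
    by (simp_all add: h left_diff_distrib right_diff_distrib)
  then show ?thesis using h kD hk by (auto simp: localizers_def adj_mult)
qed

text \<open>Take \<open>d \<ge> x\<close> and \<open>e \<ge> - x\<close> in \<open>D\<close> whose values at \<open>\<rho>\<close> almost equal those of \<open>x\<close> and \<open>- x\<close>. Then \<open>d < \<mu> + \<epsilon>\<close>
  and \<open>- e > \<mu> - \<epsilon>\<close> near \<open>\<rho>\<close>, and \<open>k\<close> is chosen to vanish outside the set where both inequalities hold.\<close>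

lemma localizers_nonvanishing:
  assumes x: "adj x = x" and \<epsilon>: "0 < \<epsilon>" and \<rho>: "\<rho> \<in> characters D"
  obtains k where "k \<in> localizers x \<epsilon>" "\<rho> k \<noteq> 0"
proof -
  define \<mu> where "\<mu> = Re (state_extension \<rho> x)"
  obtain d where d: "d \<in> D" "adj d = d" "positive (d - x)" "Re (\<rho> d) < \<mu> + \<epsilon>"
    using dominating_element[OF \<rho> x \<epsilon>] unfolding \<mu>_def by blast
  have "adj (- x) = - x" using x by simp
  from dominating_element[OF \<rho> this \<epsilon>]
  obtain e where e: "e \<in> D" "adj e = e" "positive (e - - x)" "Re (\<rho> e) < Re (state_extension \<rho> (- x)) + \<epsilon>" .
  have "state_extension \<rho> (- x) = - state_extension \<rho> x"
    using state_extension_scaleR[OF \<rho>, of "- 1" x] by simp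
  then have e4: "Re (\<rho> e) < \<epsilon> - \<mu>" using e(4) by (simp add: \<mu>_def)
  define b c where "b = (\<mu> + \<epsilon>) *\<^sub>R 1 - d" and "c = (\<epsilon> - \<mu>) *\<^sub>R 1 - e"
  have b: "b \<in> D" "adj b = b" and c: "c \<in> D" "adj c = c" using d e by (auto simp: b_def c_def)
  have \<rho>bc: "0 < Re (\<rho> b)" "0 < Re (\<rho> c)"
    using d e e4 by (simp_all add: b_def c_def character_diff[OF \<rho>] character_scaleR[OF \<rho>] character_one[OF \<rho>] scaleR_mem)
  obtain k1 where k1: "k1 \<in> D" "adj k1 = k1" "\<And>\<sigma>. \<sigma> \<in> characters D \<Longrightarrow> \<sigma> k1 = of_real (max 0 (Re (\<sigma> b)))"
    using positive_part[OF b] by blast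
  obtain k2 where k2: "k2 \<in> D" "adj k2 = k2" "\<And>\<sigma>. \<sigma> \<in> characters D \<Longrightarrow> \<sigma> k2 = of_real (max 0 (Re (\<sigma> c)))"
    using positive_part[OF c] by blast
  define k where "k = k1 * k2"
  have k: "k \<in> D" "adj k = k" using k1 k2 comm by (auto simp: k_def adj_mult)
  have \<sigma>k: "\<sigma> k = of_real (max 0 (Re (\<sigma> b)) * max 0 (Re (\<sigma> c)))" if "\<sigma> \<in> characters D" for \<sigma>
    using k1 k2 that by (simp add: k_def character_mult)
  have pos: "positive (k * y * k)" if y: "y \<in> D" "adj y = y"
    and sgn: "\<And>\<sigma>. \<sigma> \<in> characters D \<Longrightarrow> \<sigma> k \<noteq> 0 \<Longrightarrow> 0 \<le> Re (\<sigma> y)" for y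
  proof (rule positive_from_characters)
    show "k * y * k \<in> D" using k y by auto
    fix \<sigma> assume s: "\<sigma> \<in> characters D"
    define r where "r = max 0 (Re (\<sigma> b)) * max 0 (Re (\<sigma> c))"
    have yr: "\<sigma> y = of_real (Re (\<sigma> y))"
      using character_selfadjoint_real[OF s y] by (simp add: complex_eq_iff)
    have "\<sigma> (k * y * k) = of_real r * \<sigma> y * of_real r"
      unfolding character_mult[OF s mult_mem[OF k(1) y(1)] k(1)] character_mult[OF s k(1) y(1)] \<sigma>k[OF s] r_def ..
    also have "\<dots> = of_real (r * Re (\<sigma> y) * r)" by (subst yr) (simp only: of_real_mult)
    finally have "\<sigma> (k * y * k) = of_real (r * Re (\<sigma> y) * r)" .
    moreover have "0 \<le> r * Re (\<sigma> y) * r"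
    proof (cases "r = 0")
      case False
      then have "\<sigma> k \<noteq> 0" unfolding \<sigma>k[OF s] r_def[symmetric] by simp
      then have "0 \<le> Re (\<sigma> y)" by (rule sgn[OF s])
      then have "0 \<le> Re (\<sigma> y) * (r * r)" by simp
      then show ?thesis by (simp only: mult_ac)
    qed simp
    ultimately show "\<sigma> (k * y * k) \<in> \<real>\<^sub>\<ge>\<^sub>0" by (simp only: nonneg_Reals_of_real_iff)
  qed
  have bpos: "0 \<le> Re (\<sigma> b)" and cpos: "0 \<le> Re (\<sigma> c)" if "\<sigma> \<in> characters D" "\<sigma> k \<noteq> 0" for \<sigma>
    using that(2) unfolding \<sigma>k[OF that(1)] by (auto simp: max_def split: if_splits)
  have "positive (k * b * k + adj k * (d - x) * k)" "positive (k * c * k + adj k * (e - - x) * k)"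
    by (intro positive_add pos positive_conjugate b c d e bpos cpos; assumption)+
  moreover have "k * b * k + adj k * (d - x) * k = (\<mu> + \<epsilon>) *\<^sub>R (k * k) - k * x * k"
    "k * c * k + adj k * (e - - x) * k = k * x * k - (\<mu> - \<epsilon>) *\<^sub>R (k * k)"
    unfolding k(2) by (simp_all add: b_def c_def left_diff_distrib right_diff_distrib distrib_left distrib_right scaleR_diff_left)
  ultimately have "k \<in> localizers x \<epsilon>" using k by (auto simp: localizers_def)
  moreover have "\<rho> k \<noteq> 0" unfolding \<sigma>k[OF \<rho>] using \<rho>bc by simp
  ultimately show thesis by (rule that)
qed

section \<open>Averages over partitions of unity, and the conditional expectation\<close>

text \<open>Summing the order relations of the localizers bounds the difference between \<open>- \<epsilon>\<close> and \<open>\<epsilon>\<close>.\<close>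

lemma localized_average_near:
  fixes t :: "'b set"
  assumes h: "\<forall>k\<in>t. h k \<in> localizers x \<epsilon>" and one: "(\<Sum>k\<in>t. h k * h k) = 1" and x: "adj x = x"
  obtains y where "y \<in> D" "norm ((\<Sum>k\<in>t. h k * x * h k) - y) \<le> \<epsilon>"
proof -
  have "\<forall>k\<in>t. \<exists>\<mu>::real. positive ((\<mu> + \<epsilon>) *\<^sub>R (h k * h k) - h k * x * h k) \<and>
      positive (h k * x * h k - (\<mu> - \<epsilon>) *\<^sub>R (h k * h k))"
    using h by (auto simp: localizers_def)
  then obtain \<mu> :: "'b \<Rightarrow> real" where
    \<mu>: "\<And>k. k \<in> t \<Longrightarrow> positive ((\<mu> k + \<epsilon>) *\<^sub>R (h k * h k) - h k * x * h k)"
      "\<And>k. k \<in> t \<Longrightarrow> positive (h k * x * h k - (\<mu> k - \<epsilon>) *\<^sub>R (h k * h k))"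
    by metis
  have hD: "h k \<in> D" "adj (h k) = h k" if "k \<in> t" for k using h that by (auto simp: localizers_def)
  define y where "y = (\<Sum>k\<in>t. \<mu> k *\<^sub>R (h k * h k))"
  define z where "z = (\<Sum>k\<in>t. h k * x * h k) - y"
  have "y \<in> D" unfolding y_def using hD by (auto intro!: sum_mem)
  moreover have "norm z \<le> \<epsilon>"
  proof (rule norm_le_from_order)
    have "adj (\<Sum>k\<in>t. h k * x * h k) = (\<Sum>k\<in>t. h k * x * h k)" "adj y = y"
      unfolding y_def adj_sum using hD x by (auto intro!: sum.cong simp: adj_mult mult.assoc)
    then show "adj z = z" by (simp add: z_def)
    have e: "\<epsilon> *\<^sub>R 1 = (\<Sum>k\<in>t. \<epsilon> *\<^sub>R (h k * h k))" unfolding one[symmetric] by (rule scaleR_sum_right)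
    have "\<epsilon> *\<^sub>R 1 - z = (\<Sum>k\<in>t. (\<mu> k + \<epsilon>) *\<^sub>R (h k * h k) - h k * x * h k)"
      unfolding e z_def y_def by (simp add: sum_subtractf sum.distrib scaleR_add_left)
    then show "positive (\<epsilon> *\<^sub>R 1 - z)" using \<mu>(1) by (simp add: positive_sum)
    have "\<epsilon> *\<^sub>R 1 + z = (\<Sum>k\<in>t. h k * x * h k - (\<mu> k - \<epsilon>) *\<^sub>R (h k * h k))"
      unfolding e z_def y_def by (simp add: sum_subtractf sum.distrib scaleR_diff_left)
    then show "positive (\<epsilon> *\<^sub>R 1 + z)" using \<mu>(2) by (simp add: positive_sum)
  qed
  ultimately show thesis using that by (simp add: z_def)
qed

text \<open>The real and the imaginary part of \<open>x\<close> are averaged by the same partition of unity, taken from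
  elements that localize both.\<close>

lemma average_near:
  assumes \<epsilon>: "0 < \<epsilon>"
  obtains t :: "'a set" and h y where "\<forall>k\<in>t. h k \<in> D"
    "(\<Sum>k\<in>t. h k * h k) = 1" "y \<in> D" "norm ((\<Sum>k\<in>t. h k * x * h k) - y) \<le> \<epsilon>"
proof -
  let ?a = "re_part x" and ?b = "im_part x"
  define K where "K = localizers ?a (\<epsilon> / 2) \<inter> localizers ?b (\<epsilon> / 2)"
  have KD: "k \<in> D \<and> adj k = k" if "k \<in> K" for k using that by (auto simp: K_def localizers_def)
  have Kmult: "h * k \<in> K" if "h \<in> D" "adj h = h" "k \<in> K" for h k
    using that localizers_mult by (auto simp: K_def)
  have Knz: "\<exists>k\<in>K. \<rho> k \<noteq> 0" if \<rho>: "\<rho> \<in> characters D" for \<rho>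
  proof -
    have e: "0 < \<epsilon> / 2" using \<epsilon> by simp
    obtain k l where k: "k \<in> localizers ?a (\<epsilon> / 2)" "\<rho> k \<noteq> 0" and l: "l \<in> localizers ?b (\<epsilon> / 2)" "\<rho> l \<noteq> 0"
      using localizers_nonvanishing[OF adj_re_part e \<rho>] localizers_nonvanishing[OF adj_im_part e \<rho>] by metis
    have kl: "k \<in> D" "adj k = k" "l \<in> D" "adj l = l" using k l by (auto simp: localizers_def)
    have "l * k \<in> localizers ?a (\<epsilon> / 2)" "k * l \<in> localizers ?b (\<epsilon> / 2)"
      using k l kl by (auto intro: localizers_mult)
    then have "k * l \<in> K" using kl comm[of k l] by (simp add: K_def)
    moreover have "\<rho> (k * l) \<noteq> 0" using k l kl by (simp add: character_mult[OF \<rho>])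
    ultimately show ?thesis by blast
  qed
  obtain t :: "'a set" and h where h: "\<forall>k\<in>t. h k \<in> K" and one: "(\<Sum>k\<in>t. h k * h k) = 1"
    using partition_of_unity[OF KD Kmult Knz] by blast
  have ha: "\<forall>k\<in>t. h k \<in> localizers ?a (\<epsilon> / 2)" and hb: "\<forall>k\<in>t. h k \<in> localizers ?b (\<epsilon> / 2)"
    using h by (auto simp: K_def)
  obtain y where y: "y \<in> D" "norm ((\<Sum>k\<in>t. h k * ?a * h k) - y) \<le> \<epsilon> / 2"
    using localized_average_near[OF ha one adj_re_part] by blast
  obtain y' where y': "y' \<in> D" "norm ((\<Sum>k\<in>t. h k * ?b * h k) - y') \<le> \<epsilon> / 2"
    using localized_average_near[OF hb one adj_im_part] by blast
  have sum: "(\<Sum>k\<in>t. h k * x * h k) = (\<Sum>k\<in>t. h k * ?a * h k) + \<i> *\<^sub>C (\<Sum>k\<in>t. h k * ?b * h k)"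
  proof -
    have "h k * x * h k = h k * ?a * h k + \<i> *\<^sub>C (h k * ?b * h k)" for k
      by (subst (1) re_part_plus_im_part[of x, symmetric])
        (simp add: distrib_left distrib_right mult_scaleC_left mult_scaleC_right)
    then show ?thesis by (simp add: sum.distrib complex_vector.scale_sum_right)
  qed
  show thesis
  proof (rule that[of t h "y + \<i> *\<^sub>C y'"])
    show "\<forall>k\<in>t. h k \<in> D" using h KD by blast
    show "y + \<i> *\<^sub>C y' \<in> D" using y y' by auto
    have "(\<Sum>k\<in>t. h k * x * h k) - (y + \<i> *\<^sub>C y') =
        ((\<Sum>k\<in>t. h k * ?a * h k) - y) + \<i> *\<^sub>C ((\<Sum>k\<in>t. h k * ?b * h k) - y')"
      unfolding sum by (simp add: complex_vector.scale_right_diff_distrib)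
    also have "norm \<dots> \<le> norm ((\<Sum>k\<in>t. h k * ?a * h k) - y) + norm (\<i> *\<^sub>C ((\<Sum>k\<in>t. h k * ?b * h k) - y'))"
      by (rule norm_triangle_ineq)
    also have "\<dots> \<le> \<epsilon> / 2 + \<epsilon> / 2" unfolding norm_scaleC using y(2) y'(2) by (intro add_mono) simp_all
    finally show "norm ((\<Sum>k\<in>t. h k * x * h k) - (y + \<i> *\<^sub>C y')) \<le> \<epsilon>" by simp
  qed (rule one)
qed

lemma state_extension_average:
  fixes t :: "'b set"
  assumes \<rho>: "\<rho> \<in> characters D" and h: "\<forall>k\<in>t. h k \<in> D" and one: "(\<Sum>k\<in>t. h k * h k) = 1"
  shows "state_extension \<rho> (\<Sum>k\<in>t. h k * x * h k) = state_extension \<rho> x"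
proof -
  have "state_extension \<rho> (\<Sum>k\<in>t. h k * x * h k) = (\<Sum>k\<in>t. \<rho> (h k * h k) * state_extension \<rho> x)"
    using h by (simp add: state_extension_sum[OF \<rho>] state_extension_mult_right[OF \<rho>]
        state_extension_mult_left[OF \<rho>] character_mult[OF \<rho>] mult_ac)
  also have "\<dots> = \<rho> (\<Sum>k\<in>t. h k * h k) * state_extension \<rho> x"
    using h by (subst character_sum[OF \<rho>]) (auto simp: sum_distrib_right)
  finally show ?thesis by (simp add: one character_one[OF \<rho>])
qed

text \<open>Averages near \<open>D\<close> provide elements of \<open>D\<close> whose values approximate those of all extended characters at
  \<open>x\<close> uniformly. As the norm of \<open>D\<close> is the supremum over characters, these elements form a Cauchy
  sequence.\<close>

lemma ex_expectation: "\<exists>y\<in>D. \<forall>\<rho>\<in>characters D. \<rho> y = state_extension \<rho> x"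
proof -
  have "\<exists>y\<in>D. \<forall>\<rho>\<in>characters D. cmod (\<rho> y - state_extension \<rho> x) \<le> inverse (real (Suc n))" for n
  proof -
    have e: "0 < inverse (real (Suc n))" by simp
    obtain t :: "'a set" and h y where h: "\<forall>k\<in>t. h k \<in> D" and one: "(\<Sum>k\<in>t. h k * h k) = 1"
      and y: "y \<in> D" "norm ((\<Sum>k\<in>t. h k * x * h k) - y) \<le> inverse (real (Suc n))"
      using average_near[OF e, of x] by blast
    have "cmod (\<rho> y - state_extension \<rho> x) \<le> inverse (real (Suc n))" if \<rho>: "\<rho> \<in> characters D" for \<rho>
    proof -
      have "state_extension \<rho> ((\<Sum>k\<in>t. h k * x * h k) - y) = state_extension \<rho> x - \<rho> y"
        unfolding state_extension_diff[OF \<rho>] state_extension_average[OF \<rho> h one]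
          state_extension_eq[OF \<rho> y(1)] ..
      then have "cmod (state_extension \<rho> x - \<rho> y) \<le> norm ((\<Sum>k\<in>t. h k * x * h k) - y)"
        using norm_state_extension_le[OF \<rho>] by metis
      then show ?thesis using y(2) by (simp add: norm_minus_commute)
    qed
    then show ?thesis using y(1) by blast
  qed
  then obtain y where yD: "\<And>n. y n \<in> D"
    and near: "\<And>n \<rho>. \<rho> \<in> characters D \<Longrightarrow> cmod (\<rho> (y n) - state_extension \<rho> x) \<le> inverse (real (Suc n))"
    by metis
  have dist: "norm (y m - y n) \<le> inverse (real (Suc m)) + inverse (real (Suc n))" for m n
  proof (rule norm_le_from_characters)
    show "y m - y n \<in> D" using yD by auto
    fix \<rho> assume \<rho>: "\<rho> \<in> characters D"
    have "\<rho> (y m - y n) = (\<rho> (y m) - state_extension \<rho> x) - (\<rho> (y n) - state_extension \<rho> x)"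
      using yD by (simp add: character_diff[OF \<rho>])
    also have "cmod \<dots> \<le> inverse (real (Suc m)) + inverse (real (Suc n))"
      by (intro norm_triangle_le_diff add_mono near \<rho>)
    finally show "cmod (\<rho> (y m - y n)) \<le> inverse (real (Suc m)) + inverse (real (Suc n))" .
  qed
  have "Cauchy y"
  proof (rule metric_CauchyI)
    fix e :: real assume "0 < e"
    then obtain N where N: "inverse (real (Suc N)) < e / 2" using reals_Archimedean[of "e / 2"] by auto
    have "dist (y m) (y n) < e" if "N \<le> m" "N \<le> n" for m n
    proof -
      have "inverse (real (Suc m)) \<le> inverse (real (Suc N))" "inverse (real (Suc n)) \<le> inverse (real (Suc N))"
        using that by (simp_all add: le_imp_inverse_le)
      then show ?thesis unfolding dist_norm using dist[of m n] N by linarith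
    qed
    then show "\<exists>M. \<forall>m\<ge>M. \<forall>n\<ge>M. dist (y m) (y n) < e" by blast
  qed
  then obtain L where L: "y \<longlonglongrightarrow> L" using Cauchy_convergent_iff convergent_def by blast
  have LD: "L \<in> D" by (rule closed_sequentially[OF closed_A yD L])
  have "\<rho> L = state_extension \<rho> x" if \<rho>: "\<rho> \<in> characters D" for \<rho>
  proof -
    have "(\<lambda>n. \<rho> (y n)) \<longlonglongrightarrow> state_extension \<rho> x"
    proof (rule LIM_zero_cancel, rule tendsto_norm_zero_cancel, rule tendsto_sandwich[OF _ _ tendsto_const LIMSEQ_inverse_real_of_nat])
      show "\<forall>\<^sub>F n in sequentially. 0 \<le> cmod (\<rho> (y n) - state_extension \<rho> x)" by simp
      show "\<forall>\<^sub>F n in sequentially. cmod (\<rho> (y n) - state_extension \<rho> x) \<le> inverse (real (Suc n))"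
        using near[OF \<rho>] by simp
    qed
    moreover have "(\<lambda>n. \<rho> (y n)) \<longlonglongrightarrow> \<rho> L"
    proof (rule LIM_zero_cancel, rule tendsto_norm_zero_cancel, rule tendsto_sandwich[OF _ _ tendsto_const])
      show "\<forall>\<^sub>F n in sequentially. 0 \<le> cmod (\<rho> (y n) - \<rho> L)" by simp
      show "\<forall>\<^sub>F n in sequentially. cmod (\<rho> (y n) - \<rho> L) \<le> norm (y n - L)"
        using norm_character_le[OF \<rho>, of "y _ - L"] yD LD by (simp add: character_diff[OF \<rho>] diff_mem)
      show "(\<lambda>n. norm (y n - L)) \<longlonglongrightarrow> 0"
        using L by (intro tendsto_norm_zero LIM_zero)
    qed
    ultimately show ?thesis using LIMSEQ_unique by blast
  qed
  then show ?thesis using LD by blast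
qed

definition expectation :: "'a \<Rightarrow> 'a" where
  "expectation x = (SOME y. y \<in> D \<and> (\<forall>\<rho>\<in>characters D. \<rho> y = state_extension \<rho> x))"

lemma expectation_mem: "expectation x \<in> D"
  and character_expectation: "\<rho> \<in> characters D \<Longrightarrow> \<rho> (expectation x) = state_extension \<rho> x"
proof -
  have "expectation x \<in> D \<and> (\<forall>\<rho>\<in>characters D. \<rho> (expectation x) = state_extension \<rho> x)"
    unfolding expectation_def by (rule someI_ex) (use ex_expectation[of x] in blast)
  then show "expectation x \<in> D" "\<rho> \<in> characters D \<Longrightarrow> \<rho> (expectation x) = state_extension \<rho> x"
    by auto
qed

lemma expectation_eqI:
  assumes "y \<in> D" "\<And>\<rho>. \<rho> \<in> characters D \<Longrightarrow> \<rho> y = state_extension \<rho> x" shows "expectation x = y"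
  using assms by (intro eq_from_characters expectation_mem) (simp_all add: character_expectation)

lemma average_near_expectation:
  assumes \<epsilon>: "0 < \<epsilon>"
  obtains t :: "'a set" and h where "\<forall>k\<in>t. h k \<in> D" "(\<Sum>k\<in>t. h k * h k) = 1"
    "norm ((\<Sum>k\<in>t. h k * x * h k) - expectation x) \<le> \<epsilon>"
proof -
  have "0 < \<epsilon> / 2" using \<epsilon> by simp
  then obtain t :: "'a set" and h y where h: "\<forall>k\<in>t. h k \<in> D" and one: "(\<Sum>k\<in>t. h k * h k) = 1"
    and y: "y \<in> D" "norm ((\<Sum>k\<in>t. h k * x * h k) - y) \<le> \<epsilon> / 2"
    using average_near[of "\<epsilon> / 2" x] by blast
  have "norm (y - expectation x) \<le> \<epsilon> / 2"
  proof (rule norm_le_from_characters)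
    show "y - expectation x \<in> D" using y expectation_mem by auto
    fix \<rho> assume \<rho>: "\<rho> \<in> characters D"
    have "\<rho> (y - expectation x) = - state_extension \<rho> ((\<Sum>k\<in>t. h k * x * h k) - y)"
      unfolding state_extension_diff[OF \<rho>] state_extension_average[OF \<rho> h one] state_extension_eq[OF \<rho> y(1)]
        character_diff[OF \<rho> y(1) expectation_mem] character_expectation[OF \<rho>] by simp
    then have "cmod (\<rho> (y - expectation x)) \<le> norm ((\<Sum>k\<in>t. h k * x * h k) - y)"
      using norm_state_extension_le[OF \<rho>] by (metis norm_minus_cancel)
    then show "cmod (\<rho> (y - expectation x)) \<le> \<epsilon> / 2" using y(2) by simp
  qed
  then have "norm (((\<Sum>k\<in>t. h k * x * h k) - y) + (y - expectation x)) \<le> \<epsilon> / 2 + \<epsilon> / 2"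
    using y(2) by (intro norm_triangle_mono)
  then show thesis using that[OF h one] by simp
qed

lemma conditional_expectation_expectation: "conditional_expectation D expectation"
  unfolding conditional_expectation_def
proof (intro conjI ballI allI)
  have "expectation (x + y) = expectation x + expectation y" for x y
    by (rule expectation_eqI)
      (auto simp: character_add character_expectation state_extension_add expectation_mem)
  moreover have "expectation (c *\<^sub>C x) = c *\<^sub>C expectation x" for c x
    by (rule expectation_eqI)
      (auto simp: character_scaleC character_expectation state_extension_scaleC expectation_mem)
  ultimately show "Vector_Spaces.linear scaleC scaleC expectation"
    unfolding Vector_Spaces.linear_iff using complex_vector.vector_space_axioms by blast
  show "expectation x \<in> D" for x by (rule expectation_mem)
  show "expectation d = d" if "d \<in> D" for d
    using that by (intro expectation_eqI) (simp_all add: state_extension_eq)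
  show "norm (expectation x) \<le> norm x" for x
    by (rule norm_le_from_characters[OF expectation_mem])
      (simp add: character_expectation norm_state_extension_le)
  show "\<exists>y\<in>D. expectation (adj x * x) = adj y * y" for x
  proof -
    have "positive (expectation (adj x * x))"
      by (rule positive_from_characters[OF expectation_mem])
        (simp add: character_expectation state_positive[OF state_extension_state positive_adj_mult])
    then obtain b where "b \<in> D" "positive b" "b * b = expectation (adj x * x)"
      using positive_sqrt expectation_mem by metis
    then show ?thesis by (metis positive_selfadjoint)
  qed
  show "expectation (d * x * e) = d * expectation x * e" if "d \<in> D" "e \<in> D" for d e x
    using that
    by (intro expectation_eqI)
      (auto simp: character_mult character_expectation state_extension_mult_left state_extension_mult_right
        expectation_mem mult_mem)
qed

text \<open>Composing a conditional expectation with a character gives a state extending the character, and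
  there is only one.\<close>

lemma conditional_expectation_unique:
  assumes "conditional_expectation D F" shows "F = expectation"
proof
  fix x
  have lin: "F (u + v) = F u + F v" "F (c *\<^sub>C u) = c *\<^sub>C F u" for u v c
    using assms by (simp_all add: conditional_expectation_def Vector_Spaces.linear_iff)
  have FD: "F u \<in> D" for u using assms by (simp add: conditional_expectation_def)
  have Fd: "F d = d" if "d \<in> D" for d using assms that by (simp add: conditional_expectation_def)
  show "F x = expectation x"
  proof (rule expectation_eqI[symmetric, OF FD])
    fix \<rho> assume \<rho>: "\<rho> \<in> characters D"
    have "(\<lambda>u. \<rho> (F u)) = state_extension \<rho>"
    proof (rule state_extension_unique[OF \<rho>])
      show "(\<lambda>u. \<rho> (F u)) \<in> states UNIV"
      proof (rule whole.stateI)
        show "(\<lambda>u. \<rho> (F u)) \<in> linear_functionals UNIV"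
          by (simp add: linear_functionals_def lin FD character_add[OF \<rho>] character_scaleC[OF \<rho>])
        show "\<rho> (F 1) = 1" by (simp add: Fd character_one[OF \<rho>])
        fix u
        obtain y where "y \<in> D" "F (adj u * u) = adj y * y"
          using assms unfolding conditional_expectation_def by blast
        then show "\<rho> (F (adj u * u)) \<in> \<real>\<^sub>\<ge>\<^sub>0"
          by (simp add: character_positive[OF \<rho>] positive_adj_mult mult_mem adj_mem)
      qed
    qed (simp add: Fd)
    then show "\<rho> (F x) = state_extension \<rho> x" by (rule fun_cong)
  qed
qed

lemma cond_exp_eq: "cond_exp D = expectation"
  unfolding cond_exp_def
  using conditional_expectation_expectation conditional_expectation_unique by (intro the_equality)

lemma character_state_eq: "\<rho> \<in> characters D \<Longrightarrow> character_state D \<rho> = state_extension \<rho>"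
  by (auto simp: character_state_def cond_exp_eq character_expectation)

section \<open>Normalizers and the functionals they define\<close>

abbreviation normalizer :: "'a \<Rightarrow> bool" where
  "normalizer v \<equiv> v \<in> normalizers D UNIV"

lemma normalizer_mem:
  assumes "normalizer v" "d \<in> D"
  shows "v * d * adj v \<in> D" "adj v * d * v \<in> D" "adj v * (d * v) \<in> D"
  using assms by (auto simp: normalizers_def mult.assoc)

lemma normalizer_sq_mem:
  assumes "normalizer v" shows "adj v * v \<in> D" "v * adj v \<in> D"
  using normalizer_mem[OF assms one_mem] by simp_all

text \<open>Up to the factor \<open>adj v * v\<close>, conjugation by a normalizer is multiplicative on \<open>D\<close>, because \<open>v * adj v\<close>
  belongs to \<open>D\<close> and can be moved past \<open>d\<close>.\<close>

lemma normalizer_conjugation_mult: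
  assumes v: "normalizer v" and d: "d \<in> D"
  shows "(adj v * v) * (adj v * (d * e) * v) = (adj v * d * v) * (adj v * e * v)"
  using comm[OF normalizer_sq_mem(2)[OF v] d] by (metis mult.assoc)

context
  fixes v \<rho> assumes v: "normalizer v" and \<rho>: "\<rho> \<in> characters D"
begin

lemma character_normalizer_conjugation:
  assumes d: "d \<in> D" and e: "e \<in> D"
  shows "\<rho> (adj v * v) * \<rho> (adj v * (d * e) * v) = \<rho> (adj v * d * v) * \<rho> (adj v * e * v)"
  using arg_cong[OF normalizer_conjugation_mult[OF v d, of e], of \<rho>] v d e
  by (simp add: character_mult[OF \<rho>] normalizer_mem normalizer_sq_mem mult_mem del: mult.assoc)

lemma character_normalizer_sq:
  "\<rho> (adj v * v) = of_real (Re (\<rho> (adj v * v)))" "0 \<le> Re (\<rho> (adj v * v))"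
  using character_positive[OF \<rho> positive_adj_mult normalizer_sq_mem(1)[OF v]]
  by (auto simp: complex_nonneg_Reals_iff complex_eq_iff)

text \<open>With \<open>c\<close> the quotient on the right-hand side, \<open>y = adj d * v - cnj c *\<^sub>C v\<close> is a null vector of the state
  by the multiplicativity above, and the claim is \<open>f (adj y * x) = 0\<close>.\<close>

lemma state_extension_normalizer_left:
  assumes d: "d \<in> D" and nz: "\<rho> (adj v * v) \<noteq> 0"
  shows "state_extension \<rho> (adj v * (d * x)) = \<rho> (adj v * d * v) / \<rho> (adj v * v) * state_extension \<rho> (adj v * x)"
proof -
  define r where "r = Re (\<rho> (adj v * v))"
  have r: "\<rho> (adj v * v) = of_real r" using character_normalizer_sq by (simp add: r_def)
  have r0: "r \<noteq> 0" using nz r by auto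
  define c where "c = \<rho> (adj v * d * v) / of_real r"
  have dv: "\<rho> (adj v * d * v) = c * of_real r" using r0 by (simp add: c_def)
  have dv': "\<rho> (adj v * adj d * v) = cnj c * of_real r"
  proof -
    have "adj v * adj d * v = adj (adj v * d * v)" by (simp add: adj_mult adj_adj mult.assoc)
    then have "\<rho> (adj v * adj d * v) = cnj (\<rho> (adj v * d * v))"
      using normalizer_mem(2)[OF v d] by (simp only: character_adj[OF \<rho>])
    then show ?thesis by (simp add: dv)
  qed
  have dd: "\<rho> (adj v * (d * adj d) * v) = c * cnj c * of_real r"
    using character_normalizer_conjugation[OF d adj_mem[OF d]] r0 unfolding dv dv' r by simp
  define y where "y = adj d * v - cnj c *\<^sub>C v"
  have ay: "adj y = adj v * d - c *\<^sub>C adj v" by (simp add: y_def adj_mult adj_adj adj_scaleC)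
  have "adj y * y = adj v * (d * adj d) * v - cnj c *\<^sub>C (adj v * d * v) - c *\<^sub>C (adj v * adj d * v)
      + (c * cnj c) *\<^sub>C (adj v * v)"
    unfolding ay unfolding y_def
    by (simp add: left_diff_distrib right_diff_distrib mult_scaleC_left mult_scaleC_right scaleC_scaleC
        mult.assoc complex_vector.scale_right_diff_distrib)
  then have "state_extension \<rho> (adj y * y) = \<rho> (adj v * (d * adj d) * v) - cnj c * \<rho> (adj v * d * v)
      - c * \<rho> (adj v * adj d * v) + c * cnj c * \<rho> (adj v * v)"
    by (simp only: state_extension_diff[OF \<rho>] state_extension_add[OF \<rho>] state_extension_scaleC[OF \<rho>]
        state_extension_eq[OF \<rho>] normalizer_mem(2)[OF v] normalizer_sq_mem[OF v] d adj_mem mult_mem)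
  also have "\<dots> = 0" unfolding dd dv dv' r by simp
  finally have "state_extension \<rho> (adj y * x) = 0"
    by (rule whole.state_zero_left[OF state_extension_state[OF \<rho>] UNIV_I UNIV_I])
  then have "state_extension \<rho> (adj v * (d * x)) - c * state_extension \<rho> (adj v * x) = 0"
    by (simp add: ay left_diff_distrib mult_scaleC_left state_extension_diff[OF \<rho>]
        state_extension_scaleC[OF \<rho>] mult.assoc)
  then show ?thesis using r0 by (simp add: dv r)
qed

lemma bracket_eq:
  "bracket D v \<rho> x = state_extension \<rho> (adj v * x) / of_real (sqrt (Re (\<rho> (adj v * v))))"
  using normalizer_sq_mem[OF v] by (simp add: bracket_def character_state_eq[OF \<rho>] state_extension_eq[OF \<rho>])

lemma norm_bracket_le:
  assumes "0 < Re (\<rho> (adj v * v))" shows "cmod (bracket D v \<rho> x) \<le> norm x"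
proof -
  define r where "r = Re (\<rho> (adj v * v))"
  have r: "0 < r" using assms by (simp add: r_def)
  have "(cmod (state_extension \<rho> (adj v * x)))\<^sup>2 \<le> Re (state_extension \<rho> (adj v * v)) * Re (state_extension \<rho> (adj x * x))"
    by (rule whole.state_Cauchy_Schwarz[OF state_extension_state[OF \<rho>] UNIV_I UNIV_I])
  also have "Re (state_extension \<rho> (adj v * v)) = r"
    using normalizer_sq_mem[OF v] by (simp add: state_extension_eq[OF \<rho>] r_def)
  also have "r * Re (state_extension \<rho> (adj x * x)) \<le> r * (norm x)\<^sup>2"
  proof (rule mult_left_mono)
    have "Re (state_extension \<rho> (adj x * x)) \<le> cmod (state_extension \<rho> (adj x * x))"
      by (rule complex_Re_le_cmod)
    also have "\<dots> \<le> norm (adj x * x)" by (rule norm_state_extension_le[OF \<rho>])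
    finally show "Re (state_extension \<rho> (adj x * x)) \<le> (norm x)\<^sup>2" by (simp add: norm_adj_mult)
  qed (use r in simp)
  finally have "sqrt ((cmod (state_extension \<rho> (adj v * x)))\<^sup>2) \<le> sqrt (r * (norm x)\<^sup>2)"
    by (rule real_sqrt_le_mono)
  then have "cmod (state_extension \<rho> (adj v * x)) \<le> sqrt r * norm x" by (simp add: real_sqrt_mult)
  then show ?thesis
    using r by (simp add: bracket_eq norm_divide field_simps flip: r_def)
qed

end

lemma bimodule_mult:
  assumes "bimodule D M" "d \<in> D" "m \<in> M" shows "d * m \<in> M" "m * d \<in> M"
  using assms one_mem unfolding bimodule_def by (metis mult_1_right, metis mult_1_left)

text \<open>The norm is attained in the limit on \<open>v * e\<close>, where \<open>e\<close> is concentrated where \<open>adj v * v\<close> is close to its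
  value \<open>r\<close> at \<open>\<rho>\<close>: there \<open>[v, \<rho>]\<close> has the value \<open>sqrt r\<close>, and \<open>norm (v * e)\<close> is close to \<open>sqrt r\<close>.\<close>

lemma bracket_eigenfunctional:
  assumes M: "bimodule D M" and v: "v \<in> normalizers D M" and \<rho>: "\<rho> \<in> characters D"
    and pos: "0 < Re (\<rho> (adj v * v))"
  shows "restrict (bracket D v \<rho>) M \<in> eigenfunctionals1 D M"
proof -
  let ?f = "restrict (bracket D v \<rho>) M"
  have cM: "csubspace M" using M by (simp add: bimodule_def)
  have vM: "v \<in> M" and vn: "normalizer v" using v by (auto simp: normalizers_def)
  define r where "r = Re (\<rho> (adj v * v))"
  have r: "0 < r" "\<rho> (adj v * v) = of_real r"
    using pos character_normalizer_sq(1)[OF vn \<rho>] by (simp_all add: r_def)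
  have lin: "?f \<in> linear_functionals M"
    unfolding linear_functionals_def
    by (auto simp: complex_vector.subspace_add[OF cM] complex_vector.subspace_scale[OF cM] bracket_eq[OF vn \<rho>]
        distrib_left mult_scaleC_right state_extension_add[OF \<rho>] state_extension_scaleC[OF \<rho>] add_divide_distrib)
  have bound: "cmod (?f x) \<le> 1 * norm x" if "x \<in> M" for x
    using norm_bracket_le[OF vn \<rho> pos] that by simp
  have bf: "?f \<in> bounded_functionals M"
    unfolding bounded_functionals_def using lin bound by blast
  define N where "N = functional_norm M ?f"
  have N1: "N \<le> 1"
    unfolding N_def by (rule functional_norm_le[OF complex_vector.subspace_0[OF cM] _ bound]) simp
  have Nbound: "cmod (?f x) \<le> N * norm x" if "x \<in> M" for x
    unfolding N_def by (rule functional_norm_bound[OF bf cM that])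
  have N0: "0 \<le> N"
  proof -
    have "v \<noteq> 0" using r character_zero[OF \<rho>] by auto
    moreover have "0 \<le> N * norm v" using Nbound[OF vM] norm_ge_zero order_trans by blast
    ultimately show ?thesis by (simp add: zero_le_mult_iff)
  qed
  have "r \<le> N\<^sup>2 * r"
  proof (rule field_le_epsilon)
    fix \<epsilon> :: real assume \<epsilon>: "0 < \<epsilon>"
    define z where "z = adj v * v - r *\<^sub>R 1"
    have z: "z \<in> D" using normalizer_sq_mem[OF vn] by (auto simp: z_def)
    have "\<rho> z = 0"
      using normalizer_sq_mem[OF vn] r by (simp add: z_def character_diff[OF \<rho>] character_scaleR[OF \<rho>]
          character_one[OF \<rho>] scaleR_mem)
    then obtain e where e: "e \<in> D" "adj e = e" "\<rho> e = 1" "norm e \<le> 1" "norm (z * e) \<le> \<epsilon>"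
      using bump[OF \<rho> z _ \<epsilon>] by blast
    have veM: "v * e \<in> M" by (rule bimodule_mult(2)[OF M e(1) vM])
    have "?f (v * e) = of_real r / of_real (sqrt r)"
    proof -
      have "state_extension \<rho> (adj v * (v * e)) = state_extension \<rho> (adj v * v) * \<rho> e"
        unfolding mult.assoc[symmetric] by (rule state_extension_mult_right[OF \<rho> e(1)])
      also have "\<dots> = of_real r"
        using normalizer_sq_mem[OF vn] by (simp add: state_extension_eq[OF \<rho>] r e)
      finally show ?thesis using veM by (simp add: bracket_eq[OF vn \<rho>] flip: r_def)
    qed
    also have "\<dots> = of_real (sqrt r)" using r(1) by (simp add: real_div_sqrt flip: of_real_divide)
    finally have "sqrt r \<le> N * norm (v * e)" using Nbound[OF veM] r(1) by simp
    then have "(sqrt r)\<^sup>2 \<le> (N * norm (v * e))\<^sup>2" using r(1) by (intro power_mono) auto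
    then have 1: "r \<le> N\<^sup>2 * (norm (v * e))\<^sup>2" using r(1) by (simp add: power_mult_distrib)
    have "(norm (v * e))\<^sup>2 = norm (e * (adj v * v * e))"
      using norm_adj_mult[of "v * e"] by (simp add: adj_mult e mult.assoc)
    also have "\<dots> \<le> norm e * norm (adj v * v * e)" by (rule norm_mult_ineq)
    also have "\<dots> \<le> norm (adj v * v * e)" using e(4) by (simp add: mult_left_le_one_le)
    also have "adj v * v * e = z * e + r *\<^sub>R e" by (simp add: z_def left_diff_distrib)
    also have "norm (z * e + r *\<^sub>R e) \<le> \<epsilon> + r * 1"
      using e r(1) by (intro norm_triangle_mono) auto
    finally have "(norm (v * e))\<^sup>2 \<le> \<epsilon> + r" by simp
    then have "N\<^sup>2 * (norm (v * e))\<^sup>2 \<le> N\<^sup>2 * (\<epsilon> + r)" by (intro mult_left_mono) auto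
    also have "\<dots> \<le> N\<^sup>2 * r + \<epsilon>"
    proof -
      have "N\<^sup>2 \<le> 1" using N0 N1 by (simp add: power_le_one)
      then show ?thesis using \<epsilon> by (simp add: distrib_left mult_left_le_one_le)
    qed
    finally show "r \<le> N\<^sup>2 * r + \<epsilon>" using 1 by simp
  qed
  then have "1 \<le> N\<^sup>2" using r(1) by simp
  then have "1 \<le> N" using N0 by (metis abs_le_square_iff abs_of_nonneg abs_one one_power2)
  with N1 have N: "functional_norm M ?f = 1" by (simp add: N_def)
  have "\<exists>c. \<forall>m\<in>M. ?f (d * m) = c * ?f m" if d: "d \<in> D" for d
  proof (intro exI ballI)
    fix m assume m: "m \<in> M"
    have nz: "\<rho> (adj v * v) \<noteq> 0" using r by simp
    show "?f (d * m) = \<rho> (adj v * d * v) / \<rho> (adj v * v) * ?f m"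
      using m bimodule_mult(1)[OF M d m]
      by (simp add: bracket_eq[OF vn \<rho>] state_extension_normalizer_left[OF vn \<rho> d nz])
  qed
  moreover have "\<exists>c. \<forall>m\<in>M. ?f (m * d) = c * ?f m" if d: "d \<in> D" for d
  proof (intro exI ballI)
    fix m assume m: "m \<in> M"
    have "state_extension \<rho> (adj v * (m * d)) = state_extension \<rho> (adj v * m) * \<rho> d"
      unfolding mult.assoc[symmetric] by (rule state_extension_mult_right[OF \<rho> d])
    then show "?f (m * d) = \<rho> d * ?f m"
      using m bimodule_mult(2)[OF M d m] by (simp add: bracket_eq[OF vn \<rho>])
  qed
  ultimately show ?thesis using bf N by (simp add: eigenfunctionals1_def)
qed

section \<open>From an eigenfunctional to an aligned normalizer\<close>

lemma eigenfunctional_characters: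
  assumes M: "bimodule D M" and \<phi>: "\<phi> \<in> eigenfunctionals1 D M"
  obtains \<alpha> \<beta> m where "\<alpha> \<in> characters D" "\<beta> \<in> characters D" "m \<in> M" "\<phi> m \<noteq> 0"
    "\<forall>d\<in>D. \<forall>m\<in>M. \<phi> (d * m) = \<alpha> d * \<phi> m" "\<forall>d\<in>D. \<forall>m\<in>M. \<phi> (m * d) = \<beta> d * \<phi> m"
proof -
  have cM: "csubspace M" using M by (simp add: bimodule_def)
  have lin: "\<phi> \<in> linear_functionals M" and n1: "functional_norm M \<phi> = 1"
    and left: "\<And>d. d \<in> D \<Longrightarrow> \<exists>c. \<forall>m\<in>M. \<phi> (d * m) = c * \<phi> m"
    and right: "\<And>d. d \<in> D \<Longrightarrow> \<exists>c. \<forall>m\<in>M. \<phi> (m * d) = c * \<phi> m"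
    using \<phi> by (auto simp: eigenfunctionals1_def bounded_functionals_def)
  have "\<exists>m\<in>M. \<phi> m \<noteq> 0"
  proof (rule ccontr)
    assume "\<not> ?thesis"
    then have "functional_norm M \<phi> \<le> 0"
      by (intro functional_norm_le complex_vector.subspace_0[OF cM]) auto
    then show False using n1 by simp
  qed
  then obtain m where m: "m \<in> M" "\<phi> m \<noteq> 0" by blast
  define \<alpha> where "\<alpha> = (\<lambda>d\<in>D. \<phi> (d * m) / \<phi> m)"
  define \<beta> where "\<beta> = (\<lambda>d\<in>D. \<phi> (m * d) / \<phi> m)"
  have \<alpha>: "\<phi> (d * x) = \<alpha> d * \<phi> x" if "d \<in> D" "x \<in> M" for d x
    using left[OF that(1)] that m by (force simp: \<alpha>_def)
  have \<beta>: "\<phi> (x * d) = \<beta> d * \<phi> x" if "d \<in> D" "x \<in> M" for d x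
    using right[OF that(1)] that m by (force simp: \<beta>_def)
  note mM = bimodule_mult[OF M _ m(1)]
  have "\<alpha> \<in> characters D"
    unfolding characters_def linear_functionals_def
  proof (intro CollectI conjI ballI allI)
    show "\<alpha> \<in> extensional D" by (simp add: \<alpha>_def)
    show "\<exists>x\<in>D. \<alpha> x \<noteq> 0" using m by (intro bexI[of _ 1]) (simp_all add: \<alpha>_def)
    fix x assume x: "x \<in> D"
    show "\<alpha> (c *\<^sub>C x) = c * \<alpha> x" for c
      using x mM by (simp add: \<alpha>_def scaleC_mem mult_scaleC_left linear_functionals_scaleC[OF lin])
    fix y assume y: "y \<in> D"
    show "\<alpha> (x + y) = \<alpha> x + \<alpha> y"
      using x y mM by (simp add: \<alpha>_def add_mem distrib_right linear_functionals_add[OF lin] add_divide_distrib)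
    have "\<phi> (x * y * m) = \<alpha> x * (\<alpha> y * \<phi> m)"
      using x y mM(1) m by (simp add: mult.assoc \<alpha>)
    then show "\<alpha> (x * y) = \<alpha> x * \<alpha> y"
      using x y m \<alpha>[OF mult_mem[OF x y] m(1)] by simp
  qed
  moreover have "\<beta> \<in> characters D"
    unfolding characters_def linear_functionals_def
  proof (intro CollectI conjI ballI allI)
    show "\<beta> \<in> extensional D" by (simp add: \<beta>_def)
    show "\<exists>x\<in>D. \<beta> x \<noteq> 0" using m by (intro bexI[of _ 1]) (simp_all add: \<beta>_def)
    fix x assume x: "x \<in> D"
    show "\<beta> (c *\<^sub>C x) = c * \<beta> x" for c
      using x mM by (simp add: \<beta>_def scaleC_mem mult_scaleC_right linear_functionals_scaleC[OF lin])
    fix y assume y: "y \<in> D"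
    show "\<beta> (x + y) = \<beta> x + \<beta> y"
      using x y mM by (simp add: \<beta>_def add_mem distrib_left linear_functionals_add[OF lin] add_divide_distrib)
    have "\<phi> (m * (x * y)) = \<beta> y * (\<beta> x * \<phi> m)"
      using x y mM(2) m by (simp add: \<beta> flip: mult.assoc)
    then show "\<beta> (x * y) = \<beta> x * \<beta> y"
      using x y m \<beta>[OF mult_mem[OF x y] m(1)] by simp
  qed
  ultimately show thesis using that[of \<alpha> \<beta> m] m \<alpha> \<beta> by blast
qed

lemma norm_eigenfunctional_le:
  assumes M: "bimodule D M" and \<phi>: "\<phi> \<in> eigenfunctionals1 D M" and m: "m \<in> M"
  shows "cmod (\<phi> m) \<le> norm m"
  using functional_norm_bound[of \<phi> M m] assms by (simp add: eigenfunctionals1_def bimodule_def)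

text \<open>A normalizer with \<open>\<beta> (adj w * w) \<noteq> 0\<close> induces a partial homeomorphism of the character space that is
  defined at \<open>\<beta>\<close>; being aligned means that it sends \<open>\<beta>\<close> to \<open>\<alpha>\<close>.\<close>

definition aligned :: "('a \<Rightarrow> complex) \<Rightarrow> ('a \<Rightarrow> complex) \<Rightarrow> 'a \<Rightarrow> bool" where
  "aligned \<alpha> \<beta> w \<longleftrightarrow> normalizer w \<and> \<beta> (adj w * w) \<noteq> 0 \<and>
     (\<forall>d\<in>D. \<beta> (adj w * d * w) = \<beta> (adj w * w) * \<alpha> d)"

text \<open>Every bounded functional with \<open>\<phi> (d m e) = \<alpha> d \<cdot> \<beta> e \<cdot> \<phi> m\<close> vanishes on these elements.\<close>

definition locally_null :: "('a \<Rightarrow> complex) \<Rightarrow> ('a \<Rightarrow> complex) \<Rightarrow> 'a set" where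
  "locally_null \<alpha> \<beta> = {x. \<forall>\<epsilon>>0. \<exists>d\<in>D. \<exists>e\<in>D. \<alpha> d = 1 \<and> \<beta> e = 1 \<and> norm d \<le> 1 \<and> norm e \<le> 1 \<and> norm (d * x * e) \<le> \<epsilon>}"

lemma norm_conjugate_contractions:
  assumes "norm d \<le> 1" "norm e \<le> 1" shows "norm (d * x * e) \<le> norm (x :: 'a)"
proof -
  have "norm (d * x * e) \<le> norm d * norm x * norm e"
    by (meson norm_mult_ineq mult_right_mono norm_ge_zero order_trans)
  also have "\<dots> \<le> 1 * norm x * 1" using assms by (intro mult_mono) auto
  finally show ?thesis by simp
qed

lemma bump_right:
  assumes \<beta>: "\<beta> \<in> characters D" and y: "adj y * y \<in> D" "cmod (\<beta> (adj y * y)) \<le> \<epsilon>\<^sup>2 / 2" and \<epsilon>: "0 < \<epsilon>"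
  obtains e where "e \<in> D" "\<beta> e = 1" "norm e \<le> 1" "norm (y * e) \<le> \<epsilon>"
proof -
  define \<gamma> where "\<gamma> = \<beta> (adj y * y)"
  define z where "z = adj y * y - \<gamma> *\<^sub>C 1"
  have z: "z \<in> D" using y by (auto simp: z_def)
  have "\<beta> z = 0"
    using y by (simp add: z_def \<gamma>_def character_diff[OF \<beta>] character_scaleC[OF \<beta>] character_one[OF \<beta>] scaleC_mem)
  moreover have "0 < \<epsilon>\<^sup>2 / 2" using \<epsilon> by simp
  ultimately obtain e where e: "e \<in> D" "adj e = e" "\<beta> e = 1" "norm e \<le> 1" "norm (z * e) \<le> \<epsilon>\<^sup>2 / 2"
    using bump[OF \<beta> z] by metis
  have "(norm (y * e))\<^sup>2 = norm (e * (adj y * y * e))"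
    using norm_adj_mult[of "y * e"] by (simp add: adj_mult e mult.assoc)
  also have "\<dots> \<le> norm e * norm (adj y * y * e)" by (rule norm_mult_ineq)
  also have "\<dots> \<le> norm (adj y * y * e)" using e(4) by (simp add: mult_left_le_one_le)
  also have "adj y * y * e = z * e + \<gamma> *\<^sub>C e" by (simp add: z_def left_diff_distrib mult_scaleC_left)
  also have "norm (z * e + \<gamma> *\<^sub>C e) \<le> \<epsilon>\<^sup>2 / 2 + \<epsilon>\<^sup>2 / 2 * 1"
  proof (rule norm_triangle_mono[OF e(5)])
    show "norm (\<gamma> *\<^sub>C e) \<le> \<epsilon>\<^sup>2 / 2 * 1"
      unfolding norm_scaleC \<gamma>_def using y(2) e(4) by (intro mult_mono) auto
  qed
  finally have "(norm (y * e))\<^sup>2 \<le> \<epsilon>\<^sup>2" by simp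
  then have "norm (y * e) \<le> \<epsilon>" by (rule power2_le_imp_le) (use \<epsilon> in simp)
  then show thesis using that e by blast
qed

text \<open>If \<open>\<beta> (adj w * w) = 0\<close>, then multiplying on the right by \<open>e\<close> concentrated near \<open>\<beta>\<close> makes \<open>w\<close> small.
  Otherwise \<open>w\<close> sends \<open>\<beta>\<close> to a character different from \<open>\<alpha>\<close>, and \<open>d\<close> concentrated near \<open>\<alpha>\<close> makes
  \<open>\<beta> (adj (d * w) * (d * w))\<close> small, which reduces to the first situation for \<open>d * w\<close>.\<close>

lemma unaligned_locally_null:
  assumes \<alpha>: "\<alpha> \<in> characters D" and \<beta>: "\<beta> \<in> characters D" and w: "normalizer w" "\<not> aligned \<alpha> \<beta> w"
  shows "w \<in> locally_null \<alpha> \<beta>"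
  unfolding locally_null_def
proof (intro CollectI allI impI)
  fix \<epsilon> :: real assume \<epsilon>: "0 < \<epsilon>"
  show "\<exists>d\<in>D. \<exists>e\<in>D. \<alpha> d = 1 \<and> \<beta> e = 1 \<and> norm d \<le> 1 \<and> norm e \<le> 1 \<and> norm (d * w * e) \<le> \<epsilon>"
  proof (cases "\<beta> (adj w * w) = 0")
    case True
    then obtain e where "e \<in> D" "\<beta> e = 1" "norm e \<le> 1" "norm (w * e) \<le> \<epsilon>"
      using bump_right[OF \<beta> normalizer_sq_mem(1)[OF w(1)] _ \<epsilon>] by auto
    then show ?thesis using character_one[OF \<alpha>] by (intro bexI[of _ 1] bexI[of _ e]) auto
  next
    case False
    define r where "r = \<beta> (adj w * w)"
    have r: "r \<noteq> 0" using False by (simp add: r_def)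
    obtain d0 where d0: "d0 \<in> D" "\<beta> (adj w * d0 * w) \<noteq> r * \<alpha> d0"
      using w False by (auto simp: aligned_def r_def)
    define d1 where "d1 = d0 - \<alpha> d0 *\<^sub>C 1"
    have d1: "d1 \<in> D" using d0 by (auto simp: d1_def)
    have \<alpha>d1: "\<alpha> d1 = 0"
      using d0 by (simp add: d1_def character_diff[OF \<alpha>] character_scaleC[OF \<alpha>] character_one[OF \<alpha>] scaleC_mem)
    define c where "c = \<beta> (adj w * d1 * w)"
    have "c = \<beta> (adj w * d0 * w) - \<alpha> d0 * r"
    proof -
      have "adj w * d1 * w = adj w * d0 * w - \<alpha> d0 *\<^sub>C (adj w * w)"
        by (simp add: d1_def left_diff_distrib right_diff_distrib mult_scaleC_left mult_scaleC_right)
      then show ?thesis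
        using normalizer_mem(2)[OF w(1) d0(1)] normalizer_sq_mem[OF w(1)]
        by (simp add: c_def r_def character_diff[OF \<beta>] character_scaleC[OF \<beta>] scaleC_mem)
    qed
    then have c: "c \<noteq> 0" using d0 by auto
    \<comment> \<open>\<open>d1\<close> separates the two characters: it vanishes at \<open>\<alpha>\<close> and has the value \<open>c / r\<close> at the image of
      \<open>\<beta>\<close>. The tolerance \<open>\<eta>\<close> is what remains of \<open>\<epsilon>\<^sup>2 / 2\<close> after division by \<open>c\<close>; the summand \<open>1\<close> only
      keeps \<open>K\<close> positive.\<close>
    define K where "K = cmod r * (norm w)\<^sup>2 + 1"
    have K: "0 < K" by (simp add: K_def add_nonneg_pos)
    define \<eta> where "\<eta> = \<epsilon>\<^sup>2 * cmod c / (2 * K)"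
    have \<eta>: "0 < \<eta>" using \<epsilon> c K by (simp add: \<eta>_def)
    obtain d where d: "d \<in> D" "adj d = d" "\<alpha> d = 1" "norm d \<le> 1" "norm (d1 * d) \<le> \<eta>"
      using bump[OF \<alpha> d1 \<alpha>d1 \<eta>] by blast
    define \<gamma> where "\<gamma> = \<beta> (adj w * (d * d) * w)"
    have "r * \<beta> (adj w * (d1 * (d * d)) * w) = c * \<gamma>"
      using character_normalizer_conjugation[OF w(1) \<beta> d1 mult_mem[OF d(1) d(1)]]
      by (simp add: r_def c_def \<gamma>_def)
    then have "cmod c * cmod \<gamma> = cmod r * cmod (\<beta> (adj w * (d1 * (d * d)) * w))"
      by (metis norm_mult)
    also have "\<dots> \<le> cmod r * (\<eta> * (norm w)\<^sup>2)"
    proof (rule mult_left_mono)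
      have "cmod (\<beta> (adj w * (d1 * (d * d)) * w)) \<le> norm (adj w * (d1 * (d * d)) * w)"
        using d d1 by (intro norm_character_le[OF \<beta>] normalizer_mem[OF w(1)]) auto
      also have "\<dots> \<le> norm (adj w) * norm (d1 * (d * d)) * norm w"
        by (meson norm_mult_ineq mult_right_mono norm_ge_zero order_trans)
      also have "norm (d1 * (d * d)) \<le> \<eta>"
      proof -
        have "norm (d1 * (d * d)) \<le> norm (d1 * d) * norm d"
          unfolding mult.assoc[symmetric] by (rule norm_mult_ineq)
        also have "\<dots> \<le> norm (d1 * d)" using d(4) by (simp add: mult_left_le)
        finally show ?thesis using d(5) by simp
      qed
      finally show "cmod (\<beta> (adj w * (d1 * (d * d)) * w)) \<le> \<eta> * (norm w)\<^sup>2"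
        by (simp add: power2_eq_square mult_ac mult_left_mono mult_right_mono)
    qed simp
    also have "\<dots> \<le> \<eta> * K" using \<eta> by (simp add: K_def algebra_simps)
    also have "\<dots> = cmod c * (\<epsilon>\<^sup>2 / 2)" using K by (simp add: \<eta>_def)
    finally have "cmod \<gamma> \<le> \<epsilon>\<^sup>2 / 2" using c by (simp add: mult_le_cancel_left)
    moreover have dw: "adj (d * w) * (d * w) = adj w * (d * d) * w" using d by (simp add: adj_mult mult.assoc)
    ultimately obtain e where "e \<in> D" "\<beta> e = 1" "norm e \<le> 1" "norm (d * w * e) \<le> \<epsilon>"
      using bump_right[OF \<beta> _ _ \<epsilon>, of "d * w"] normalizer_mem(2)[OF w(1) mult_mem[OF d(1) d(1)]]
      by (auto simp: \<gamma>_def)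
    then show ?thesis using d by blast
  qed
qed

lemma locally_null_add:
  assumes \<alpha>: "\<alpha> \<in> characters D" and \<beta>: "\<beta> \<in> characters D"
    and x: "x \<in> locally_null \<alpha> \<beta>" and y: "y \<in> locally_null \<alpha> \<beta>"
  shows "x + y \<in> locally_null \<alpha> \<beta>"
  unfolding locally_null_def
proof (intro CollectI allI impI)
  fix \<epsilon> :: real assume "0 < \<epsilon>"
  then have "0 < \<epsilon> / 2" by simp
  obtain d e where d: "d \<in> D" "\<alpha> d = 1" "norm d \<le> 1" and e: "e \<in> D" "\<beta> e = 1" "norm e \<le> 1"
    and xle: "norm (d * x * e) \<le> \<epsilon> / 2"
    using x \<open>0 < \<epsilon> / 2\<close> unfolding locally_null_def by blast
  obtain d' e' where d': "d' \<in> D" "\<alpha> d' = 1" "norm d' \<le> 1" and e': "e' \<in> D" "\<beta> e' = 1" "norm e' \<le> 1"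
    and yle: "norm (d' * y * e') \<le> \<epsilon> / 2"
    using y \<open>0 < \<epsilon> / 2\<close> unfolding locally_null_def by blast
  have "(d * d') * x * (e * e') = d' * (d * x * e) * e'"
    by (subst comm[OF d(1) d'(1)]) (simp only: mult.assoc)
  moreover have "(d * d') * y * (e * e') = d * (d' * y * e') * e"
    by (subst comm[OF e(1) e'(1)]) (simp only: mult.assoc)
  ultimately have "(d * d') * (x + y) * (e * e') = d' * (d * x * e) * e' + d * (d' * y * e') * e"
    by (simp only: distrib_left distrib_right)
  also have "norm \<dots> \<le> norm (d * x * e) + norm (d' * y * e')"
    using d d' e e' by (intro norm_triangle_mono norm_conjugate_contractions)
  finally have "norm ((d * d') * (x + y) * (e * e')) \<le> \<epsilon>" using xle yle by simp
  moreover have "norm (d * d') \<le> 1" "norm (e * e') \<le> 1"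
    by (rule order_trans[OF norm_mult_ineq mult_le_one[OF d(3) norm_ge_zero d'(3)]],
        rule order_trans[OF norm_mult_ineq mult_le_one[OF e(3) norm_ge_zero e'(3)]])
  moreover have "\<alpha> (d * d') = 1" "\<beta> (e * e') = 1"
    using d d' e e' by (simp_all add: character_mult[OF \<alpha>] character_mult[OF \<beta>])
  ultimately show "\<exists>d\<in>D. \<exists>e\<in>D. \<alpha> d = 1 \<and> \<beta> e = 1 \<and> norm d \<le> 1 \<and> norm e \<le> 1 \<and> norm (d * (x + y) * e) \<le> \<epsilon>"
    using d d' e e' by (intro bexI[of _ "d * d'"] bexI[of _ "e * e'"]) auto
qed

lemma csubspace_locally_null:
  assumes \<alpha>: "\<alpha> \<in> characters D" and \<beta>: "\<beta> \<in> characters D" shows "csubspace (locally_null \<alpha> \<beta>)"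
proof (rule complex_vector.subspaceI)
  show "0 \<in> locally_null \<alpha> \<beta>"
    unfolding locally_null_def using character_one[OF \<alpha>] character_one[OF \<beta>]
    by (auto intro!: bexI[of _ 1])
  show "x + y \<in> locally_null \<alpha> \<beta>" if "x \<in> locally_null \<alpha> \<beta>" "y \<in> locally_null \<alpha> \<beta>" for x y
    by (rule locally_null_add[OF \<alpha> \<beta> that])
  fix c x assume x: "x \<in> locally_null \<alpha> \<beta>"
  show "c *\<^sub>C x \<in> locally_null \<alpha> \<beta>"
    unfolding locally_null_def
  proof (intro CollectI allI impI)
    fix \<epsilon> :: real assume "0 < \<epsilon>"
    then have "0 < \<epsilon> / (cmod c + 1)" by (simp add: add_nonneg_pos)
    then obtain d e where de: "d \<in> D" "e \<in> D" "\<alpha> d = 1" "\<beta> e = 1" "norm d \<le> 1" "norm e \<le> 1"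
      and le: "norm (d * x * e) \<le> \<epsilon> / (cmod c + 1)"
      using x unfolding locally_null_def by blast
    have "norm (d * (c *\<^sub>C x) * e) = cmod c * norm (d * x * e)"
      by (simp add: mult_scaleC_left mult_scaleC_right norm_scaleC)
    also have "\<dots> \<le> (cmod c + 1) * (\<epsilon> / (cmod c + 1))" using le by (intro mult_mono) auto
    also have "\<dots> = \<epsilon>" by (simp add: add_nonneg_eq_0_iff)
    finally show "\<exists>d\<in>D. \<exists>e\<in>D. \<alpha> d = 1 \<and> \<beta> e = 1 \<and> norm d \<le> 1 \<and> norm e \<le> 1 \<and> norm (d * (c *\<^sub>C x) * e) \<le> \<epsilon>"
      using de by blast
  qed
qed

lemma closed_locally_null: "closed (locally_null \<alpha> \<beta>)"
proof -
  have "x \<in> locally_null \<alpha> \<beta>" if x: "x \<in> closure (locally_null \<alpha> \<beta>)" for x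
    unfolding locally_null_def
  proof (intro CollectI allI impI)
    fix \<epsilon> :: real assume "0 < \<epsilon>"
    then have h: "0 < \<epsilon> / 2" by simp
    obtain y where y: "y \<in> locally_null \<alpha> \<beta>" "dist y x < \<epsilon> / 2"
      using x h unfolding closure_approachable by blast
    obtain d e where de: "d \<in> D" "e \<in> D" "\<alpha> d = 1" "\<beta> e = 1" "norm d \<le> 1" "norm e \<le> 1"
      and le: "norm (d * y * e) \<le> \<epsilon> / 2"
      using y(1) h unfolding locally_null_def by blast
    have "d * x * e = d * y * e + d * (x - y) * e" by (simp add: algebra_simps)
    also have "norm \<dots> \<le> \<epsilon> / 2 + \<epsilon> / 2"
    proof (rule norm_triangle_mono[OF le])
      show "norm (d * (x - y) * e) \<le> \<epsilon> / 2"
        using norm_conjugate_contractions[OF de(5,6), of "x - y"] y(2) by (simp add: dist_norm norm_minus_commute)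
    qed
    finally show "\<exists>d\<in>D. \<exists>e\<in>D. \<alpha> d = 1 \<and> \<beta> e = 1 \<and> norm d \<le> 1 \<and> norm e \<le> 1 \<and> norm (d * x * e) \<le> \<epsilon>"
      using de by auto
  qed
  then have "closure (locally_null \<alpha> \<beta>) \<subseteq> locally_null \<alpha> \<beta>" by (rule subsetI)
  then show ?thesis by (simp only: closure_subset_eq)
qed

text \<open>Regularity enters here: if no normalizer is aligned, all elements are locally null, whereas
  \<open>\<phi> (d * m * e) = \<phi> m \<noteq> 0\<close> for all \<open>d\<close>, \<open>e\<close> normalized at \<open>\<alpha>\<close>, \<open>\<beta>\<close>.\<close>

lemma exists_aligned:
  assumes reg: "closure (cspan (normalizers D UNIV)) = UNIV" and M: "bimodule D M"
    and \<phi>: "\<phi> \<in> eigenfunctionals1 D M" and \<alpha>: "\<alpha> \<in> characters D" and \<beta>: "\<beta> \<in> characters D"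
    and left: "\<forall>d\<in>D. \<forall>m\<in>M. \<phi> (d * m) = \<alpha> d * \<phi> m" and right: "\<forall>d\<in>D. \<forall>m\<in>M. \<phi> (m * d) = \<beta> d * \<phi> m"
    and m: "m \<in> M" "\<phi> m \<noteq> 0"
  obtains w where "aligned \<alpha> \<beta> w"
proof -
  have "\<exists>w. aligned \<alpha> \<beta> w"
  proof (rule ccontr)
    assume "\<not> ?thesis"
    then have "normalizers D UNIV \<subseteq> locally_null \<alpha> \<beta>"
      using unaligned_locally_null[OF \<alpha> \<beta>] by blast
    then have "cspan (normalizers D UNIV) \<subseteq> locally_null \<alpha> \<beta>"
      by (rule complex_vector.span_minimal[OF _ csubspace_locally_null[OF \<alpha> \<beta>]])
    then have "closure (cspan (normalizers D UNIV)) \<subseteq> locally_null \<alpha> \<beta>"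
      by (rule closure_minimal[OF _ closed_locally_null])
    then have mnull: "m \<in> locally_null \<alpha> \<beta>" using reg by blast
    have "cmod (\<phi> m) \<le> 0 + \<epsilon>" if \<epsilon>: "0 < \<epsilon>" for \<epsilon>
    proof -
      obtain d e where de: "d \<in> D" "e \<in> D" "\<alpha> d = 1" "\<beta> e = 1" and le: "norm (d * m * e) \<le> \<epsilon>"
        using mnull \<epsilon> unfolding locally_null_def by blast
      have dm: "d * m \<in> M" "d * m * e \<in> M" using M m de by (simp_all add: bimodule_mult)
      have "\<phi> (d * m * e) = \<phi> m" using left right de m dm by simp
      moreover have "cmod (\<phi> (d * m * e)) \<le> norm (d * m * e)"
        using norm_eigenfunctional_le[OF M \<phi> dm(2)] .
      ultimately show ?thesis using le by simp
    qed
    then have "cmod (\<phi> m) \<le> 0" by (rule field_le_epsilon)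
    then show False using m by simp
  qed
  then show thesis using that by blast
qed

context
  fixes M \<phi> \<alpha> \<beta>
  assumes M: "bimodule D M" and closed_M: "closed M" and \<phi>: "\<phi> \<in> eigenfunctionals1 D M"
    and \<alpha>: "\<alpha> \<in> characters D" and \<beta>: "\<beta> \<in> characters D"
    and left: "\<forall>d\<in>D. \<forall>m\<in>M. \<phi> (d * m) = \<alpha> d * \<phi> m" and right: "\<forall>d\<in>D. \<forall>m\<in>M. \<phi> (m * d) = \<beta> d * \<phi> m"
begin

text \<open>Moving \<open>w\<close> inside the average turns each term into \<open>(w h w\<^sup>*) m h\<close> with \<open>w h w\<^sup>* \<in> D\<close>, which lies in \<open>M\<close>
  although \<open>w\<close> need not. Alignment evaluates \<open>\<alpha> (w h w\<^sup>*)\<close> as \<open>\<beta> (w\<^sup>* w) \<beta> h\<close>, so the values of \<open>\<phi>\<close> at the terms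
  add up to \<open>\<beta> (w\<^sup>* w) \<beta> (\<Sum> h\<^sup>2) \<phi> m\<close>.\<close>

lemma eigenfunctional_average:
  fixes t :: "'b set"
  assumes w: "aligned \<alpha> \<beta> w" and h: "\<forall>k\<in>t. h k \<in> D" and one: "(\<Sum>k\<in>t. h k * h k) = 1" and m: "m \<in> M"
  shows "w * (\<Sum>k\<in>t. h k * (adj w * m) * h k) \<in> M"
    and "\<phi> (w * (\<Sum>k\<in>t. h k * (adj w * m) * h k)) = \<beta> (adj w * w) * \<phi> m"
proof -
  have cM: "csubspace M" using M by (simp add: bimodule_def)
  have lin: "\<phi> \<in> linear_functionals M" using \<phi> by (simp add: eigenfunctionals1_def bounded_functionals_def)
  have wn: "normalizer w" and wnz: "\<beta> (adj w * w) \<noteq> 0"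
    and wal: "\<And>d. d \<in> D \<Longrightarrow> \<beta> (adj w * d * w) = \<beta> (adj w * w) * \<alpha> d"
    using w by (auto simp: aligned_def)
  have eq: "w * (\<Sum>k\<in>t. h k * (adj w * m) * h k) = (\<Sum>k\<in>t. (w * h k * adj w) * m * h k)"
    by (simp add: sum_distrib_left mult.assoc)
  have wD: "w * h k * adj w \<in> D" if "k \<in> t" for k using normalizer_mem(1)[OF wn] h that by blast
  have mem: "(w * h k * adj w) * m * h k \<in> M" "(w * h k * adj w) * m \<in> M" if "k \<in> t" for k
    using bimodule_mult(2)[OF M _ bimodule_mult(1)[OF M wD[OF that] m], of "h k"]
      bimodule_mult(1)[OF M wD[OF that] m] h that by blast+
  show "w * (\<Sum>k\<in>t. h k * (adj w * m) * h k) \<in> M"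
    unfolding eq using mem(1) by (rule complex_vector.subspace_sum[OF cM])
  have val: "\<phi> ((w * h k * adj w) * m * h k) = \<beta> (adj w * w) * \<beta> (h k * h k) * \<phi> m" if k: "k \<in> t" for k
  proof -
    have hD: "h k \<in> D" using h k by blast
    have "adj w * (w * h k * adj w) * w = (adj w * w) * h k * (adj w * w)" by (simp only: mult.assoc)
    then have "\<beta> (adj w * w) * \<alpha> (w * h k * adj w) = \<beta> ((adj w * w) * h k * (adj w * w))"
      using wal[OF wD[OF k]] by simp
    also have "\<dots> = \<beta> (adj w * w) * \<beta> (h k) * \<beta> (adj w * w)"
      using normalizer_sq_mem(1)[OF wn] hD by (simp only: character_mult[OF \<beta>] mult_mem)
    finally have "\<alpha> (w * h k * adj w) = \<beta> (adj w * w) * \<beta> (h k)" using wnz by simp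
    then show ?thesis
      using right hD mem(2)[OF k] left wD[OF k] m by (simp only: character_mult[OF \<beta> hD hD]) (simp only: mult_ac)
  qed
  have "\<phi> (\<Sum>k\<in>t. (w * h k * adj w) * m * h k) = (\<Sum>k\<in>t. \<phi> ((w * h k * adj w) * m * h k))"
    using mem(1) by (rule linear_functionals_sum[OF lin cM])
  also have "\<dots> = (\<Sum>k\<in>t. \<beta> (adj w * w) * \<beta> (h k * h k) * \<phi> m)" by (rule sum.cong[OF refl val])
  also have "\<dots> = \<beta> (adj w * w) * (\<Sum>k\<in>t. \<beta> (h k * h k)) * \<phi> m"
    by (simp only: sum_distrib_left sum_distrib_right)
  also have "(\<Sum>k\<in>t. \<beta> (h k * h k)) = \<beta> (\<Sum>k\<in>t. h k * h k)"
    using h by (intro character_sum[OF \<beta>, symmetric]) auto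
  finally show "\<phi> (w * (\<Sum>k\<in>t. h k * (adj w * m) * h k)) = \<beta> (adj w * w) * \<phi> m"
    unfolding eq by (simp add: one character_one[OF \<beta>])
qed

text \<open>The limit of the preceding averages; \<open>M\<close> is closed and \<open>\<phi>\<close> is bounded.\<close>

lemma eigenfunctional_expectation:
  assumes w: "aligned \<alpha> \<beta> w" and m: "m \<in> M"
  shows "w * expectation (adj w * m) \<in> M"
    and "\<phi> (w * expectation (adj w * m)) = \<beta> (adj w * w) * \<phi> m"
proof -
  have cM: "csubspace M" using M by (simp add: bimodule_def)
  have lin: "\<phi> \<in> linear_functionals M" using \<phi> by (simp add: eigenfunctionals1_def bounded_functionals_def)
  have approx: "\<exists>y\<in>M. \<phi> y = \<beta> (adj w * w) * \<phi> m \<and> norm (y - w * expectation (adj w * m)) < \<epsilon>"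
    if \<epsilon>: "0 < \<epsilon>" for \<epsilon>
  proof -
    define \<delta> where "\<delta> = \<epsilon> / (norm w + 1)"
    have \<delta>: "0 < \<delta>" "norm w * \<delta> < \<epsilon>"
      using \<epsilon> by (auto simp: \<delta>_def add_nonneg_pos divide_simps distrib_right mult.commute)
    obtain t :: "'a set" and h where h: "\<forall>k\<in>t. h k \<in> D" and one: "(\<Sum>k\<in>t. h k * h k) = 1"
      and near: "norm ((\<Sum>k\<in>t. h k * (adj w * m) * h k) - expectation (adj w * m)) \<le> \<delta>"
      using average_near_expectation[OF \<delta>(1)] by blast
    let ?T = "\<Sum>k\<in>t. h k * (adj w * m) * h k"
    have "norm (w * ?T - w * expectation (adj w * m)) \<le> norm w * norm (?T - expectation (adj w * m))"
      unfolding right_diff_distrib[symmetric] by (rule norm_mult_ineq)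
    also have "\<dots> \<le> norm w * \<delta>" using near by (rule mult_left_mono) simp
    finally have "norm (w * ?T - w * expectation (adj w * m)) < \<epsilon>" using \<delta>(2) by simp
    then show ?thesis using eigenfunctional_average[OF w h one m] by blast
  qed
  have "w * expectation (adj w * m) \<in> closure M"
    unfolding closure_approachable dist_norm using approx by blast
  then show mem: "w * expectation (adj w * m) \<in> M" using closed_M by simp
  have "cmod (\<phi> (w * expectation (adj w * m)) - \<beta> (adj w * w) * \<phi> m) \<le> 0 + \<epsilon>" if \<epsilon>: "0 < \<epsilon>" for \<epsilon>
  proof -
    obtain y where y: "y \<in> M" "\<phi> y = \<beta> (adj w * w) * \<phi> m" "norm (y - w * expectation (adj w * m)) < \<epsilon>"
      using approx[OF \<epsilon>] by blast
    have "cmod (\<phi> (w * expectation (adj w * m) - y)) \<le> norm (w * expectation (adj w * m) - y)"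
      using complex_vector.subspace_diff[OF cM mem y(1)] by (rule norm_eigenfunctional_le[OF M \<phi>])
    then show ?thesis
      using y by (simp add: linear_functionals_diff[OF lin mem y(1) cM] norm_minus_commute)
  qed
  then have "cmod (\<phi> (w * expectation (adj w * m)) - \<beta> (adj w * w) * \<phi> m) \<le> 0" by (rule field_le_epsilon)
  then show "\<phi> (w * expectation (adj w * m)) = \<beta> (adj w * w) * \<phi> m" by simp
qed

text \<open>If \<open>\<beta> h = 0\<close> for \<open>h = E (w\<^sup>* m)\<close>, then \<open>\<phi> (w h) = \<phi> (w h e)\<close> is small for \<open>e\<close> concentrated near \<open>\<beta>\<close>, although
  it equals \<open>\<beta> (w\<^sup>* w) \<phi> m\<close>.\<close>

lemma character_expectation_nonzero:
  assumes w: "aligned \<alpha> \<beta> w" and m: "m \<in> M" "\<phi> m \<noteq> 0"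
  shows "\<beta> (expectation (adj w * m)) \<noteq> 0"
proof
  let ?h = "expectation (adj w * m)"
  assume 0: "\<beta> ?h = 0"
  have "cmod (\<phi> (w * ?h)) \<le> 0 + \<epsilon>" if \<epsilon>: "0 < \<epsilon>" for \<epsilon>
  proof -
    define \<delta> where "\<delta> = \<epsilon> / (norm w + 1)"
    have \<delta>: "0 < \<delta>" "norm w * \<delta> \<le> \<epsilon>"
      using \<epsilon> by (auto simp: \<delta>_def add_nonneg_pos divide_simps distrib_right mult.commute)
    obtain e where e: "e \<in> D" "\<beta> e = 1" "norm (?h * e) \<le> \<delta>"
      using bump[OF \<beta> expectation_mem 0 \<delta>(1)] by blast
    note wh = eigenfunctional_expectation(1)[OF w m(1)]
    have "\<phi> (w * ?h) = \<phi> (w * ?h * e)" using right e wh by simp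
    also have "cmod \<dots> \<le> norm (w * ?h * e)"
      by (rule norm_eigenfunctional_le[OF M \<phi> bimodule_mult(2)[OF M e(1) wh]])
    also have "\<dots> \<le> norm w * norm (?h * e)" unfolding mult.assoc by (rule norm_mult_ineq)
    also have "\<dots> \<le> norm w * \<delta>" using e(3) by (rule mult_left_mono) simp
    finally show ?thesis using \<delta>(2) by simp
  qed
  then have "cmod (\<phi> (w * ?h)) \<le> 0" by (rule field_le_epsilon)
  moreover have "\<phi> (w * ?h) \<noteq> 0"
    using eigenfunctional_expectation(2)[OF w m(1)] w m by (simp add: aligned_def)
  ultimately show False by simp
qed

end

section \<open>Eigenfunctionals come from intertwiners\<close>

text \<open>\<open>k\<close> is the positive part of \<open>s - c\<close> for \<open>c = \<beta> s / 2\<close>, and \<open>l\<close> is the inverse of \<open>max s c\<close>, which agrees with \<open>s\<close>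
  on the support of \<open>k\<close>.\<close>

lemma cut_off:
  assumes \<beta>: "\<beta> \<in> characters D" and s: "s \<in> D" "positive s" "\<beta> s \<noteq> 0"
  obtains k l where "k \<in> D" "l \<in> D" "s * l * k = k" "\<beta> k \<noteq> 0"
proof -
  have ss: "adj s = s" using s by (simp add: positive_selfadjoint)
  have real: "\<sigma> s = of_real (Re (\<sigma> s))" if "\<sigma> \<in> characters D" for \<sigma>
    using character_selfadjoint_real[OF that s(1) ss] by (simp add: complex_eq_iff)
  define c where "c = Re (\<beta> s) / 2"
  have "\<beta> s \<in> \<real>\<^sub>\<ge>\<^sub>0" by (rule character_positive[OF \<beta> s(2,1)])
  then have c: "0 < c" using s(3) real[OF \<beta>] by (auto simp: c_def complex_nonneg_Reals_iff complex_eq_iff)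
  define b where "b = s - c *\<^sub>R 1"
  have b: "b \<in> D" "adj b = b" using s ss by (auto simp: b_def)
  have \<sigma>b: "Re (\<sigma> b) = Re (\<sigma> s) - c" if "\<sigma> \<in> characters D" for \<sigma>
    using s that by (simp add: b_def character_diff character_scaleR character_one scaleR_mem)
  obtain k where k: "k \<in> D" "adj k = k" and \<sigma>k: "\<And>\<sigma>. \<sigma> \<in> characters D \<Longrightarrow> \<sigma> k = of_real (max 0 (Re (\<sigma> b)))"
    using positive_part[OF b] by blast
  define q where "q = c *\<^sub>R 1 + k"
  have q: "q \<in> D" "adj q = q" using k by (auto simp: q_def adj_add)
  have \<sigma>q: "\<sigma> q = of_real (c + max 0 (Re (\<sigma> s) - c))" if "\<sigma> \<in> characters D" for \<sigma>
    using k that by (simp add: q_def character_add character_scaleR character_one scaleR_mem \<sigma>k \<sigma>b)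
  have "\<sigma> q \<noteq> 0" if "\<sigma> \<in> characters D" for \<sigma>
    unfolding \<sigma>q[OF that] of_real_eq_0_iff using c by simp
  then obtain l where l: "l \<in> D" "q * l = 1" using inverse_from_characters[OF q] by blast
  have "s * l * k = k"
  proof (rule eq_from_characters)
    show "s * l * k \<in> D" "k \<in> D" using s l k by auto
    fix \<sigma> assume \<sigma>: "\<sigma> \<in> characters D"
    have prod: "\<sigma> (s * l * k) = \<sigma> s * \<sigma> l * \<sigma> k" using s l k by (simp add: character_mult[OF \<sigma>] mult_mem)
    show "\<sigma> (s * l * k) = \<sigma> k"
    proof (cases "\<sigma> k = 0")
      case False
      then have "\<sigma> q = \<sigma> s" using real[OF \<sigma>] unfolding \<sigma>q[OF \<sigma>] \<sigma>k[OF \<sigma>] \<sigma>b[OF \<sigma>] by (auto simp: max_def split: if_splits)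
      moreover have "\<sigma> q * \<sigma> l = 1" using character_mult[OF \<sigma> q(1) l(1)] l(2) character_one[OF \<sigma>] by simp
      ultimately show ?thesis by (simp add: prod)
    qed (simp add: prod)
  qed
  moreover have "\<beta> k \<noteq> 0" unfolding \<sigma>k[OF \<beta>] \<sigma>b[OF \<beta>] using c by (simp add: c_def)
  ultimately show thesis using that k l by blast
qed

text \<open>A normalizer satisfies \<open>w d (w\<^sup>* w) = (w d w\<^sup>*) w\<close>, so it intertwines \<open>D\<close> up to the factor \<open>w\<^sup>* w\<close>. On the
  support of \<open>k\<close> this factor has the inverse \<open>l\<close>.\<close>

lemma intertwiner_cut_off:
  assumes w: "normalizer w" and k: "k \<in> D" and l: "l \<in> D" and cut: "adj w * w * l * k = k" and nz: "w * k \<noteq> 0"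
  shows "intertwiner D (w * k)"
proof -
  have k_eq: "k = l * (adj w * w) * k" "k = k * (adj w * w) * l"
    using cut comm[OF l normalizer_sq_mem(1)[OF w]] comm[OF k mult_mem[OF normalizer_sq_mem(1)[OF w] l]]
    by (simp_all add: mult.assoc)
  have 1: "w * k * d = (w * d * l * adj w) * (w * k)" if d: "d \<in> D" for d
  proof -
    have "w * k * d = w * d * k" using comm[OF k d] by (simp add: mult.assoc)
    also have "\<dots> = w * d * (l * (adj w * w) * k)" using k_eq(1) by simp
    finally show ?thesis by (simp add: mult.assoc)
  qed
  have 2: "d * (w * k) = (w * k) * (adj w * d * w * l)" if d: "d \<in> D" for d
  proof -
    have "d * (w * k) = d * w * (k * (adj w * w) * l)" using k_eq(2) by (simp add: mult.assoc)
    also have "\<dots> = (d * (w * k * adj w)) * w * l" by (simp add: mult.assoc)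
    also have "d * (w * k * adj w) = (w * k * adj w) * d" by (rule comm[OF d normalizer_mem(1)[OF w k]])
    finally show ?thesis by (simp add: mult.assoc)
  qed
  have mem: "w * d * l * adj w \<in> D" "adj w * d * w * l \<in> D" if d: "d \<in> D" for d
    using normalizer_mem(1)[OF w mult_mem[OF d l]] mult_mem[OF normalizer_mem(2)[OF w d] l]
    by (simp_all only: mult.assoc)
  have "(\<lambda>d. w * k * d) ` D = (\<lambda>d. d * (w * k)) ` D"
  proof (intro equalityI image_subsetI)
    fix d assume d: "d \<in> D"
    show "w * k * d \<in> (\<lambda>d. d * (w * k)) ` D" by (rule image_eqI[where x = "w * d * l * adj w"]) (use 1 mem d in auto)
    show "d * (w * k) \<in> (\<lambda>d. w * k * d) ` D" by (rule image_eqI[where x = "adj w * d * w * l"]) (use 2 mem d in auto)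
  qed
  then show ?thesis using nz by (simp add: intertwiner_def)
qed

text \<open>The intertwiner is \<open>w k E (w\<^sup>* m\<^sub>0)\<close>, rotated by a phase: the factor \<open>E (w\<^sup>* m\<^sub>0)\<close> places it in \<open>M\<close>, and the
  factor \<open>k\<close> makes it an intertwiner.\<close>

lemma eigenfunctional_is_bracket:
  assumes reg: "closure (cspan (normalizers D UNIV)) = UNIV" and M: "bimodule D M" and closed_M: "closed M"
    and \<phi>: "\<phi> \<in> eigenfunctionals1 D M"
  obtains v \<rho> where "v \<in> M" "\<rho> \<in> characters D" "intertwiner D v" "normalizer v"
    "0 < Re (\<rho> (adj v * v))" "\<phi> = restrict (bracket D v \<rho>) M"
proof -
  have cM: "csubspace M" using M by (simp add: bimodule_def)
  have lin: "\<phi> \<in> linear_functionals M" using \<phi> by (simp add: eigenfunctionals1_def bounded_functionals_def)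
  obtain \<alpha> \<beta> m0 where \<alpha>: "\<alpha> \<in> characters D" and \<beta>: "\<beta> \<in> characters D" and m0: "m0 \<in> M" "\<phi> m0 \<noteq> 0"
    and left: "\<forall>d\<in>D. \<forall>m\<in>M. \<phi> (d * m) = \<alpha> d * \<phi> m" and right: "\<forall>d\<in>D. \<forall>m\<in>M. \<phi> (m * d) = \<beta> d * \<phi> m"
    by (rule eigenfunctional_characters[OF M \<phi>])
  obtain w where w: "aligned \<alpha> \<beta> w" by (rule exists_aligned[OF reg M \<phi> \<alpha> \<beta> left right m0])
  note expectation_facts = eigenfunctional_expectation[OF M closed_M \<phi> \<alpha> \<beta> left right]
  have wn: "normalizer w" and wnz: "\<beta> (adj w * w) \<noteq> 0"
    and wal: "\<And>d. d \<in> D \<Longrightarrow> \<beta> (adj w * d * w) = \<beta> (adj w * w) * \<alpha> d"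
    using w by (auto simp: aligned_def)
  define h where "h = expectation (adj w * m0)"
  have h: "h \<in> D" "w * h \<in> M" "\<beta> h \<noteq> 0"
    unfolding h_def using expectation_mem expectation_facts(1)[OF w m0(1)]
      character_expectation_nonzero[OF M closed_M \<phi> \<alpha> \<beta> left right w m0] by auto
  obtain k l where kl: "k \<in> D" "l \<in> D" "adj w * w * l * k = k" "\<beta> k \<noteq> 0"
    by (rule cut_off[OF \<beta> normalizer_sq_mem(1)[OF wn] positive_adj_mult wnz])
  define q where "q = k * h"
  have q: "q \<in> D" "\<beta> q \<noteq> 0" using kl h by (auto simp: q_def character_mult[OF \<beta>])
  have cut: "adj w * w * l * q = q" unfolding q_def by (subst (2) kl(3)[symmetric]) (simp only: mult.assoc)
  define v where "v = w * q"
  have vM: "v \<in> M"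
    using bimodule_mult(2)[OF M kl(1) h(2)] comm[OF kl(1) h(1)] by (simp add: v_def q_def mult.assoc)
  have conj: "adj v * d * v = adj q * (adj w * d * w) * q" for d by (simp add: v_def adj_mult mult.assoc)
  have vn: "normalizer v"
    unfolding normalizers_def
  proof (intro CollectI conjI ballI UNIV_I)
    fix d assume d: "d \<in> D"
    have "v * d * adj v = w * (q * d * adj q) * adj w" by (simp add: v_def adj_mult mult.assoc)
    also have "\<dots> \<in> D" by (intro normalizer_mem(1)[OF wn] mult_mem adj_mem q d)
    finally show "v * d * adj v \<in> D" .
    show "adj v * d * v \<in> D" unfolding conj by (intro mult_mem adj_mem normalizer_mem(2)[OF wn] q d)
  qed
  have \<beta>v: "\<beta> (adj v * d * v) = \<beta> (adj q * q) * (\<beta> (adj w * w) * \<alpha> d)" if d: "d \<in> D" for d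
  proof -
    have "\<beta> (adj v * d * v) = \<beta> (adj q) * \<beta> (adj w * d * w) * \<beta> q"
      unfolding conj using q normalizer_mem(2)[OF wn d] by (simp only: character_mult[OF \<beta>] mult_mem adj_mem)
    then show ?thesis
      using q by (simp only: wal[OF d] character_mult[OF \<beta> adj_mem[OF q(1)] q(1)]) (simp only: mult_ac)
  qed
  have vv: "\<beta> (adj v * v) = \<beta> (adj q * q) * \<beta> (adj w * w)"
    using \<beta>v[OF one_mem] character_one[OF \<alpha>] by simp
  have vnz: "\<beta> (adj v * v) \<noteq> 0" unfolding vv character_adj_mult[OF \<beta> q(1)] using q(2) wnz by simp
  have va: "aligned \<alpha> \<beta> v" using vn vnz \<beta>v vv by (simp add: aligned_def mult.assoc)
  have v0: "v \<noteq> 0" using vnz character_zero[OF \<beta>] by auto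
  have vi: "intertwiner D v"
    unfolding v_def by (rule intertwiner_cut_off[OF wn q(1) kl(2) cut]) (use v0 in \<open>simp add: v_def\<close>)
  define r where "r = Re (\<beta> (adj v * v))"
  have r: "0 < r" "\<beta> (adj v * v) = of_real r"
    using character_normalizer_sq[OF vn \<beta>] vnz by (auto simp: r_def complex_eq_iff)
  \<comment> \<open>The factor between \<open>\<phi>\<close> and \<open>[v, \<beta>]\<close>, read off from the expectation formula for \<open>v \<in> M\<close> itself.\<close>
  define \<kappa> where "\<kappa> = \<phi> v / of_real (sqrt r)"
  have \<phi>_eq: "\<phi> m = \<kappa> * bracket D v \<beta> m" if m: "m \<in> M" for m
  proof -
    have "of_real r * \<phi> m = \<phi> (v * expectation (adj v * m))"
      using expectation_facts(2)[OF va m] r by simp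
    also have "\<dots> = state_extension \<beta> (adj v * m) * \<phi> v"
      using right expectation_mem vM by (simp add: character_expectation[OF \<beta>])
    finally have "\<phi> m = \<phi> v * state_extension \<beta> (adj v * m) / of_real r"
      using r(1) by (simp add: field_simps)
    also have "complex_of_real r = of_real (sqrt r) * of_real (sqrt r)"
      using r(1) by (simp flip: of_real_mult)
    finally show ?thesis by (simp add: \<kappa>_def bracket_eq[OF vn \<beta>] flip: r_def)
  qed
  have "cmod \<kappa> = 1"
  proof (rule antisym)
    have br: "restrict (bracket D v \<beta>) M \<in> eigenfunctionals1 D M"
      using vM vn r(1) by (intro bracket_eigenfunctional[OF M _ \<beta>]) (auto simp: normalizers_def r_def)
    have n\<phi>: "functional_norm M \<phi> = 1" and nbr: "functional_norm M (restrict (bracket D v \<beta>) M) = 1"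
      using \<phi> br by (simp_all add: eigenfunctionals1_def)
    have "functional_norm M \<phi> \<le> cmod \<kappa>"
    proof (rule functional_norm_le[OF complex_vector.subspace_0[OF cM]])
      show "cmod (\<phi> x) \<le> cmod \<kappa> * norm x" if "x \<in> M" for x
        using norm_bracket_le[OF vn \<beta>, of x] r(1) by (simp add: \<phi>_eq[OF that] norm_mult r_def mult_left_mono)
    qed simp
    then show \<kappa>1: "1 \<le> cmod \<kappa>" using n\<phi> by simp
    have "functional_norm M (restrict (bracket D v \<beta>) M) \<le> 1 / cmod \<kappa>"
    proof (rule functional_norm_le[OF complex_vector.subspace_0[OF cM]])
      show "cmod (restrict (bracket D v \<beta>) M x) \<le> 1 / cmod \<kappa> * norm x" if x: "x \<in> M" for x
      proof -
        have "cmod \<kappa> * cmod (bracket D v \<beta> x) \<le> norm x"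
          using norm_eigenfunctional_le[OF M \<phi> x] by (simp add: \<phi>_eq[OF x] norm_mult)
        moreover have "0 < cmod \<kappa>" using \<kappa>1 by linarith
        ultimately show ?thesis using x by (simp add: field_simps)
      qed
    qed simp
    then have "1 \<le> 1 / cmod \<kappa>" using nbr by simp
    then show "cmod \<kappa> \<le> 1" using \<kappa>1 by (simp add: le_divide_eq split: if_splits)
  qed
  define u where "u = cnj \<kappa> *\<^sub>C v"
  have \<kappa>\<kappa>: "\<kappa> * cnj \<kappa> = 1" using \<open>cmod \<kappa> = 1\<close> complex_norm_square[of \<kappa>] by simp
  have au: "adj u = \<kappa> *\<^sub>C adj v" by (simp add: u_def adj_scaleC)
  have conj_u: "adj u * d * u = adj v * d * v" "u * d * adj u = v * d * adj v" for d
    using \<kappa>\<kappa> unfolding au unfolding u_def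
    by (simp_all add: mult_scaleC_left mult_scaleC_right scaleC_scaleC scaleC_one mult.commute[of "cnj \<kappa>"])
  have uu: "adj u * u = adj v * v" using conj_u(1)[of 1] by simp
  have un: "normalizer u" using vn by (simp add: normalizers_def conj_u)
  show thesis
  proof (rule that[OF _ \<beta> _ un])
    show "u \<in> M" unfolding u_def by (rule complex_vector.subspace_scale[OF cM vM])
    show "intertwiner D u"
    proof -
      have "u \<noteq> 0" using uu vnz character_zero[OF \<beta>] by auto
      moreover have "(\<lambda>d. u * d) ` D = (\<lambda>x. cnj \<kappa> *\<^sub>C x) ` (\<lambda>d. v * d) ` D"
        "(\<lambda>d. d * u) ` D = (\<lambda>x. cnj \<kappa> *\<^sub>C x) ` (\<lambda>d. d * v) ` D"
        by (simp_all add: u_def image_image mult_scaleC_left mult_scaleC_right)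
      ultimately show ?thesis using vi by (simp add: intertwiner_def)
    qed
    show "0 < Re (\<beta> (adj u * u))" using r by (simp add: uu)
    show "\<phi> = restrict (bracket D u \<beta>) M"
    proof (rule extensionalityI[of _ M])
      show "\<phi> \<in> extensional M" using lin by (simp add: linear_functionals_def)
      fix x assume x: "x \<in> M"
      have "bracket D u \<beta> x = \<kappa> * bracket D v \<beta> x"
        unfolding bracket_eq[OF un \<beta>] bracket_eq[OF vn \<beta>] uu unfolding au
        by (simp add: mult_scaleC_left state_extension_scaleC[OF \<beta>])
      then show "\<phi> x = restrict (bracket D u \<beta>) M x" using x \<phi>_eq[OF x] by simp
    qed simp
  qed
qed

end

theorem theorem4p14:
  fixes D M :: "'a :: cstar_algebra set"
  assumes "regular_inclusion D"
    and "closed M" and "bimodule D M"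
  shows "(\<forall>\<phi> \<in> eigenfunctionals1 D M.
            \<exists>v\<in>M. \<exists>\<rho>\<in>characters D.
              intertwiner D v \<and> bracket_defined D v \<rho> \<and> \<phi> = restrict (bracket D v \<rho>) M) \<and>
         (\<forall>v \<in> normalizers D M. \<forall>\<rho>\<in>characters D.
            Re (character_state D \<rho> (adj v * v)) > 0 \<longrightarrow>
              restrict (bracket D v \<rho>) M \<in> eigenfunctionals1 D M)"
proof -
  interpret extension_property_inclusion D
    using assms(1)
    by unfold_locales
      (auto simp: regular_inclusion_def maximal_abelian_cstar_subalgebra_def abelian_cstar_subalgebra_def)
  have reg: "closure (cspan (normalizers D UNIV)) = UNIV" using assms(1) by (simp add: regular_inclusion_def)
  have sq: "character_state D \<rho> (adj v * v) = \<rho> (adj v * v)" if "normalizer v" "\<rho> \<in> characters D" for v \<rho>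
    using normalizer_sq_mem(1)[OF that(1)] by (simp add: character_state_eq[OF that(2)] state_extension_eq[OF that(2)])
  show ?thesis
  proof (intro conjI ballI impI)
    fix \<phi> assume "\<phi> \<in> eigenfunctionals1 D M"
    from eigenfunctional_is_bracket[OF reg assms(3,2) this]
    obtain v \<rho> where "v \<in> M" "\<rho> \<in> characters D" "intertwiner D v" "normalizer v"
      "0 < Re (\<rho> (adj v * v))" "\<phi> = restrict (bracket D v \<rho>) M" .
    then show "\<exists>v\<in>M. \<exists>\<rho>\<in>characters D.
        intertwiner D v \<and> bracket_defined D v \<rho> \<and> \<phi> = restrict (bracket D v \<rho>) M"
      using sq by (intro bexI[of _ v] bexI[of _ \<rho>]) (auto simp: bracket_defined_def)
  next
    fix v \<rho> assume v: "v \<in> normalizers D M" and \<rho>: "\<rho> \<in> characters D"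
      and "0 < Re (character_state D \<rho> (adj v * v))"
    moreover have "normalizer v" using v by (simp add: normalizers_def)
    ultimately show "restrict (bracket D v \<rho>) M \<in> eigenfunctionals1 D M"
      using sq by (intro bracket_eigenfunctional[OF assms(3) v \<rho>]) simp
  qed
qed

end
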